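(* Let $a,b,c\in i\mathbb{R}$ be purely imaginary numbers and let $$Z^{abc}(s)=\prod_{p\text{ prime}}\left(1-(p^a+p^b)p^{-s}+p^{c-2s}\right)^{-1},$$ an Euler product converging absolutely for $\operatorname{Re}(s)>1$. If $a+b\neq c$, then $Z^{abc}(s)$ has an analytic continuation to $\operatorname{Re}(s)>0$ as a meromorphic function, and the line $\operatorname{Re}(s)=0$ is a natural boundary. More precisely, every point on $\operatorname{Re}(s)=0$ is a limit point of poles of (the continuation of) $Z^{abc}(s)$ lying in $\operatorname{Re}(s)>0$.
   Context: For $p$ prime and $z\in\mathbb{C}$, $p^{z}=e^{z\log p}$. *)

theory Defs
  imports
    "HOL-Complex_Analysis.Complex_Analysis"
    "HOL-Computational_Algebra.Primes"
begin

text \<open>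
  For a prime \<open>p\<close>, \<open>of_nat p powr z\<close> is \<open>exp (z * ln p)\<close> with the real logarithm of \<open>p\<close>.
\<close>

definition local_poly :: "complex \<Rightarrow> complex \<Rightarrow> complex \<Rightarrow> nat \<Rightarrow> complex \<Rightarrow> complex" where
  "local_poly a b c p s =
     1 - (of_nat p powr a + of_nat p powr b) * of_nat p powr (- s) + of_nat p powr (c - 2 * s)"

text \<open>
  A product over the primes is written as a product over \<open>nat\<close> with factor \<open>1\<close> at
  non-primes.  The polynomial at \<open>p = 2\<close> (and no other) can vanish at some \<open>s\<close> with
  \<open>Re s > 1\<close>, for instance at \<open>2 powr (-s) = sqrt 2 - 1\<close> when \<open>a = b = 0\<close> and
  \<open>2 powr c = -1\<close>.  Such an \<open>s\<close> is a pole of the product; the factor, and hence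
  \<open>Z_abc\<close>, then has the value \<open>0\<close> there, which is also the value that
  \<open>nicely_meromorphic_on\<close> prescribes at a pole.  Convergence of an infinite product is not
  affected by a single factor.
\<close>

definition euler_factor :: "complex \<Rightarrow> complex \<Rightarrow> complex \<Rightarrow> complex \<Rightarrow> nat \<Rightarrow> complex" where
  "euler_factor a b c s n = (if prime n then inverse (local_poly a b c n s) else 1)"

definition Z_abc :: "complex \<Rightarrow> complex \<Rightarrow> complex \<Rightarrow> complex \<Rightarrow> complex" where
  "Z_abc a b c s = prodinf (euler_factor a b c s)"

text \<open>
  No point of \<open>L\<close> has a neighbourhood to which \<open>F\<close>, given on \<open>D\<close>, extends meromorphically.
  Agreement is only required off a sparse set, since values at isolated points are
  irrelevant for meromorphic functions.
\<close>

definition natural_boundary :: "(complex \<Rightarrow> complex) \<Rightarrow> complex set \<Rightarrow> complex set \<Rightarrow> bool" where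
  "natural_boundary F D L \<longleftrightarrow>
     L \<subseteq> frontier D \<and>
     (\<forall>z\<in>L. \<not> (\<exists>U G. open U \<and> z \<in> U \<and> G meromorphic_on U \<and> (\<forall>\<^sub>\<approx>w\<in>U \<inter> D. G w = F w)))"

end

theory Submission
  imports Defs "HOL-Real_Asymp.Real_Asymp"
begin

text \<open>
  Multiplying the local polynomial \<open>1 - (p^a + p^b) u + p^c u^2\<close> by finitely many factors
  \<open>(1 - p^w u^n)^(+1 or -1)\<close>, with \<open>n \<le> N\<close> and \<open>w = i a + j b + k c\<close> for
  \<open>i + j + 2 k = n\<close>, one reaches \<open>1 + O(u^(N+1))\<close> uniformly in \<open>p\<close>. The corrected product
  converges for \<open>Re s > 1/(N+1)\<close>, and the correction is a product of powers of
  \<open>zeta (n s - w)\<close>; letting \<open>N\<close> grow gives the continuation.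

  A zero \<open>s\<close> of a local polynomial is a pole of the continuation unless some \<open>zeta (n s - w)\<close>
  vanishes or has its pole at \<open>s\<close>. By Jensen's inequality the number of such exceptional points
  of bounded height with \<open>Re s \<ge> 1/N\<close> is polynomial in \<open>N\<close>. If \<open>a + b \<noteq> c\<close>, then for many
  primes one root of the quadratic has modulus at most \<open>8/9\<close>, so its zeros have real part
  at least \<open>ln (9/8) / ln p\<close> and form a vertical progression of step \<open>2 pi / ln p\<close>. Two
  consecutive zeros determine \<open>p\<close>. If there were no poles near some point of the line, both would be
  exceptional, hence the number of these primes with \<open>ln p \<le> ln (9/8) N\<close> would be polynomial
  in \<open>N\<close>, and the sum of their reciprocals would converge. That sum diverges, as the inequality
  \<open>3 + 4 cos x + cos 2x \<ge> 0\<close> and the boundedness of \<open>zeta (\<sigma> + i t)\<close> as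
  \<open>\<sigma>\<close> tends to \<open>1\<close>, for fixed nonzero \<open>t\<close>, show.
\<close>

text \<open>The obstacle is cancellation: a zero of a local polynomial gives no pole if it meets a
  zero or the pole of some \<open>zeta (n s - w)\<close>, and little is known about zeros of zeta in
  the strip. It is overcome by counting alone. The number of correcting factors is not controlled in
  \<open>N\<close>, but cancellation depends only on which pairs \<open>(n, w)\<close> occur, and
  there are only O(n^2) shifts \<open>w\<close> in degree \<open>n\<close>. One zero per prime would
  not do for the count, since local polynomials of different primes may share a zero; a pair of
  neighbouring zeros carries \<open>p\<close> with it, in the difference
  \<open>2 pi i / ln p\<close>.

  The condition on \<open>a + b - c\<close> comes from the quadratic. With A, B, C for p^a, p^b,
  p^c, both roots lie on the unit circle if AB = C or A + B = 0, and |A + B| |AB - C| measures how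
  far one is from this. Its square is a trigonometric polynomial in \<open>ln p\<close>, whose
  weighted mean over the primes stays positive when \<open>a + b - c\<close> is a nonzero imaginary
  number.\<close>

lemma norm_of_nat_powr: "norm (of_nat n powr z :: complex) = real n powr Re z"
  using norm_powr_real_powr[of "of_nat n" z] by simp

lemma of_nat_mult_powr:
  "(of_nat (m * n) :: complex) powr z = of_nat m powr z * of_nat n powr z"
  using powr_times_real[of "of_nat m" "of_nat n" z] by simp

lemma norm_powr_segment_le:
  fixes z s :: complex
  assumes n: "n > 0" and z: "z \<in> closed_segment (of_nat n) (of_nat (Suc n))" and s: "Re s \<le> 0"
  shows "norm (z powr s) \<le> real n powr Re s" "z \<notin> \<real>\<^sub>\<le>\<^sub>0" "norm (z - of_nat n) \<le> 1"
proof -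
  from z obtain u where u: "0 \<le> u" "u \<le> 1"
    and z_eq: "z = (1 - u) *\<^sub>R of_nat n + u *\<^sub>R of_nat (Suc n)"
    by (auto simp: closed_segment_def)
  have z2: "z = of_real (real n + u)"
    by (simp add: z_eq scaleR_conv_of_real algebra_simps)
  have "norm (z powr s) = (real n + u) powr Re s"
    using norm_powr_real_powr[of z s] u by (simp add: z2)
  also have "\<dots> \<le> real n powr Re s"
    using n u s by (intro powr_mono2') auto
  finally show "norm (z powr s) \<le> real n powr Re s" .
  show "z \<notin> \<real>\<^sub>\<le>\<^sub>0"
    unfolding z2 using n u by (simp add: complex_nonpos_Reals_iff)
  have "z - of_nat n = of_real u" by (simp add: z2)
  thus "norm (z - of_nat n) \<le> 1" using u by simp
qed

subsection \<open>The Riemann zeta function on the right half plane\<close>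

definition zeta_term :: "nat \<Rightarrow> complex \<Rightarrow> complex" where
  "zeta_term n s = (s - 1) * of_nat n powr (-s) - of_nat n powr (1 - s) + of_nat (Suc n) powr (1 - s)"

text \<open>The term is \<open>s - 1\<close> times the error made when \<open>x powr (-s)\<close> is replaced by its
  value at \<open>n\<close> in the integral over \<open>{n..n+1}\<close>; hence \<open>xi\<close> below is \<open>(s - 1) * zeta s\<close>.\<close>

definition xi :: "complex \<Rightarrow> complex" where
  "xi s = 1 + (\<Sum>k. zeta_term (Suc k) s)"

text \<open>The mean value inequality is used twice on the real segment from \<open>n\<close> to
  \<open>n + 1\<close>: the term is the increment of a function \<phi> whose derivative is
  \<open>s - 1\<close> times a difference of values of \<open>w powr (-s)\<close>, and that
  difference is estimated by a derivative again. The second use produces the exponent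
  \<open>-1 - Re s\<close>, summable for every \<open>Re s > 0\<close>.\<close>

lemma norm_zeta_term_le:
  assumes n: "n > 0" and s: "Re s > 0"
  shows "norm (zeta_term n s) \<le> norm (s - 1) * norm s * real n powr (-1 - Re s)"
proof -
  define S where "S = closed_segment (of_nat n :: complex) (of_nat (Suc n))"
  define B where "B = norm s * real n powr (-1 - Re s)"
  have inS: "of_nat n \<in> S" "of_nat (Suc n) \<in> S" unfolding S_def by auto
  have cS: "convex S" unfolding S_def by simp
  have B: "norm (z powr (-s) - of_nat n powr (-s)) \<le> B" if z: "z \<in> S" for z
  proof -
    have "norm (z powr (-s) - of_nat n powr (-s)) \<le> B * norm (z - of_nat n)"
    proof (rule field_differentiable_bound[OF cS _ _ z inS(1)])
      fix w assume w: "w \<in> S"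
      note W = norm_powr_segment_le[OF n w[unfolded S_def]]
      show "((\<lambda>w. w powr (-s)) has_field_derivative (-s) * w powr (-s - 1)) (at w within S)"
        by (rule has_field_derivative_at_within[OF has_field_derivative_powr[OF W(2)[of 0]]]) simp
      show "norm ((-s) * w powr (-s - 1)) \<le> B"
        using W(1)[of "-s - 1"] s unfolding B_def
        by (simp add: norm_mult mult_left_mono minus_diff_commute)
    qed
    also have "\<dots> \<le> B * 1"
      using norm_powr_segment_le(3)[OF n z[unfolded S_def], of 0] unfolding B_def
      by (intro mult_left_mono) auto
    finally show ?thesis by simp
  qed
  define \<phi> where "\<phi> z = (s - 1) * of_nat n powr (-s) * (z - of_nat n) + z powr (1 - s)" for z
  have "norm (\<phi> (of_nat (Suc n)) - \<phi> (of_nat n))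
        \<le> norm (s - 1) * B * norm (of_nat (Suc n) - of_nat n :: complex)"
  proof (rule field_differentiable_bound[OF cS _ _ inS(2,1)])
    fix w assume w: "w \<in> S"
    note W = norm_powr_segment_le[OF n w[unfolded S_def]]
    have "((\<lambda>w. w powr (1-s)) has_field_derivative (1-s) * w powr (1-s - 1)) (at w within S)"
      by (rule has_field_derivative_at_within[OF has_field_derivative_powr[OF W(2)[of 0]]]) simp
    hence D: "((\<lambda>w. w powr (1-s)) has_field_derivative (1-s) * w powr (-s)) (at w within S)"
      by simp
    show "(\<phi> has_field_derivative (s - 1) * (of_nat n powr (-s) - w powr (-s))) (at w within S)"
      unfolding \<phi>_def by (rule derivative_eq_intros D refl | simp)+ (simp add: algebra_simps)
    show "norm ((s - 1) * (of_nat n powr (-s) - w powr (-s))) \<le> norm (s - 1) * B"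
      using B[OF w] by (simp add: norm_mult norm_minus_commute mult_left_mono)
  qed
  moreover have "\<phi> (of_nat (Suc n)) - \<phi> (of_nat n) = zeta_term n s"
    by (simp add: \<phi>_def zeta_term_def)
  ultimately show ?thesis by (simp add: B_def mult.assoc)
qed

text \<open>Comparison with the integral of \<open>z powr (-1 - x)\<close>, by the mean value
  theorem in each step so that the bounds telescope. The explicit \<open>1 + 1 / x\<close> keeps
  later bounds polynomial in \<open>N\<close> when \<open>x\<close> is of size
  \<open>1 / N\<close>.\<close>

lemma sum_powr_le:
  fixes x :: real
  assumes "x > 0"
  shows "summable (\<lambda>k. real (Suc k) powr (-1 - x))"
        "(\<Sum>k. real (Suc k) powr (-1 - x)) \<le> 1 + 1 / x"
proof -
  show S: "summable (\<lambda>k. real (Suc k) powr (-1 - x))"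
    using assms summable_real_powr_iff[of "-1 - x"]
    by (subst summable_Suc_iff[of "\<lambda>k. real k powr (-1 - x)"]) simp
  have step: "real (Suc (Suc k)) powr (-1 - x) \<le> (real (Suc k) powr (-x) - real (Suc (Suc k)) powr (-x)) / x" for k
  proof -
    have "((\<lambda>z. z powr (-x)) has_real_derivative -x * z powr (-x - 1)) (at z)"
      if "real (Suc k) \<le> z" for z
      using that by (intro has_real_derivative_powr) auto
    from MVT2[of "real (Suc k)" "real (Suc (Suc k))", OF _ this]
    obtain z where z: "real (Suc k) < z" "z < real (Suc (Suc k))"
      "real (Suc (Suc k)) powr (-x) - real (Suc k) powr (-x)
        = (real (Suc (Suc k)) - real (Suc k)) * (-x * z powr (-x - 1))"
      by auto
    have "real (Suc (Suc k)) powr (-1 - x) \<le> z powr (-1 - x)"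
      using z assms by (intro powr_mono2') auto
    also have "\<dots> = (real (Suc k) powr (-x) - real (Suc (Suc k)) powr (-x)) / x"
    proof -
      have "-x - 1 = -1 - x" by simp
      with z(3) have "real (Suc (Suc k)) powr (-x) - real (Suc k) powr (-x) = -x * z powr (-1 - x)"
        by simp
      thus ?thesis using assms by (simp add: field_simps)
    qed
    finally show ?thesis .
  qed
  \<comment> \<open>Keeping the telescoped remainder \<open>real n powr (-x)\<close> makes the
    estimate inductive.\<close>
  have pos: "(\<Sum>k<n. real (Suc k) powr (-1 - x)) \<le> 1 + (1 - real n powr (-x)) / x" if "n > 0" for n
    using that
  proof (induction n rule: nat_induct_non_zero)
    case (Suc n)
    then obtain m where m: "n = Suc m" by (cases n) auto
    show ?case using Suc step[of m] assms unfolding m by (simp add: field_simps)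
  qed simp
  have "(\<Sum>k<n. real (Suc k) powr (-1 - x)) \<le> 1 + 1 / x" for n
  proof (cases "n = 0")
    case False
    hence "(\<Sum>k<n. real (Suc k) powr (-1 - x)) \<le> 1 + (1 - real n powr (-x)) / x" by (intro pos) simp
    also have "\<dots> \<le> 1 + 1 / x" using assms by (intro add_left_mono divide_right_mono) auto
    finally show ?thesis .
  qed (use assms in simp)
  thus "(\<Sum>k. real (Suc k) powr (-1 - x)) \<le> 1 + 1 / x"
    by (intro suminf_le_const[OF S]) auto
qed

lemma summable_zeta_term:
  assumes "Re s > 0"
  shows "summable (\<lambda>k. norm (zeta_term (Suc k) s))"
proof (rule summable_comparison_test')
  show "summable (\<lambda>k. norm (s - 1) * norm s * real (Suc k) powr (-1 - Re s))"
    by (intro summable_mult sum_powr_le assms)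
  show "norm (norm (zeta_term (Suc k) s)) \<le> norm (s - 1) * norm s * real (Suc k) powr (-1 - Re s)" for k
    using norm_zeta_term_le[OF _ assms, of "Suc k"] by simp
qed

text \<open>Growth that is polynomial in \<open>norm s\<close> and \<open>1 / e\<close> is what
  Jensen's inequality turns into a polynomial count of zeros.\<close>

lemma norm_xi_le:
  assumes "Re s \<ge> e" "e > 0"
  shows "norm (xi s) \<le> 1 + norm (s - 1) * norm s * (1 + 1 / e)"
proof -
  have s: "Re s > 0" using assms by linarith
  note S = summable_zeta_term[OF s]
  have "norm (xi s) \<le> 1 + norm (\<Sum>k. zeta_term (Suc k) s)"
    unfolding xi_def by (metis norm_one norm_triangle_ineq)
  also have "norm (\<Sum>k. zeta_term (Suc k) s) \<le> (\<Sum>k. norm (zeta_term (Suc k) s))"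
    by (rule summable_norm[OF S])
  also have "\<dots> \<le> (\<Sum>k. norm (s - 1) * norm s * real (Suc k) powr (-1 - Re s))"
    by (intro suminf_le S norm_zeta_term_le summable_mult sum_powr_le s zero_less_Suc)
  also have "\<dots> = norm (s - 1) * norm s * (\<Sum>k. real (Suc k) powr (-1 - Re s))"
    by (intro suminf_mult sum_powr_le s)
  also have "\<dots> \<le> norm (s - 1) * norm s * (1 + 1 / Re s)"
    by (intro mult_left_mono sum_powr_le s) auto
  also have "\<dots> \<le> norm (s - 1) * norm s * (1 + 1 / e)"
    using assms s by (intro mult_left_mono add_left_mono divide_left_mono) auto
  finally show ?thesis by simp
qed

lemma holomorphic_xi: "xi holomorphic_on {s. Re s > 0}"
proof -
  have "(\<lambda>s. \<Sum>k. zeta_term (Suc k) s) holomorphic_on {s. Re s > 0}"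
  proof (rule holomorphic_uniform_sequence[where f = "\<lambda>n s. \<Sum>k<n. zeta_term (Suc k) s"])
    show "open {s. Re s > 0}" by (simp add: open_halfspace_Re_gt)
    show "(\<lambda>s. \<Sum>k<n. zeta_term (Suc k) s) holomorphic_on {s. Re s > 0}" for n
      unfolding zeta_term_def by (intro holomorphic_intros)
    fix s :: complex assume "s \<in> {s. Re s > 0}"
    hence s: "Re s > 0" by simp
    define d where "d = Re s / 2"
    have d: "d > 0" using s by (simp add: d_def)
    have re: "Re w \<ge> d" if "w \<in> cball s d" for w
    proof -
      have "\<bar>Re (s - w)\<bar> \<le> d"
        using that abs_Re_le_cmod[of "s - w"] by (simp add: dist_norm)
      thus ?thesis unfolding d_def minus_complex.sel by linarith
    qed
    define C where "C = (norm s + d + 1) * (norm s + d)"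
    have "uniform_limit (cball s d) (\<lambda>n s. \<Sum>k<n. zeta_term (Suc k) s) (\<lambda>s. \<Sum>k. zeta_term (Suc k) s) sequentially"
    proof (rule Weierstrass_m_test)
      fix k w assume w: "w \<in> cball s d"
      have nw: "norm w \<le> norm s + d" "norm (w - 1) \<le> norm s + d + 1"
        using w norm_triangle_ineq2[of w s] norm_triangle_ineq4[of w 1]
        by (auto simp: dist_norm norm_minus_commute)
      have "norm (zeta_term (Suc k) w) \<le> norm (w - 1) * norm w * real (Suc k) powr (-1 - Re w)"
        using re[OF w] d by (intro norm_zeta_term_le) auto
      also have "\<dots> \<le> C * real (Suc k) powr (-1 - d)"
        unfolding C_def using nw re[OF w] d by (intro mult_mono powr_mono) auto
      finally show "norm (zeta_term (Suc k) w) \<le> C * real (Suc k) powr (-1 - d)" .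
    qed (intro summable_mult sum_powr_le d)
    thus "\<exists>d>0. cball s d \<subseteq> {s. 0 < Re s} \<and>
      uniform_limit (cball s d) (\<lambda>n s. \<Sum>k<n. zeta_term (Suc k) s) (\<lambda>s. \<Sum>k. zeta_term (Suc k) s) sequentially"
      using d re by (intro exI[of _ d]) fastforce
  qed
  thus ?thesis unfolding xi_def by (intro holomorphic_intros)
qed

lemma summable_norm_powr:
  assumes "Re s > 1"
  shows "summable (\<lambda>n. norm (of_nat n powr (-s) :: complex))"
  using assms summable_real_powr_iff[of "- Re s"] by (simp add: norm_of_nat_powr)

text \<open>For \<open>Re s > 1\<close> the parts of \<open>zeta_term\<close> may be summed
  separately. The difference telescopes to \<open>-1\<close>, which the leading \<open>1\<close> of
  \<open>xi\<close> absorbs. Index \<open>0\<close> contributes nothing because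
  \<open>0 powr z = 0\<close>.\<close>

lemma xi_eq:
  assumes s: "Re s > 1"
  shows "xi s = (s - 1) * (\<Sum>n. of_nat n powr (-s))"
proof -
  have S: "summable (\<lambda>n. of_nat n powr (-s) :: complex)"
    using summable_norm_cancel[OF summable_norm_powr[OF s]] .
  hence "(\<lambda>n. of_nat (Suc n) powr (-s) :: complex) sums ((\<Sum>n. of_nat n powr (-s)) - of_nat 0 powr (-s))"
    by (subst sums_Suc_iff) auto
  hence 1: "(\<lambda>k. (s - 1) * of_nat (Suc k) powr (-s)) sums ((s - 1) * (\<Sum>n. of_nat n powr (-s)))"
    by (intro sums_mult) simp
  have "(\<lambda>k. norm (of_nat (Suc k) powr (1 - s) :: complex)) \<longlonglongrightarrow> 0"
  proof -
    have "((\<lambda>n. real n powr (1 - Re s)) \<longlongrightarrow> 0) at_top"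
      using s by (intro tendsto_neg_powr filterlim_real_sequentially) auto
    hence "(\<lambda>n. real (Suc n) powr (1 - Re s)) \<longlonglongrightarrow> 0"
      by (subst filterlim_sequentially_Suc)
    thus ?thesis unfolding norm_of_nat_powr by simp
  qed
  hence "(\<lambda>k. of_nat (Suc k) powr (1 - s) :: complex) \<longlonglongrightarrow> 0"
    by (rule tendsto_norm_zero_cancel)
  hence 2: "(\<lambda>k. of_nat (Suc (Suc k)) powr (1 - s) - of_nat (Suc k) powr (1 - s) :: complex) sums (0 - of_nat (Suc 0) powr (1 - s))"
    by (rule telescope_sums)
  have "(\<lambda>k. zeta_term (Suc k) s) sums ((s - 1) * (\<Sum>n. of_nat n powr (-s)) + (0 - of_nat (Suc 0) powr (1 - s)))"
    using sums_add[OF 1 2] by (simp add: zeta_term_def algebra_simps)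
  thus ?thesis by (simp add: xi_def sums_iff)
qed

section \<open>The Euler product by sieving\<close>

text \<open>The sieve of Eratosthenes: among the numbers with no prime factor below a prime
  \<open>N\<close>, the multiples of \<open>N\<close> are exactly \<open>N\<close> times the same
  set, so by multiplicativity deleting them multiplies the sum by \<open>1 - f N\<close>.\<close>

lemma sieve_infsum:
  fixes f :: "nat \<Rightarrow> complex"
  assumes f: "f summable_on UNIV" and f0: "f 0 = 0" and mult: "\<And>m n. f (m * n) = f m * f n"
  shows "infsum f {n. n > 0 \<and> (\<forall>p. prime p \<and> p < N \<longrightarrow> \<not> p dvd n)}
         = (\<Prod>p<N. if prime p then 1 - f p else 1) * infsum f UNIV"
proof (induction N)
  case 0
  have "infsum f {n. n > 0} = infsum f UNIV"
    using f0 by (intro infsum_cong_neutral) auto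
  thus ?case by simp
next
  case (Suc N)
  define A where "A M = {n::nat. n > 0 \<and> (\<forall>p. prime p \<and> p < M \<longrightarrow> \<not> p dvd n)}" for M
  show ?case
  proof (cases "prime N")
    case False
    hence "A (Suc N) = A N" unfolding A_def by (auto simp: less_Suc_eq)
    thus ?thesis using Suc False unfolding A_def by simp
  next
    case True
    have eq: "A N = A (Suc N) \<union> (\<lambda>n. N * n) ` A N"
    proof (intro equalityI subsetI)
      fix n assume n: "n \<in> A N"
      show "n \<in> A (Suc N) \<union> (\<lambda>n. N * n) ` A N"
      proof (cases "N dvd n")
        case True
        then obtain m where m: "n = N * m" by auto
        with n have "m \<in> A N" unfolding A_def by auto
        thus ?thesis using m by blast
      qed (use n in \<open>auto simp: A_def less_Suc_eq\<close>)
    next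
      fix n assume "n \<in> A (Suc N) \<union> (\<lambda>n. N * n) ` A N"
      thus "n \<in> A N"
      proof
        assume "n \<in> (\<lambda>n. N * n) ` A N"
        then obtain m where m: "n = N * m" "m \<in> A N" by auto
        have "\<not> p dvd n" if "prime p" "p < N" for p
          using that m True unfolding A_def
          by (auto simp: prime_dvd_mult_iff dest: primes_dvd_imp_eq)
        thus ?thesis using m True unfolding A_def by (auto simp: prime_gt_0_nat)
      qed (auto simp: A_def)
    qed
    have inj: "inj_on (\<lambda>n. N * n) (A N)"
      using True by (auto simp: inj_on_def)
    have sub: "f summable_on B" for B
      using summable_on_subset_banach[OF f] by auto
    have "infsum f (A N) = infsum f (A (Suc N)) + infsum f ((\<lambda>n. N * n) ` A N)"
      by (subst eq, rule infsum_Un_disjoint[OF sub sub]) (use True in \<open>auto simp: A_def\<close>)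
    also have "infsum f ((\<lambda>n. N * n) ` A N) = f N * infsum f (A N)"
      by (subst infsum_reindex[OF inj]) (simp add: o_def mult infsum_cmult_right')
    finally have "infsum f (A (Suc N)) = (1 - f N) * infsum f (A N)"
      by algebra
    thus ?thesis using Suc True unfolding A_def by simp
  qed
qed

text \<open>As the sieving bound grows, only the term \<open>n = 1\<close> survives, by dominated
  convergence. So the partial products times \<open>Z\<close> tend to \<open>1\<close>, which yields
  the value of the product and the nonvanishing of \<open>Z\<close> at once.\<close>

lemma euler_product:
  assumes s: "Re s > 1"
  defines "Z \<equiv> (\<Sum>n. of_nat n powr (-s) :: complex)"
  shows "(\<lambda>p. if prime p then 1 - of_nat p powr (-s) else 1) has_prod inverse Z" and "Z \<noteq> 0"
proof -
  define f where "f n = (of_nat n powr (-s) :: complex)" for n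
  have f0: "f 0 = 0" and mult: "f (m * n) = f m * f n" for m n
    unfolding f_def by (simp, rule of_nat_mult_powr)
  have Sn: "summable (\<lambda>n. norm (f n))"
    using summable_norm_powr[OF s] by (simp add: f_def)
  have hs: "(f has_sum Z) UNIV"
    using norm_summable_imp_has_sum[OF Sn summable_sums[OF summable_norm_cancel[OF Sn]]]
    by (simp add: Z_def f_def[abs_def])
  define A where "A M = {n::nat. n > 0 \<and> (\<forall>p. prime p \<and> p < M \<longrightarrow> \<not> p dvd n)}" for M
  define E where "E p = (if prime p then 1 - f p else 1)" for p
  have sieve: "infsum f (A N) = (\<Prod>p<N. E p) * Z" for N
    using sieve_infsum[OF _ f0 mult, of N] hs unfolding A_def E_def
    by (simp add: has_sum_imp_summable infsumI)
  have "infsum f (A N) = (\<Sum>n. if n \<in> A N then f n else 0)" for N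
  proof -
    have N: "summable (\<lambda>n. norm (if n \<in> A N then f n else 0))"
      by (rule summable_comparison_test'[OF Sn]) auto
    have "infsum f (A N) = infsum (\<lambda>n. if n \<in> A N then f n else 0) UNIV"
      by (intro infsum_cong_neutral) auto
    also have "\<dots> = (\<Sum>n. if n \<in> A N then f n else 0)"
      using norm_summable_imp_has_sum[OF N] summable_norm_cancel[OF N]
      by (intro infsumI) (auto intro: summable_sums)
    finally show ?thesis .
  qed
  moreover have "(\<lambda>N. \<Sum>n. if n \<in> A N then f n else 0) \<longlonglongrightarrow> (\<Sum>n. if n = 1 then f n else 0)"
  proof (rule tannerys_theorem[THEN conjunct2, THEN conjunct2, of _ _ _ "\<lambda>n. norm (f n)"])
    show "\<forall>\<^sub>F (n, N) in at_top \<times>\<^sub>F sequentially. norm (if n \<in> A N then f n else 0) \<le> norm (f n)"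
      by (intro always_eventually) auto
    fix n :: nat
    show "((\<lambda>N. if n \<in> A N then f n else 0) \<longlongrightarrow> (if n = 1 then f n else 0)) sequentially"
    proof (cases "n = 0 \<or> n = 1")
      case True
      thus ?thesis using f0 by (auto simp: A_def intro!: tendsto_eventually always_eventually)
    next
      case False
      then obtain p where p: "prime p" "p dvd n" using prime_factor_nat[of n] by auto
      have "\<forall>\<^sub>F N in sequentially. (if n \<in> A N then f n else 0) = 0"
        using eventually_gt_at_top[of p] by eventually_elim (use p in \<open>auto simp: A_def\<close>)
      thus ?thesis using False tendsto_eventually by simp
    qed
  qed (use Sn in auto)
  moreover have "(\<Sum>n. if n = 1 then f n else 0) = 1"
    using suminf_finite[of "{1}" "\<lambda>n. if n = 1 then f n else 0"] by (simp add: f_def)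
  ultimately have lim: "(\<lambda>N. (\<Prod>p<N. E p) * Z) \<longlonglongrightarrow> 1"
    by (simp add: sieve)
  show Z: "Z \<noteq> 0" using lim LIMSEQ_unique[OF tendsto_const[of 0]] by fastforce
  have lim2: "(\<lambda>N. \<Prod>p<N. E p) \<longlonglongrightarrow> inverse Z"
    using tendsto_mult_right[OF lim, of "inverse Z"] Z by (simp add: mult.assoc)
  have "summable (\<lambda>p. norm (E p - 1))"
    by (rule summable_comparison_test'[OF Sn]) (auto simp: E_def)
  hence "convergent_prod E"
    by (intro abs_convergent_prod_imp_convergent_prod summable_imp_abs_convergent_prod)
  hence "E has_prod inverse Z"
    using lim2 by (intro convergent_prod_tendsto_imp_has_prod) (auto simp: LIMSEQ_lessThan_iff_atMost)
  thus "(\<lambda>p. if prime p then 1 - of_nat p powr (-s) else 1) has_prod inverse Z"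
    unfolding E_def f_def .
qed

lemma xi_nonzero: "Re s > 1 \<Longrightarrow> xi s \<noteq> 0"
  using euler_product(2)[of s] by (auto simp: xi_eq)

lemma euler_product_xi:
  assumes "Re s > 1"
  shows "(\<lambda>p. if prime p then 1 - of_nat p powr (-s) else 1) has_prod ((s - 1) / xi s)"
proof -
  have "s \<noteq> 1" using assms by auto
  thus ?thesis using euler_product[OF assms] by (simp add: xi_eq[OF assms] inverse_eq_divide)
qed

text \<open>This normalises the centre of the discs in Jensen's inequality, uniformly in the height.
  The zeta series from \<open>2\<close> on is at most \<open>1/2\<close> by comparison with a
  telescoping series, and the factor \<open>s - 1\<close>, of modulus at least \<open>2\<close>,
  makes up for the loss.\<close>

lemma norm_xi_ge:
  assumes "Re s = 3"
  shows "norm (xi s) \<ge> 1"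
proof -
  have s: "Re s > 1" using assms by simp
  define f where "f n = (of_nat n powr (-s) :: complex)" for n
  have Sn: "summable (\<lambda>n. norm (f n))"
    using summable_norm_powr[OF s] by (simp add: f_def)
  have nf: "norm (f n) = inverse (real n ^ 3)" for n
    unfolding f_def norm_of_nat_powr using assms by (cases "n = 0") (auto simp: powr_minus)
  have ff: "(\<Sum>n. f n) = 1 + (\<Sum>n. f (n + 2))"
    using suminf_split_initial_segment[OF summable_norm_cancel[OF Sn], of 2]
    by (simp add: f_def numeral_2_eq_2)
  have S2: "summable (\<lambda>n. norm (f (n + 2)))" using Sn by (subst summable_iff_shift)
  have le: "norm (f (n + 2)) \<le> (1 / real (n + 1) - 1 / real (Suc n + 1)) / 2" for n
  proof -
    have "norm (f (n + 2)) = 1 / ((real n + 2)^3)" by (simp add: nf inverse_eq_divide algebra_simps)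
    also have "\<dots> \<le> 1 / (2 * ((real n + 1) * (real n + 2)))"
    proof (intro divide_left_mono)
      have "2 * ((real n + 1) * (real n + 2)) \<le> (real n + 2) * ((real n + 2) * (real n + 2))"
        by (intro mult_mono) auto
      thus "2 * ((real n + 1) * (real n + 2)) \<le> (real n + 2) ^ 3" by (simp add: power3_eq_cube mult.assoc)
    qed auto
    also have "\<dots> = (1 / real (n + 1) - 1 / real (Suc n + 1)) / 2" by (simp add: field_simps)
    finally show ?thesis .
  qed
  have "(\<lambda>n. 1 / real (n + 1)) \<longlonglongrightarrow> 0"
    using LIMSEQ_inverse_real_of_nat by (simp add: inverse_eq_divide)
  from sums_divide[OF telescope_sums'[OF this], of 2]
  have T: "(\<lambda>n. (1 / real (n + 1) - 1 / real (Suc n + 1)) / 2) sums (1/2)" by simp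
  have "norm (\<Sum>n. f (n + 2)) \<le> (\<Sum>n. norm (f (n + 2)))" by (rule summable_norm[OF S2])
  also have "\<dots> \<le> 1/2"
    using suminf_le[OF le S2 sums_summable[OF T]] T by (simp add: sums_iff)
  finally have "norm (\<Sum>n. f n) \<ge> 1/2"
    unfolding ff using norm_triangle_ineq2[of 1 "- (\<Sum>n. f (n + 2))"] by simp
  moreover have "norm (s - 1) \<ge> 2"
    using complex_Re_le_cmod[of "s - 1"] assms by simp
  ultimately have "norm (s - 1) * norm (\<Sum>n. f n) \<ge> 2 * (1/2)"
    by (intro mult_mono) auto
  thus ?thesis by (simp add: xi_eq[OF s] norm_mult f_def)
qed

subsection \<open>Counting zeros in a disc\<close>

text \<open>The Schwarz lemma asks for the strict bound \<open>norm (F z) < 1\<close>, so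
  \<open>f\<close> is divided by \<open>M + e\<close> and \<open>e\<close> tends to
  \<open>0\<close>; this also covers \<open>M = 0\<close>.\<close>

lemma Schwarz_lemma_bounded:
  assumes hol: "f holomorphic_on ball 0 1" and f0: "f 0 = 0"
    and bd: "\<And>z. norm z < 1 \<Longrightarrow> norm (f z) \<le> M"
  obtains h where "h holomorphic_on ball 0 1" "\<And>z. norm z < 1 \<Longrightarrow> f z = z * h z"
    "\<And>z. norm z < 1 \<Longrightarrow> norm (h z) \<le> M"
proof -
  obtain h where h: "h holomorphic_on ball 0 1" "\<And>z. norm z < 1 \<Longrightarrow> f z = z * h z" "deriv f 0 = h 0"
    using Schwarz3[OF hol f0] by metis
  have M: "M \<ge> 0" using bd[of 0] f0 by simp
  have fd: "f field_differentiable at 0"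
    using hol by (meson centre_in_ball holomorphic_on_imp_differentiable_at open_ball zero_less_one)
  have "norm (h z) \<le> M" if z: "norm z < 1" for z
  proof (rule field_le_epsilon)
    fix e :: real assume e: "e > 0"
    define F where "F w = f w / of_real (M + e)" for w
    have "norm (F z) < 1" if "norm z < 1" for z
      using bd[OF that] e M by (simp add: F_def norm_divide divide_simps del: of_real_add)
    hence F: "F holomorphic_on ball 0 1" "F 0 = 0" "\<And>z. norm z < 1 \<Longrightarrow> norm (F z) < 1"
      using e M f0 unfolding F_def
      by (auto intro!: holomorphic_intros hol simp del: of_real_add)
    show "norm (h z) \<le> M + e"
    proof (cases "z = 0")
      case True
      have "deriv F 0 = deriv f 0 / of_real (M + e)"
        unfolding F_def using fd by (rule deriv_cdivide_right)
      hence "norm (deriv F 0) = norm (h 0) / (M + e)"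
        using e M h(3) by (simp add: norm_divide del: of_real_add)
      thus ?thesis using Schwarz_Lemma(2)[OF F, of 0] e M True mult_right_mono[of "norm (deriv F 0)" 1 "M + e"] by (simp add: divide_simps split: if_splits)
    next
      case False
      thus ?thesis using Schwarz_Lemma(1)[OF F z] e M h(2)[OF z]
        by (simp add: F_def norm_divide norm_mult divide_simps del: of_real_add split: if_splits)
    qed
  qed
  with h that show ?thesis by blast
qed

text \<open>Precomposing with an automorphism of the disc moves \<open>a\<close> to
  \<open>0\<close>, where the Schwarz lemma applies. The quotient obeys the same bound
  \<open>M\<close>, so the step can be iterated without loss.\<close>

lemma divide_out_zero:
  assumes hol: "f holomorphic_on ball 0 1" and a: "norm a < 1" "f a = 0"
    and bd: "\<And>z. norm z < 1 \<Longrightarrow> norm (f z) \<le> M"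
  obtains g where "g holomorphic_on ball 0 1" "\<And>z. norm z < 1 \<Longrightarrow> f z = Moebius_function 0 a z * g z"
    "\<And>z. norm z < 1 \<Longrightarrow> norm (g z) \<le> M"
proof -
  have a': "norm (-a) < 1" using a by simp
  have "(f \<circ> Moebius_function 0 (-a)) holomorphic_on ball 0 1"
    using Moebius_function_norm_lt_1[OF a']
    by (intro holomorphic_on_compose_gen[OF Moebius_function_holomorphic[OF a'] hol]) auto
  moreover have "(f \<circ> Moebius_function 0 (-a)) 0 = 0"
    using a by (simp add: Moebius_function_of_zero)
  moreover have "norm ((f \<circ> Moebius_function 0 (-a)) z) \<le> M" if "norm z < 1" for z
    using bd Moebius_function_norm_lt_1[OF a' that] by simp
  ultimately obtain h where h: "h holomorphic_on ball 0 1"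
    "\<And>z. norm z < 1 \<Longrightarrow> (f \<circ> Moebius_function 0 (-a)) z = z * h z"
    "\<And>z. norm z < 1 \<Longrightarrow> norm (h z) \<le> M"
    using Schwarz_lemma_bounded[of "f \<circ> Moebius_function 0 (-a)" M] by blast
  show ?thesis
  proof (rule that[of "h \<circ> Moebius_function 0 a"])
    show "(h \<circ> Moebius_function 0 a) holomorphic_on ball 0 1"
      using Moebius_function_norm_lt_1[OF a(1)]
      by (intro holomorphic_on_compose_gen[OF Moebius_function_holomorphic[OF a(1)] h(1)]) auto
    fix z :: complex assume z: "norm z < 1"
    note m = Moebius_function_norm_lt_1[OF a(1) z]
    show "f z = Moebius_function 0 a z * (h \<circ> Moebius_function 0 a) z"
      using h(2)[OF m, of 0] Moebius_function_compose[of "-a" a z] a z by simp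
    show "norm ((h \<circ> Moebius_function 0 a) z) \<le> M"
      using h(3)[OF m] by simp
  qed
qed

text \<open>Jensen's inequality in Blaschke form: each zero divided out contributes
  \<open>norm a\<close>, the modulus of its Moebius factor at \<open>0\<close>. Zeros are counted
  without multiplicity, as the later count is one of distinct points.\<close>

lemma norm_at_centre_le_prod_zeros:
  assumes "finite S" "f holomorphic_on ball 0 1" "\<And>z. norm z < 1 \<Longrightarrow> norm (f z) \<le> M"
    "\<And>z. z \<in> S \<Longrightarrow> norm z < 1 \<and> f z = 0"
  shows "norm (f 0) \<le> M * (\<Prod>a\<in>S. norm a)"
  using assms
proof (induction S arbitrary: f rule: finite_induct)
  case (insert a S)
  obtain g where g: "g holomorphic_on ball 0 1" "\<And>z. norm z < 1 \<Longrightarrow> f z = Moebius_function 0 a z * g z"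
    "\<And>z. norm z < 1 \<Longrightarrow> norm (g z) \<le> M"
    using divide_out_zero[of f a M] insert.prems by blast
  \<comment> \<open>The Moebius factor of \<open>a\<close> vanishes only at \<open>a\<close>, so the
    remaining zeros pass to the quotient.\<close>
  have "g b = 0" if b: "b \<in> S" for b
  proof -
    have ab: "norm a < 1" "norm b < 1" "f b = 0" "b \<noteq> a"
      using insert b by auto
    have "norm (cnj a * b) < 1"
      using norm_mult_less[of "cnj a" 1 b 1] ab by simp
    hence "1 - cnj a * b \<noteq> 0" by auto
    hence "Moebius_function 0 a b \<noteq> 0"
      using ab by (simp add: Moebius_function_simple)
    thus ?thesis using g(2)[of b] ab by simp
  qed
  hence IH: "norm (g 0) \<le> M * (\<Prod>a\<in>S. norm a)"
    using insert.IH[of g] g insert.prems by auto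
  have "norm (f 0) = norm a * norm (g 0)"
    using g(2)[of 0] by (simp add: Moebius_function_of_zero norm_mult)
  thus ?case using mult_left_mono[OF IH, of "norm a"] insert.hyps by (simp add: mult_ac)
qed auto

text \<open>Jensen's inequality gives \<open>1 \<le> M * (1 - x) ^ card S\<close>. Bernoulli's
  inequality extracts a bound linear in \<open>M\<close> from this: weaker than the logarithmic one,
  but still polynomial for the \<open>M\<close> at hand.\<close>

lemma card_zeros_le:
  fixes M q x R r :: real
  assumes hol: "f holomorphic_on ball c R" and bd: "\<And>z. z \<in> ball c R \<Longrightarrow> norm (f z) \<le> M"
    and fc: "norm (f c) \<ge> 1"
    and r: "0 < R" "0 \<le> r" "r \<le> (1 - x) * R" "0 < x"
    and S: "finite S" "\<And>z. z \<in> S \<Longrightarrow> z \<in> cball c r \<and> f z = 0"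
  shows "real (card S) \<le> M / x"
proof -
  define F where "F z = f (c + of_real R * z)" for z
  define T where "T = (\<lambda>v. (v - c) / of_real R) ` S"
  have inball: "c + of_real R * z \<in> ball c R" if "norm z < 1" for z
    using that r by (simp add: dist_norm norm_mult)
  have q: "r / R \<le> 1 - x" using r by (simp add: field_simps)
  have q0: "0 \<le> r / R" using r by simp
  have nT: "norm t \<le> r / R \<and> F t = 0" if t: "t \<in> T" for t
  proof -
    obtain v where v: "v \<in> S" "t = (v - c) / of_real R" using t unfolding T_def by auto
    have "norm (v - c) \<le> r" using S(2)[OF v(1)] by (simp add: dist_norm norm_minus_commute)
    thus ?thesis using v S(2)[OF v(1)] r by (simp add: F_def norm_divide divide_right_mono)
  qed
  have "inj_on (\<lambda>v. (v - c) / of_real R) S" using r by (auto simp: inj_on_def)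
  hence cT: "card T = card S" unfolding T_def by (rule card_image)
  have "norm (F 0) \<le> M * (\<Prod>a\<in>T. norm a)"
  proof (rule norm_at_centre_le_prod_zeros)
    show "finite T" using S by (simp add: T_def)
    have "(f \<circ> (\<lambda>z. c + of_real R * z)) holomorphic_on ball 0 1"
      by (rule holomorphic_on_compose_gen[OF _ hol]) (use inball in \<open>auto intro!: holomorphic_intros\<close>)
    thus "F holomorphic_on ball 0 1" by (simp add: F_def[abs_def] o_def)
    show "norm (F z) \<le> M" if "norm z < 1" for z using bd[OF inball[OF that]] by (simp add: F_def)
    show "norm z < 1 \<and> F z = 0" if "z \<in> T" for z using nT[OF that] q r by linarith
  qed
  also have M: "M \<ge> 0" using bd[of c] r norm_ge_zero[of "f c"] by (metis centre_in_ball order.trans)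
  hence "M * (\<Prod>a\<in>T. norm a) \<le> M * (\<Prod>a\<in>T. 1 - x)"
    using nT q by (intro mult_left_mono prod_mono) (auto intro: order.trans)
  also have "\<dots> = M * (1 - x) ^ card S" by (simp add: cT)
  finally have 1: "1 \<le> M * (1 - x) ^ card S" using fc by (simp add: F_def)
  have x1: "x \<le> 1" using q q0 by linarith
  have "(1 - x) ^ card S * (1 + real (card S) * x) \<le> (1 - x) ^ card S * (1 + x) ^ card S"
    using x1 r Bernoulli_inequality[of x "card S"] by (intro mult_left_mono) auto
  also have "\<dots> = (1 - x\<^sup>2) ^ card S"
    by (simp add: power_mult_distrib[symmetric] algebra_simps power2_eq_square)
  also have "\<dots> \<le> 1" using x1 r by (intro power_le_one) (auto simp: power2_eq_square mult_le_one)
  finally have 2: "(1 - x) ^ card S * (1 + real (card S) * x) \<le> 1" .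
  have "1 + real (card S) * x \<le> M * (1 - x) ^ card S * (1 + real (card S) * x)"
    using mult_right_mono[OF 1, of "1 + real (card S) * x"] r by simp
  also have "\<dots> \<le> M * 1" using mult_left_mono[OF 2 M] by (simp add: mult.assoc)
  finally have "real (card S) * x \<le> M" by simp
  thus ?thesis using r by (simp add: field_simps)
qed

section \<open>Counting zeros of \<open>xi\<close> in a strip\<close>

text \<open>The disc about \<open>3 + i T\<close> of radius \<open>3 - e\<close> stays in
  \<open>Re v \<ge> e\<close>, where \<open>xi\<close> is bounded. A zero has
  \<open>Re v \<le> 1\<close>, so those in \<open>Z\<close> lie in the concentric disc of radius
  \<open>3 - 3 e / 2\<close>; the relative gap between the radii is at least
  \<open>e / 6\<close>.\<close>

lemma xi_zeros_local:
  fixes e T :: real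
  assumes e: "0 < e" "e \<le> 1/2"
  defines "Z \<equiv> {v. Re v \<ge> 2 * e \<and> \<bar>Im v - T\<bar> \<le> e \<and> xi v = 0}"
  shows "finite Z \<and> real (card Z) \<le> (1 + (7 + \<bar>T\<bar>)\<^sup>2 * (1 + 1 / e)) / (e / 6)"
proof -
  define c where "c = Complex 3 T"
  define M where "M = 1 + (7 + \<bar>T\<bar>)\<^sup>2 * (1 + 1 / e)"
  have nc: "norm c \<le> 3 + \<bar>T\<bar>" using cmod_le[of c] by (simp add: c_def)
  have reb: "Re v \<ge> e" if "v \<in> ball c (3 - e)" for v
  proof -
    have "\<bar>Re (c - v)\<bar> < 3 - e" using that abs_Re_le_cmod[of "c - v"] by (simp add: dist_norm)
    thus ?thesis by (simp add: c_def)
  qed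
  have hol: "xi holomorphic_on ball c (3 - e)"
    by (rule holomorphic_on_subset[OF holomorphic_xi]) (use reb e in fastforce)
  have bd: "norm (xi v) \<le> M" if v: "v \<in> ball c (3 - e)" for v
  proof -
    have n: "norm v \<le> 6 + \<bar>T\<bar>"
      using v nc e norm_triangle_ineq2[of v c] by (simp add: dist_norm norm_minus_commute)
    have n1: "norm (v - 1) \<le> 7 + \<bar>T\<bar>" using n norm_triangle_ineq4[of v 1] by simp
    have "norm (v - 1) * norm v \<le> (7 + \<bar>T\<bar>) * (7 + \<bar>T\<bar>)"
      using n n1 by (intro mult_mono) auto
    hence "norm (v - 1) * norm v * (1 + 1 / e) \<le> (7 + \<bar>T\<bar>)\<^sup>2 * (1 + 1 / e)"
      using e by (intro mult_right_mono) (auto simp: power2_eq_square)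
    thus ?thesis using norm_xi_le[OF reb[OF v] e(1)] by (simp add: M_def)
  qed
  have fc: "norm (xi c) \<ge> 1" by (rule norm_xi_ge) (simp add: c_def)
  have Zin: "v \<in> cball c (3 - 3 * e / 2)" if v: "v \<in> Z" for v
  proof -
    have "Re v \<le> 1" using v xi_nonzero[of v] unfolding Z_def by force
    hence a: "\<bar>3 - Re v\<bar> \<le> \<bar>3 - 2 * e\<bar>" and b: "\<bar>T - Im v\<bar> \<le> \<bar>e\<bar>"
      using v e unfolding Z_def by auto
    have "(norm (c - v))\<^sup>2 = (3 - Re v)\<^sup>2 + (T - Im v)\<^sup>2"
      by (simp add: cmod_power2 c_def)
    also have "\<dots> \<le> (3 - 2 * e)\<^sup>2 + e\<^sup>2"
      using a b by (intro add_mono) (auto simp: abs_le_square_iff)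
    also have "\<dots> \<le> (3 - 3 * e / 2)\<^sup>2"
    proof -
      have "e * e \<le> e" using e by (simp add: mult_left_le)
      moreover have "(3 - 3 * e / 2)\<^sup>2 - ((3 - 2 * e)\<^sup>2 + e\<^sup>2) = 3 * e - 11 / 4 * (e * e)"
        by (simp add: power2_eq_square field_simps)
      ultimately show ?thesis using e by linarith
    qed
    finally have "norm (c - v) \<le> 3 - 3 * e / 2"
      by (rule power2_le_imp_le) (use e in auto)
    thus ?thesis by (simp add: dist_norm)
  qed
  have card: "real (card S) \<le> M / (e / 6)" if S: "finite S" "S \<subseteq> Z" for S
  proof (rule card_zeros_le[OF hol bd fc])
    show "3 - 3 * e / 2 \<le> (1 - e / 6) * (3 - e)" using e by (simp add: algebra_simps)
    show "z \<in> cball c (3 - 3 * e / 2) \<and> xi z = 0" if "z \<in> S" for z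
      using Zin[of z] that S unfolding Z_def by blast
  qed (use e S in auto)
  \<comment> \<open>The uniform bound on finite subsets also forces \<open>Z\<close> itself to be
    finite.\<close>
  have "card S \<le> nat \<lfloor>M / (e / 6)\<rfloor>" if "finite S" "S \<subseteq> Z" for S
    using card[OF that] by linarith
  hence "finite Z" using finite_if_finite_subsets_card_bdd[of Z] by blast
  with card[of Z] show ?thesis by (simp add: M_def)
qed

lemma xi_zeros_strip:
  fixes e Y :: real
  assumes e: "0 < e" "e \<le> 1/2" and Y: "Y \<ge> 0"
  defines "Z \<equiv> {v. Re v \<ge> 2 * e \<and> \<bar>Im v\<bar> \<le> Y \<and> xi v = 0}"
  shows "finite Z \<and> real (card Z) \<le> (2 * Y / e + 3) * ((1 + (8 + Y)\<^sup>2 * (1 + 1 / e)) / (e / 6))"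
proof -
  define K where "K = \<lfloor>Y / e\<rfloor> + 1"
  define L where "L T = {v. Re v \<ge> 2 * e \<and> \<bar>Im v - T\<bar> \<le> e \<and> xi v = 0}" for T
  define C where "C = (1 + (8 + Y)\<^sup>2 * (1 + 1 / e)) / (e / 6)"
  \<comment> \<open>Windows of half-height \<open>e\<close> are centred at the multiples
    \<open>j * e\<close>. The condition on \<open>j * e\<close> keeps the local bound, which grows
    with the height, uniform over \<open>J\<close>.\<close>
  define J where "J = {j\<in>{-K..K}. \<bar>real_of_int j * e\<bar> \<le> Y + 1}"
  have K0: "K \<ge> 0" using Y e by (simp add: K_def)
  have sub: "Z \<subseteq> (\<Union>j\<in>J. L (real_of_int j * e))"
  proof
    fix v assume v: "v \<in> Z"
    define j where "j = \<lfloor>Im v / e\<rfloor>"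
    have j: "real_of_int j \<le> Im v / e" "Im v / e < real_of_int j + 1" unfolding j_def by linarith+
    have j2: "real_of_int j * e \<le> Im v" "Im v < real_of_int j * e + e"
      using j e by (simp_all add: field_simps)
    have "Im v / e \<le> Y / e" "-(Y / e) \<le> Im v / e"
      using v e unfolding Z_def by (auto simp: divide_right_mono minus_divide_left simp del: minus_divide_left[symmetric])
    hence "j \<in> {-K..K}" unfolding j_def K_def by (auto; linarith)
    moreover have "\<bar>real_of_int j * e\<bar> \<le> Y + 1" using j2 v e unfolding Z_def by (auto simp: abs_le_iff)
    moreover have "v \<in> L (real_of_int j * e)" using j2 v unfolding Z_def L_def by auto
    ultimately show "v \<in> (\<Union>j\<in>J. L (real_of_int j * e))" unfolding J_def by blast
  qed
  have C: "finite (L (real_of_int j * e)) \<and> real (card (L (real_of_int j * e))) \<le> C" if j: "j \<in> J" for j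
  proof -
    have "(1 + (7 + \<bar>real_of_int j * e\<bar>)\<^sup>2 * (1 + 1 / e)) / (e / 6) \<le> C"
      unfolding C_def using e Y j by (intro divide_right_mono add_left_mono mult_right_mono power_mono) (auto simp: J_def)
    thus ?thesis using xi_zeros_local[OF e, of "real_of_int j * e"] unfolding L_def by force
  qed
  have C0: "C \<ge> 0" unfolding C_def using e by simp
  have finJ: "finite J" unfolding J_def by (rule finite_subset[of _ "{-K..K}"]) auto
  have "card J \<le> card {-K..K}" unfolding J_def by (intro card_mono) auto
  hence "int (card J) \<le> 2 * \<lfloor>Y / e\<rfloor> + 3" using K0 unfolding K_def by simp
  hence "real (card J) \<le> 2 * real_of_int \<lfloor>Y / e\<rfloor> + 3" by linarith
  hence cJ: "real (card J) \<le> 2 * Y / e + 3"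
    using of_int_floor_le[of "Y / e"] by linarith
  have fin: "finite (\<Union>j\<in>J. L (real_of_int j * e))" using finJ C by blast
  have "card Z \<le> card (\<Union>j\<in>J. L (real_of_int j * e))" by (rule card_mono[OF fin sub])
  also have "\<dots> \<le> (\<Sum>j\<in>J. card (L (real_of_int j * e)))" by (rule card_UN_le[OF finJ])
  finally have "real (card Z) \<le> (\<Sum>j\<in>J. real (card (L (real_of_int j * e))))" by (metis of_nat_le_iff of_nat_sum)
  also have "\<dots> \<le> (\<Sum>j\<in>J. C)" using C by (intro sum_mono) auto
  also have "\<dots> \<le> (2 * Y / e + 3) * C" using cJ C0 by (simp add: mult_right_mono)
  finally show ?thesis using finite_subset[OF sub fin] by (simp add: C_def)
qed

text \<open>The choice \<open>e = 1 / (2 N)\<close> gives of order \<open>N^2\<close> windows with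
  at most of order \<open>N^4\<close> zeros each. The strip has height of order \<open>N\<close>
  because it must contain the arguments \<open>n s - w\<close> for \<open>n \<le> N\<close>.\<close>

lemma xi_zeros_card:
  fixes B :: real
  assumes B: "B \<ge> 0"
  obtains A where "A \<ge> 0"
    "\<And>N::nat. N \<ge> 1 \<Longrightarrow> finite {v. Re v \<ge> 1 / N \<and> \<bar>Im v\<bar> \<le> B * N \<and> xi v = 0} \<and>
       real (card {v. Re v \<ge> 1 / N \<and> \<bar>Im v\<bar> \<le> B * N \<and> xi v = 0}) \<le> A * real N ^ 6"
proof
  define A where "A = (4 * B + 3) * (12 * (1 + (8 + B)\<^sup>2 * 3))"
  show "A \<ge> 0" using B by (simp add: A_def)
  fix N :: nat assume N: "N \<ge> 1"
  define n where "n = real N"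
  have n: "n \<ge> 1" using N by (simp add: n_def)
  have n2: "1 \<le> n ^ k" for k using n by (rule one_le_power)
  have e: "0 < 1 / (2 * n)" "1 / (2 * n) \<le> 1 / 2" using n by (auto simp: field_simps)
  have "(2 * (B * n) / (1 / (2 * n)) + 3) * ((1 + (8 + B * n)\<^sup>2 * (1 + 1 / (1 / (2 * n)))) / (1 / (2 * n) / 6))
      = (4 * B * n ^ 2 + 3) * (12 * n * (1 + (8 + B * n)\<^sup>2 * (1 + 2 * n)))"
    using n by (simp add: power2_eq_square)
  also have "\<dots> \<le> ((4 * B + 3) * n ^ 2) * (12 * n * ((1 + (8 + B)\<^sup>2 * 3) * n ^ 3))"
  proof (intro mult_mono)
    show "4 * B * n ^ 2 + 3 \<le> (4 * B + 3) * n ^ 2" using n2[of 2] by (simp add: algebra_simps)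
    have "(8 + B * n)\<^sup>2 * (1 + 2 * n) \<le> ((8 + B) * n)\<^sup>2 * (3 * n)"
      using n B by (intro mult_mono power_mono) (auto simp: algebra_simps)
    also have "\<dots> = (8 + B)\<^sup>2 * 3 * n ^ 3"
      by (simp add: power_mult_distrib power2_eq_square power3_eq_cube)
    finally show "1 + (8 + B * n)\<^sup>2 * (1 + 2 * n) \<le> (1 + (8 + B)\<^sup>2 * 3) * n ^ 3"
      using n2[of 3] by (simp add: algebra_simps)
  qed (use n B in auto)
  also have "\<dots> = A * n ^ 6"
    by (simp add: A_def power2_eq_square power3_eq_cube numeral_eq_Suc)
  finally show "finite {v. Re v \<ge> 1 / N \<and> \<bar>Im v\<bar> \<le> B * N \<and> xi v = 0} \<and>
       real (card {v. Re v \<ge> 1 / N \<and> \<bar>Im v\<bar> \<le> B * N \<and> xi v = 0}) \<le> A * real N ^ 6"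
    using xi_zeros_strip[OF e, of "B * n"] B n by (auto simp: n_def)
qed

subsection \<open>Twists and formal local factors\<close>

text \<open>Written with \<open>exp\<close> and the real logarithm so that the group law in
  \<open>w\<close>, and modulus \<open>1\<close> for imaginary \<open>w\<close>, hold for every
  natural \<open>p\<close>, including \<open>0\<close>, where \<open>powr\<close> vanishes.\<close>

definition twist :: "complex \<Rightarrow> nat \<Rightarrow> complex" where
  "twist w p = exp (w * of_real (ln (real p)))"

lemma twist_0 [simp]: "twist 0 p = 1"
  by (simp add: twist_def)

lemma twist_add: "twist (w + v) p = twist w p * twist v p"
  by (simp add: twist_def ring_distribs exp_add)

lemma norm_twist: "Re w = 0 \<Longrightarrow> norm (twist w p) = 1"
  by (simp add: twist_def)

lemma of_nat_powr_eq_twist: "p > 0 \<Longrightarrow> of_nat p powr w = twist w p"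
  by (simp add: twist_def powr_def)

locale imaginary_twists =
  fixes a b c :: complex
  assumes Re_abc: "Re a = 0" "Re b = 0" "Re c = 0"
begin

text \<open>The grading gives \<open>a\<close> and \<open>b\<close> degree \<open>1\<close> and
  \<open>c\<close> degree \<open>2\<close>, as in the local polynomial. It is a set, since
  cancellation only asks which shifts occur and not how often.\<close>

definition weights :: "nat \<Rightarrow> complex set" where
  "weights n = (\<lambda>(i, j, k). of_nat i * a + of_nat j * b + of_nat k * c) ` {(i, j, k). i + j + 2 * k = n}"

lemma weights_add: "w \<in> weights m \<Longrightarrow> v \<in> weights n \<Longrightarrow> w + v \<in> weights (m + n)"
  unfolding weights_def
proof (elim imageE, clarsimp)
  fix i j k i' j' k' :: nat
  show "of_nat i * a + of_nat j * b + of_nat k * c + (of_nat i' * a + of_nat j' * b + of_nat k' * c) \<in>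
    (\<lambda>(i, j, k). of_nat i * a + of_nat j * b + of_nat k * c) `
      {(ia, ja, ka). ia + ja + 2 * ka = i + j + 2 * k + (i' + j' + 2 * k')}"
    by (rule image_eqI[of _ _ "(i + i', j + j', k + k')"]) (auto simp: algebra_simps)
qed

lemma weights_intros: "0 \<in> weights 0" "a \<in> weights 1" "b \<in> weights 1" "c \<in> weights 2"
proof -
  show "0 \<in> weights 0" unfolding weights_def by (rule image_eqI[of _ _ "(0, 0, 0)"]) auto
  show "a \<in> weights 1" unfolding weights_def by (rule image_eqI[of _ _ "(1, 0, 0)"]) auto
  show "b \<in> weights 1" unfolding weights_def by (rule image_eqI[of _ _ "(0, 1, 0)"]) auto
  show "c \<in> weights 2" unfolding weights_def by (rule image_eqI[of _ _ "(0, 0, 1)"]) auto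
qed

lemma Re_weights: "w \<in> weights n \<Longrightarrow> Re w = 0"
  using Re_abc by (auto simp: weights_def)

text \<open>\<open>j\<close> is determined by \<open>n\<close>, \<open>i\<close> and
  \<open>k\<close>, so the number of shifts in a degree is polynomial, however many correcting
  factors there are. The final count rests on this.\<close>

lemma finite_card_weights: "finite (weights n)" "card (weights n) \<le> (n + 1) ^ 2"
proof -
  have sub: "{(i, j, k). i + j + 2 * k = n} \<subseteq> (\<lambda>(i, k). (i, n - i - 2 * k, k)) ` ({..n} \<times> {..n})"
  proof
    fix x assume "x \<in> {(i, j, k). i + j + 2 * k = n}"
    then obtain i j k where "x = (i, j, k)" "i + j + 2 * k = n" by auto
    thus "x \<in> (\<lambda>(i, k). (i, n - i - 2 * k, k)) ` ({..n} \<times> {..n})"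
      by (intro image_eqI[of _ _ "(i, k)"]) auto
  qed
  have fin: "finite {(i, j, k). i + j + 2 * k = n}" by (rule finite_subset[OF sub]) auto
  thus "finite (weights n)" by (simp add: weights_def)
  have "card (weights n) \<le> card {(i, j, k). i + j + 2 * k = n}"
    unfolding weights_def by (rule card_image_le[OF fin])
  also have "\<dots> \<le> card ((\<lambda>(i, k). (i, n - i - 2 * k, k)) ` ({..n} \<times> {..n}))"
    by (rule card_mono[OF _ sub]) auto
  also have "\<dots> \<le> card ({..n} \<times> {..n})" by (rule card_image_le) auto
  finally show "card (weights n) \<le> (n + 1) ^ 2" by (simp add: card_cartesian_product power2_eq_square)
qed

lemma norm_weights: "w \<in> weights n \<Longrightarrow> norm w \<le> real n * (norm a + norm b + norm c)"
proof -
  assume "w \<in> weights n"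
  then obtain i j k where w: "w = of_nat i * a + of_nat j * b + of_nat k * c" "i + j + 2 * k = n"
    unfolding weights_def by auto
  have "norm w \<le> real i * norm a + real j * norm b + real k * norm c"
    unfolding w by (intro norm_triangle_mono) (simp_all add: norm_mult)
  also have "\<dots> \<le> real n * norm a + real n * norm b + real n * norm c"
    using w by (intro add_mono mult_right_mono) auto
  finally show ?thesis by (simp add: algebra_simps)
qed

text \<open>The graded pieces of the group ring of twists. Integrality of the coefficients is what
  makes the correcting factors integral powers of zeta functions, so that no branch points
  arise in the continuation.\<close>

inductive twist_span :: "nat \<Rightarrow> (nat \<Rightarrow> complex) \<Rightarrow> bool" where
  zero: "twist_span n (\<lambda>p. 0)"
| plus: "twist_span n f \<Longrightarrow> w \<in> weights n \<Longrightarrow> twist_span n (\<lambda>p. f p + twist w p)"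
| minus: "twist_span n f \<Longrightarrow> w \<in> weights n \<Longrightarrow> twist_span n (\<lambda>p. f p - twist w p)"

lemma twist_span_twist: "w \<in> weights n \<Longrightarrow> twist_span n (twist w)"
  using twist_span.plus[OF twist_span.zero, of w n] by simp

lemma twist_span_one: "twist_span 0 (\<lambda>p. 1)"
  using twist_span.plus[OF twist_span.zero weights_intros(1)] by simp

lemma twist_span_add: "twist_span n g \<Longrightarrow> twist_span n f \<Longrightarrow> twist_span n (\<lambda>p. f p + g p)"
proof (induction rule: twist_span.induct)
  case (plus n g w)
  thus ?case using twist_span.plus[of n "\<lambda>p. f p + g p" w] by (simp add: add.assoc)
next
  case (minus n g w)
  thus ?case using twist_span.minus[of n "\<lambda>p. f p + g p" w] by (simp add: add_diff_eq)
qed simp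

lemma twist_span_uminus: "twist_span n f \<Longrightarrow> twist_span n (\<lambda>p. - f p)"
proof (induction rule: twist_span.induct)
  case (zero n)
  show ?case using twist_span.zero by simp
next
  case (plus n f w)
  thus ?case using twist_span.minus[of n "\<lambda>p. - f p" w] by simp
next
  case (minus n f w)
  thus ?case using twist_span.plus[of n "\<lambda>p. - f p" w] by (simp add: algebra_simps)
qed

lemma twist_span_mult_twist:
  "twist_span m f \<Longrightarrow> w \<in> weights n \<Longrightarrow> twist_span (m + n) (\<lambda>p. f p * twist w p)"
proof (induction rule: twist_span.induct)
  case (zero m)
  show ?case using twist_span.zero by simp
next
  case (plus m f v)
  thus ?case using twist_span.plus[of "m + n" "\<lambda>p. f p * twist w p" "v + w"]
    by (simp add: weights_add twist_add algebra_simps)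
next
  case (minus m f v)
  thus ?case using twist_span.minus[of "m + n" "\<lambda>p. f p * twist w p" "v + w"]
    by (simp add: weights_add twist_add algebra_simps)
qed

lemma twist_span_mult:
  "twist_span n g \<Longrightarrow> twist_span m f \<Longrightarrow> twist_span (m + n) (\<lambda>p. f p * g p)"
proof (induction rule: twist_span.induct)
  case (zero n)
  show ?case using twist_span.zero by simp
next
  case (plus n g w)
  thus ?case using twist_span_add[OF twist_span_mult_twist[of m f w n], of "\<lambda>p. f p * g p"]
    by (simp add: algebra_simps)
next
  case (minus n g w)
  thus ?case using twist_span_add[OF twist_span_uminus[OF twist_span_mult_twist[of m f w n]], of "\<lambda>p. f p * g p"]
    by (simp add: algebra_simps)
qed

lemma twist_span_sum:
  "finite I \<Longrightarrow> (\<And>i. i \<in> I \<Longrightarrow> twist_span n (f i)) \<Longrightarrow> twist_span n (\<lambda>p. \<Sum>i\<in>I. f i p)"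
proof (induction I rule: finite_induct)
  case empty
  show ?case using twist_span.zero by simp
next
  case (insert i I)
  thus ?case using twist_span_add[of n "\<lambda>p. \<Sum>i\<in>I. f i p" "f i"] by simp
qed

text \<open>A coefficient is regarded as a function of \<open>p\<close>: it is one combination of
  twists, the same for all \<open>p\<close>, so that a single list of correcting factors can serve
  every prime simultaneously.\<close>

definition graded :: "(nat \<Rightarrow> complex fps) \<Rightarrow> bool" where
  "graded f \<longleftrightarrow> (\<forall>p. fps_nth (f p) 0 = 1) \<and> (\<forall>k. twist_span k (\<lambda>p. fps_nth (f p) k))"

lemma graded_mult:
  assumes "graded f" "graded g"
  shows "graded (\<lambda>p. f p * g p)"
proof -
  have "twist_span k (\<lambda>p. fps_nth (f p * g p) k)" for k
    unfolding fps_mult_nth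
  proof (rule twist_span_sum)
    fix i assume i: "i \<in> {0..k}"
    have "twist_span (i + (k - i)) (\<lambda>p. fps_nth (f p) i * fps_nth (g p) (k - i))"
      using assms by (intro twist_span_mult) (auto simp: graded_def)
    thus "twist_span k (\<lambda>p. fps_nth (f p) i * fps_nth (g p) (k - i))" using i by simp
  qed simp
  thus ?thesis using assms by (simp add: graded_def)
qed

text \<open>The recursion for the coefficients of the inverse divides only by the constant
  coefficient \<open>1\<close>, so integrality survives.\<close>

lemma graded_inverse:
  assumes f: "graded f"
  shows "graded (\<lambda>p. inverse (f p))"
proof -
  have f0: "fps_nth (f p) 0 = 1" for p using f by (simp add: graded_def)
  have rec: "fps_nth (inverse (f p)) k = - (\<Sum>i=1..k. fps_nth (f p) i * fps_nth (inverse (f p)) (k - i))"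
    if k: "k > 0" for p k
  proof -
    have "f p * inverse (f p) = 1" using f0[of p] inverse_mult_eq_1'[of "f p"] by simp
    hence "0 = fps_nth (f p * inverse (f p)) k" using k by simp
    also have "\<dots> = (\<Sum>i=0..k. fps_nth (f p) i * fps_nth (inverse (f p)) (k - i))"
      by (rule fps_mult_nth)
    also have "{0..k} = insert 0 {1..k}" by auto
    finally show ?thesis using f0[of p] by (simp add: algebra_simps eq_neg_iff_add_eq_0)
  qed
  have "twist_span k (\<lambda>p. fps_nth (inverse (f p)) k)" for k
  proof (induction k rule: less_induct)
    case (less k)
    show ?case
    proof (cases "k = 0")
      case True
      thus ?thesis using f0 twist_span_one by simp
    next
      case False
      have "twist_span k (\<lambda>p. \<Sum>i=1..k. fps_nth (f p) i * fps_nth (inverse (f p)) (k - i))"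
      proof (rule twist_span_sum)
        fix i assume i: "i \<in> {1..k}"
        have "twist_span (i + (k - i)) (\<lambda>p. fps_nth (f p) i * fps_nth (inverse (f p)) (k - i))"
          using f i less.IH[of "k - i"] by (intro twist_span_mult) (auto simp: graded_def)
        thus "twist_span k (\<lambda>p. fps_nth (f p) i * fps_nth (inverse (f p)) (k - i))" using i by simp
      qed simp
      from twist_span_uminus[OF this] show ?thesis using False by (simp add: rec[of k])
    qed
  qed
  thus ?thesis using f0 by (simp add: graded_def)
qed

text \<open>A triple \<open>(n, w, s)\<close> stands for a single factor \<open>(1 - p^w X^n)^(+1 or -1)\<close>;
  integral exponents are encoded by repetition in a list.\<close>

definition cyclo_fps :: "nat \<times> complex \<times> bool \<Rightarrow> nat \<Rightarrow> complex fps" where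
  "cyclo_fps x p = (case x of (n, w, s) \<Rightarrow>
     let q = 1 - fps_const (twist w p) * fps_X ^ n in if s then q else inverse q)"

definition local_fps :: "nat \<Rightarrow> complex fps" where
  "local_fps p = 1 - fps_const (twist a p + twist b p) * fps_X + fps_const (twist c p) * fps_X ^ 2"

lemma graded_cyclo_fps:
  assumes "n \<ge> 1" "w \<in> weights n"
  shows "graded (cyclo_fps (n, w, s))"
proof -
  have "twist_span k (\<lambda>p. fps_nth (1 - fps_const (twist w p) * fps_X ^ n) k)" for k
    using twist_span_one twist_span_uminus[OF twist_span_twist[OF assms(2)]]
      twist_span.zero[of k] assms(1)
    by (cases "k = 0"; cases "k = n") auto
  hence "graded (\<lambda>p. 1 - fps_const (twist w p) * fps_X ^ n)"
    using assms by (simp add: graded_def)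
  thus ?thesis using graded_inverse[of "\<lambda>p. 1 - fps_const (twist w p) * fps_X ^ n"]
    by (cases s) (simp_all add: cyclo_fps_def[abs_def] Let_def)
qed

lemma graded_local_fps: "graded local_fps"
proof -
  have "twist_span k (\<lambda>p. fps_nth (local_fps p) k)" for k
  proof -
    consider "k = 0" | "k = 1" | "k = 2" | "k > 2" by linarith
    thus ?thesis
    proof cases
      case 1
      thus ?thesis using twist_span_one by (simp add: local_fps_def)
    next
      case 2
      have "twist_span 1 (\<lambda>p. - (twist a p + twist b p))"
        by (intro twist_span_uminus twist_span_add twist_span_twist weights_intros)
      thus ?thesis using 2 by (simp add: local_fps_def)
    next
      case 3
      thus ?thesis using twist_span_twist[OF weights_intros(4)] by (simp add: local_fps_def)
    next
      case 4
      thus ?thesis using twist_span.zero[of k] by (simp add: local_fps_def)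
    qed
  qed
  thus ?thesis by (simp add: graded_def local_fps_def)
qed

section \<open>Cancelling coefficients one degree at a time\<close>

definition low_zero :: "nat \<Rightarrow> complex fps \<Rightarrow> bool" where
  "low_zero n P \<longleftrightarrow> fps_nth P 0 = 1 \<and> (\<forall>k. 1 \<le> k \<and> k < n \<longrightarrow> fps_nth P k = 0)"

text \<open>Up to degree \<open>n\<close> both series have the form \<open>1 + x X^n\<close>, so
  multiplication adds the coefficients of degree \<open>n\<close>.\<close>

lemma low_zero_mult:
  assumes "low_zero n P" "low_zero n Q"
  shows "low_zero n (P * Q)" "n \<ge> 1 \<Longrightarrow> fps_nth (P * Q) n = fps_nth P n + fps_nth Q n"
proof -
  have eq: "fps_nth (P * Q) k = fps_nth P k + fps_nth Q k" if k: "1 \<le> k" "k \<le> n" for k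
  proof -
    have "fps_nth (P * Q) k = (\<Sum>i=0..k. fps_nth P i * fps_nth Q (k - i))" by (rule fps_mult_nth)
    also have "\<dots> = (\<Sum>i\<in>{0, k}. fps_nth P i * fps_nth Q (k - i))"
      using assms k by (intro sum.mono_neutral_right) (auto simp: low_zero_def)
    also have "\<dots> = fps_nth P k + fps_nth Q k" using k assms by (simp add: low_zero_def)
    finally show ?thesis .
  qed
  show "low_zero n (P * Q)" using eq assms by (auto simp: low_zero_def)
  show "n \<ge> 1 \<Longrightarrow> fps_nth (P * Q) n = fps_nth P n + fps_nth Q n" using eq by simp
qed

lemma low_zero_cyclo_fps:
  assumes n: "n \<ge> 1"
  shows "low_zero n (cyclo_fps (n, w, s) p)"
    "fps_nth (cyclo_fps (n, w, s) p) n = (if s then - twist w p else twist w p)"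
proof -
  define q where "q = 1 - fps_const (twist w p) * fps_X ^ n"
  have q0: "fps_nth q 0 \<noteq> 0" using n by (simp add: q_def)
  have "q * inverse q = 1" using inverse_mult_eq_1'[OF q0] .
  \<comment> \<open>The fixed-point equation of the geometric series; the coefficients up to degree
    \<open>n\<close> can be read off from it.\<close>
  hence "inverse q = 1 + fps_const (twist w p) * (fps_X ^ n * inverse q)"
    unfolding q_def by (simp add: algebra_simps)
  hence I: "fps_nth (inverse q) k = fps_nth (1 + fps_const (twist w p) * (fps_X ^ n * inverse q)) k" for k
    by (rule arg_cong)
  have I0: "fps_nth (inverse q) 0 = 1" using n by (simp add: q_def)
  have "fps_nth (inverse q) k = 0" if "1 \<le> k" "k < n" for k
    using I[of k] that by (simp add: fps_X_power_mult_nth)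
  hence low: "low_zero n (inverse q)" using I0 by (simp add: low_zero_def)
  have nth: "fps_nth (inverse q) n = twist w p" using I[of n] n I0 by (simp add: fps_X_power_mult_nth)
  show "low_zero n (cyclo_fps (n, w, s) p)"
    using low n by (auto simp: cyclo_fps_def Let_def low_zero_def q_def)
  show "fps_nth (cyclo_fps (n, w, s) p) n = (if s then - twist w p else twist w p)"
    using nth n by (simp add: cyclo_fps_def q_def)
qed

text \<open>Induction along the generation of the span: each \<open>+ twist w\<close> is met by one
  factor \<open>1 - p^w X^n\<close>, and each \<open>- twist w\<close> by the inverse of such a
  factor.\<close>

lemma cancel_coefficient:
  assumes "twist_span n f" "n \<ge> 1"
  shows "\<exists>ys. (\<forall>x\<in>set ys. fst x = n \<and> fst (snd x) \<in> weights n) \<and>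
    (\<forall>p. low_zero n (\<Prod>x\<leftarrow>ys. cyclo_fps x p) \<and> fps_nth (\<Prod>x\<leftarrow>ys. cyclo_fps x p) n = - f p)"
  using assms
proof (induction rule: twist_span.induct)
  case (zero n)
  thus ?case by (intro exI[of _ "[]"]) (auto simp: low_zero_def)
next
  case (plus n f w)
  then obtain ys where "\<forall>x\<in>set ys. fst x = n \<and> fst (snd x) \<in> weights n"
    "\<forall>p. low_zero n (\<Prod>x\<leftarrow>ys. cyclo_fps x p) \<and> fps_nth (\<Prod>x\<leftarrow>ys. cyclo_fps x p) n = - f p" by blast
  thus ?case using plus low_zero_cyclo_fps[of n w True] low_zero_mult
    by (intro exI[of _ "(n, w, True) # ys"]) auto
next
  case (minus n f w)
  then obtain ys where "\<forall>x\<in>set ys. fst x = n \<and> fst (snd x) \<in> weights n"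
    "\<forall>p. low_zero n (\<Prod>x\<leftarrow>ys. cyclo_fps x p) \<and> fps_nth (\<Prod>x\<leftarrow>ys. cyclo_fps x p) n = - f p" by blast
  thus ?case using minus low_zero_cyclo_fps[of n w False] low_zero_mult
    by (intro exI[of _ "(n, w, False) # ys"]) auto
qed

definition admissible :: "nat \<Rightarrow> (nat \<times> complex \<times> bool) list \<Rightarrow> bool" where
  "admissible N xs \<longleftrightarrow> (\<forall>(n, w, s)\<in>set xs. 1 \<le> n \<and> n \<le> N \<and> w \<in> weights n)"

lemma graded_prod_list: "admissible N xs \<Longrightarrow> graded (\<lambda>p. local_fps p * (\<Prod>x\<leftarrow>xs. cyclo_fps x p))"
proof (induction xs)
  case Nil
  thus ?case using graded_local_fps by simp
next
  case (Cons x xs)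
  obtain n w s where x: "x = (n, w, s)" by (cases x) auto
  have "graded (cyclo_fps x)" using Cons.prems x graded_cyclo_fps by (auto simp: admissible_def)
  moreover have "graded (\<lambda>p. local_fps p * (\<Prod>x\<leftarrow>xs. cyclo_fps x p))"
    using Cons by (simp add: admissible_def)
  ultimately have "graded (\<lambda>p. cyclo_fps x p * (local_fps p * (\<Prod>x\<leftarrow>xs. cyclo_fps x p)))"
    by (rule graded_mult)
  thus ?case by (simp add: mult_ac)
qed

text \<open>The new factors are \<open>1 + O(X^(N+1))\<close>, so they repair degree
  \<open>N + 1\<close> and leave the lower degrees untouched. \<open>low_zero (Suc N)\<close> says
  that degrees \<open>1\<close> to \<open>N\<close> have been cleared.\<close>

lemma exists_cyclotomic_approximation:
  "\<exists>xs. admissible N xs \<and> (\<forall>p. low_zero (Suc N) (local_fps p * (\<Prod>x\<leftarrow>xs. cyclo_fps x p)))"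
proof (induction N)
  case 0
  show ?case by (rule exI[of _ "[]"]) (auto simp: admissible_def low_zero_def local_fps_def)
next
  case (Suc N)
  then obtain xs where xs: "admissible N xs" "\<And>p. low_zero (Suc N) (local_fps p * (\<Prod>x\<leftarrow>xs. cyclo_fps x p))"
    by blast
  define P where "P p = local_fps p * (\<Prod>x\<leftarrow>xs. cyclo_fps x p)" for p
  have "twist_span (Suc N) (\<lambda>p. fps_nth (P p) (Suc N))"
    using graded_prod_list[OF xs(1)] by (simp add: graded_def P_def)
  from cancel_coefficient[OF this] obtain ys where
    ys: "\<forall>x\<in>set ys. fst x = Suc N \<and> fst (snd x) \<in> weights (Suc N)" and
    ys': "\<forall>p. low_zero (Suc N) (\<Prod>x\<leftarrow>ys. cyclo_fps x p) \<and>
      fps_nth (\<Prod>x\<leftarrow>ys. cyclo_fps x p) (Suc N) = - fps_nth (P p) (Suc N)"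
    by auto
  have "low_zero (Suc (Suc N)) (P p * (\<Prod>x\<leftarrow>ys. cyclo_fps x p))" for p
    using low_zero_mult[OF xs(2)[of p, folded P_def], of "\<Prod>x\<leftarrow>ys. cyclo_fps x p"] ys'
    by (auto simp: low_zero_def less_Suc_eq)
  hence "low_zero (Suc (Suc N)) (local_fps p * (\<Prod>x\<leftarrow>xs @ ys. cyclo_fps x p))" for p
    by (simp add: P_def mult.assoc)
  moreover have "admissible (Suc N) (xs @ ys)"
    using xs(1) ys by (fastforce simp: admissible_def)
  ultimately show ?case by blast
qed

end

subsection \<open>Analytic local factors\<close>

text \<open>Cauchy's estimate on the circle of radius \<open>1/2\<close> bounds the n-th coefficient
  by \<open>B * 2 ^ n\<close>; for \<open>norm u \<le> 1/4\<close> the tail is then dominated by a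
  geometric series of ratio \<open>1/2\<close>. The bound depends on \<open>f\<close> only through
  \<open>B\<close>, which gives uniformity in \<open>p\<close>.\<close>

lemma fps_tail_bound:
  fixes f :: "complex \<Rightarrow> complex"
  assumes F: "f has_fps_expansion F" and hol: "f holomorphic_on ball 0 1"
    and bd: "\<And>u. norm u = 1/2 \<Longrightarrow> norm (f u) \<le> B"
    and F0: "fps_nth F 0 = 1" "\<And>k. 1 \<le> k \<Longrightarrow> k \<le> N \<Longrightarrow> fps_nth F k = 0"
    and u: "norm u \<le> 1/4"
  shows "norm (f u - 1) \<le> 2 * B * (2 * norm u) ^ Suc N"
proof -
  have sums: "(\<lambda>n. fps_nth F n * u ^ n) sums f u"
    by (rule has_fps_expansion_imp_sums_complex[OF F, of "ereal 1"]) (use hol u in auto)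
  have coeff: "norm (fps_nth F n) \<le> B * 2 ^ n" for n
  proof -
    have "fps_nth F n = (deriv ^^ n) f 0 / fact n"
      using fps_expansion_eqI[OF F] by (metis fps_expansion_def fps_nth_Abs_fps)
    moreover have "norm ((deriv ^^ n) f 0) \<le> fact n * B / (1/2) ^ n"
      by (rule Cauchy_inequality)
         (use bd in \<open>auto intro!: holomorphic_on_subset[OF hol] holomorphic_on_imp_continuous_on[OF holomorphic_on_subset[OF hol]]\<close>)
    ultimately show ?thesis
      by (simp add: norm_divide power_divide divide_le_eq mult_ac)
  qed
  have B: "B \<ge> 0" using coeff[of 0] by (metis norm_ge_zero order.trans mult.right_neutral power_0)
  have split: "f u - 1 = (\<Sum>n. fps_nth F (n + Suc N) * u ^ (n + Suc N))"
  proof -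
    have "(\<Sum>i<Suc N. fps_nth F i * u ^ i) = (\<Sum>i\<in>{0}. fps_nth F i * u ^ i)"
      using F0 by (intro sum.mono_neutral_right) auto
    hence "(\<Sum>i<Suc N. fps_nth F i * u ^ i) = 1" using F0 by simp
    moreover have "f u = (\<Sum>n. fps_nth F n * u ^ n)" using sums by (simp only: sums_iff)
    ultimately have "f u = (\<Sum>n. fps_nth F (n + Suc N) * u ^ (n + Suc N)) + 1"
      using suminf_split_initial_segment[OF sums_summable[OF sums], of "Suc N"] by (simp only:)
    thus ?thesis by (simp only: add_diff_cancel_right')
  qed
  have le: "norm (fps_nth F (n + Suc N) * u ^ (n + Suc N)) \<le> B * (2 * norm u) ^ Suc N * (1/2) ^ n" for n
  proof -
    have "norm (fps_nth F (n + Suc N) * u ^ (n + Suc N)) \<le> B * 2 ^ (n + Suc N) * norm u ^ (n + Suc N)"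
      unfolding norm_mult norm_power by (intro mult_right_mono coeff) auto
    also have "\<dots> = B * (2 * norm u) ^ Suc N * (2 * norm u) ^ n"
      by (simp add: power_mult_distrib power_add)
    also have "\<dots> \<le> B * (2 * norm u) ^ Suc N * (1/2) ^ n"
      using u B by (intro mult_left_mono power_mono) auto
    finally show ?thesis .
  qed
  have geo: "(\<lambda>n. B * (2 * norm u) ^ Suc N * (1/2) ^ n) sums (B * (2 * norm u) ^ Suc N * 2)"
    using geometric_sums[of "1/2 :: real"] by (intro sums_mult) simp
  have "norm (f u - 1) \<le> (\<Sum>n. B * (2 * norm u) ^ Suc N * (1/2) ^ n)"
    unfolding split by (rule norm_suminf_le[OF le sums_summable[OF geo]])
  also have "\<dots> = 2 * B * (2 * norm u) ^ Suc N" using geo by (simp add: sums_iff)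
  finally show ?thesis .
qed

lemma norm_of_nat_powr_uminus_lt_1:
  "prime p \<Longrightarrow> Re s > 0 \<Longrightarrow> norm (of_nat p powr (-s) :: complex) < 1"
  unfolding norm_of_nat_powr
  using prime_gt_1_nat[of p] powr_less_mono[of "- Re s" 0 "real p"] by simp

context imaginary_twists
begin

definition cyclo_fun :: "nat \<times> complex \<times> bool \<Rightarrow> nat \<Rightarrow> complex \<Rightarrow> complex" where
  "cyclo_fun x p u = (case x of (n, w, s) \<Rightarrow>
     let q = 1 - twist w p * u ^ n in if s then q else inverse q)"

definition local_fun :: "nat \<Rightarrow> complex \<Rightarrow> complex" where
  "local_fun p u = 1 - (twist a p + twist b p) * u + twist c p * u ^ 2"

definition corrected :: "(nat \<times> complex \<times> bool) list \<Rightarrow> nat \<Rightarrow> complex \<Rightarrow> complex" where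
  "corrected xs p u = local_fun p u * (\<Prod>x\<leftarrow>xs. cyclo_fun x p u)"

lemma norm_twist_power:
  assumes "Re w = 0" shows "norm (twist w p * u ^ n) = norm u ^ n"
  using norm_twist[OF assms] by (simp add: norm_mult norm_power)

lemma cyclo_den_nonzero:
  assumes "n \<ge> 1" "w \<in> weights n" "norm u < 1"
  shows "1 - twist w p * u ^ n \<noteq> 0"
proof
  assume "1 - twist w p * u ^ n = 0"
  hence "norm (twist w p * u ^ n) = 1" by simp
  moreover have "norm u ^ n < 1" using assms by (intro power_less_one_iff[THEN iffD2]) auto
  ultimately show False using norm_twist_power[OF Re_weights[OF assms(2)]] by simp
qed

lemma cyclo_fun_nonzero:
  assumes "admissible N xs" "x \<in> set xs" "norm u < 1"
  shows "cyclo_fun x p u \<noteq> 0"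
proof -
  obtain n w s where x: "x = (n, w, s)" by (cases x) auto
  have "1 - twist w p * u ^ n \<noteq> 0"
    using assms x by (intro cyclo_den_nonzero) (auto simp: admissible_def)
  thus ?thesis by (simp add: cyclo_fun_def x Let_def)
qed

lemma norm_cyclo_fun_le:
  assumes "n \<ge> 1" "w \<in> weights n" "norm u \<le> 1/2"
  shows "norm (cyclo_fun (n, w, s) p u) \<le> 2"
proof -
  define q where "q = 1 - twist w p * u ^ n"
  have "norm u ^ n \<le> norm u ^ 1" using assms by (intro power_decreasing) auto
  hence t: "norm (twist w p * u ^ n) \<le> 1/2"
    using norm_twist_power[OF Re_weights[OF assms(2)]] assms by simp
  have "norm q \<le> 2" "norm q \<ge> 1/2"
    using t norm_triangle_ineq4[of 1 "twist w p * u ^ n"] norm_triangle_ineq2[of 1 "twist w p * u ^ n"]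
    unfolding q_def norm_one by linarith+
  moreover from this have "q \<noteq> 0" by auto
  ultimately show ?thesis by (simp add: cyclo_fun_def q_def[symmetric] norm_inverse inverse_eq_divide divide_le_eq norm_divide)
qed

lemma norm_local_fun_le: "norm (1 - local_fun p u) \<le> 2 * norm u + norm u ^ 2"
proof -
  have "norm (twist a p + twist b p) \<le> 2"
    using norm_triangle_ineq[of "twist a p" "twist b p"] Re_abc by (simp add: norm_twist)
  hence "norm ((twist a p + twist b p) * u) \<le> 2 * norm u"
    unfolding norm_mult by (rule mult_right_mono) simp
  moreover have "norm (twist c p * u ^ 2) = norm u ^ 2"
    using Re_abc by (simp add: norm_twist norm_mult norm_power)
  moreover have "1 - local_fun p u = (twist a p + twist b p) * u - twist c p * u ^ 2"
    by (simp add: local_fun_def)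
  ultimately show ?thesis
    using norm_triangle_ineq4[of "(twist a p + twist b p) * u" "twist c p * u ^ 2"] by simp
qed

lemma norm_local_fun_ge:
  assumes "norm u \<le> 1/4" shows "norm (local_fun p u) \<ge> 1/4"
proof -
  have "norm u ^ 2 \<le> (1/4)^2" using assms by (intro power_mono) auto
  hence "norm (1 - local_fun p u) \<le> 3/4"
    using norm_local_fun_le[of p u] assms by (simp add: power2_eq_square)
  thus ?thesis using norm_triangle_ineq2[of 1 "1 - local_fun p u"] by simp
qed

text \<open>Each correcting factor has modulus at most \<open>2\<close> on this disc. The bound is
  exponential in their number but independent of \<open>p\<close>, as convergence for fixed
  \<open>N\<close> requires.\<close>

lemma norm_corrected_le:
  assumes "admissible N xs" "norm u \<le> 1/2"
  shows "norm (corrected xs p u) \<le> 3 * 2 ^ length xs"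
proof -
  have "norm u ^ 2 \<le> (1/2)^2" using assms by (intro power_mono) auto
  hence "norm (1 - local_fun p u) \<le> 2"
    using norm_local_fun_le[of p u] assms by (simp add: power2_eq_square)
  hence 1: "norm (local_fun p u) \<le> 3"
    using norm_triangle_ineq4[of 1 "1 - local_fun p u"] by simp
  have 2: "norm (\<Prod>x\<leftarrow>xs. cyclo_fun x p u) \<le> 2 ^ length xs"
    using assms(1)
  proof (induction xs)
    case (Cons x xs)
    obtain n w s where x: "x = (n, w, s)" by (cases x) auto
    have "norm (cyclo_fun x p u) \<le> 2"
      using Cons.prems x assms(2) by (auto simp: admissible_def intro!: norm_cyclo_fun_le)
    moreover have "norm (\<Prod>x\<leftarrow>xs. cyclo_fun x p u) \<le> 2 ^ length xs"
      using Cons by (simp add: admissible_def)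
    ultimately show ?case by (simp add: norm_mult mult_mono)
  qed simp
  show ?thesis unfolding corrected_def norm_mult using mult_mono[OF 1 2] by simp
qed

lemma holomorphic_corrected:
  assumes "admissible N xs"
  shows "corrected xs p holomorphic_on ball 0 1"
proof -
  have "cyclo_fun x p holomorphic_on ball 0 1" if x: "x \<in> set xs" for x
  proof -
    obtain n w s where nws: "x = (n, w, s)" by (cases x) auto
    have nz: "1 - twist w p * u ^ n \<noteq> 0" if "u \<in> ball 0 1" for u
      using cyclo_den_nonzero[of n w u p] that x nws assms by (auto simp: admissible_def)
    show ?thesis
      by (cases s) (use nz in \<open>auto simp: nws cyclo_fun_def[abs_def] Let_def intro!: holomorphic_intros\<close>)
  qed
  hence "(\<lambda>u. \<Prod>x\<leftarrow>xs. cyclo_fun x p u) holomorphic_on ball 0 1"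
    by (induction xs) (auto intro!: holomorphic_intros)
  thus ?thesis unfolding corrected_def[abs_def] local_fun_def by (intro holomorphic_intros)
qed

lemma has_fps_expansion_corrected:
  assumes "admissible N xs"
  shows "corrected xs p has_fps_expansion local_fps p * (\<Prod>x\<leftarrow>xs. cyclo_fps x p)"
proof -
  have "cyclo_fun x p has_fps_expansion cyclo_fps x p" if x: "x \<in> set xs" for x
  proof -
    obtain n w s where nws: "x = (n, w, s)" by (cases x) auto
    have n: "n \<ge> 1" using x nws assms by (auto simp: admissible_def)
    have "(\<lambda>u. 1 - twist w p * u ^ n) has_fps_expansion 1 - fps_const (twist w p) * fps_X ^ n"
      by (intro fps_expansion_intros)
    moreover from this have "(\<lambda>u. inverse (1 - twist w p * u ^ n)) has_fps_expansion
        inverse (1 - fps_const (twist w p) * fps_X ^ n)"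
      by (rule has_fps_expansion_inverse) (use n in simp)
    ultimately show ?thesis
      by (cases s) (simp_all add: nws cyclo_fun_def[abs_def] cyclo_fps_def Let_def)
  qed
  hence "(\<lambda>u. \<Prod>x\<leftarrow>xs. cyclo_fun x p u) has_fps_expansion (\<Prod>x\<leftarrow>xs. cyclo_fps x p)"
    by (induction xs) (auto intro!: fps_expansion_intros)
  moreover have "local_fun p has_fps_expansion local_fps p"
    unfolding local_fun_def[abs_def] local_fps_def by (intro fps_expansion_intros)
  ultimately show ?thesis unfolding corrected_def[abs_def] by (intro fps_expansion_intros)
qed

definition approximating :: "nat \<Rightarrow> (nat \<times> complex \<times> bool) list \<Rightarrow> bool" where
  "approximating N xs \<longleftrightarrow> admissible N xs \<and>
     (\<forall>p. low_zero (Suc N) (local_fps p * (\<Prod>x\<leftarrow>xs. cyclo_fps x p)))"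

lemma approximating_Nil: "approximating 0 []"
  by (auto simp: approximating_def admissible_def low_zero_def local_fps_def)

lemma norm_corrected_minus_1_le:
  assumes xs: "approximating N xs"
  obtains C where "\<And>p u. norm u \<le> 1/4 \<Longrightarrow> norm (corrected xs p u - 1) \<le> C * norm u ^ Suc N"
proof (rule that)
  fix p u assume u: "norm (u::complex) \<le> 1/4"
  have adm: "admissible N xs" using xs by (simp add: approximating_def)
  have "norm (corrected xs p u - 1) \<le> 2 * (3 * 2 ^ length xs) * (2 * norm u) ^ Suc N"
    using xs norm_corrected_le[OF adm]
    by (intro fps_tail_bound[OF has_fps_expansion_corrected[OF adm] holomorphic_corrected[OF adm]] u)
       (auto simp: approximating_def low_zero_def)
  also have "\<dots> = (2 * (3 * 2 ^ length xs) * 2 ^ Suc N) * norm u ^ Suc N"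
    by (simp add: power_mult_distrib)
  finally show "norm (corrected xs p u - 1) \<le> (2 * (3 * 2 ^ length xs) * 2 ^ Suc N) * norm u ^ Suc N" .
qed

section \<open>The corrected Euler product\<close>

definition factor :: "(nat \<times> complex \<times> bool) list \<Rightarrow> nat \<Rightarrow> complex \<Rightarrow> complex" where
  "factor xs p s = (if prime p then corrected xs p (of_nat p powr (-s)) else 1)"

definition eprod :: "(nat \<times> complex \<times> bool) list \<Rightarrow> complex \<Rightarrow> complex" where
  "eprod xs s = prodinf (\<lambda>p. factor xs p s)"

text \<open>With \<open>u = p^(-s)\<close> the error is \<open>O(p^(-\<sigma> (N+1)))\<close>,
  summable because \<open>\<sigma> (N+1) > 1\<close>. The estimate is asserted for large
  \<open>p\<close>, where \<open>norm u \<le> 1/4\<close>.\<close>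

lemma factor_bound:
  assumes xs: "approximating N xs" and \<sigma>: "\<sigma> > 1 / real (Suc N)"
  obtains M where "summable M" "\<forall>\<^sub>F p in sequentially. \<forall>s. Re s \<ge> \<sigma> \<longrightarrow> norm (factor xs p s - 1) \<le> M p"
proof -
  obtain C where C: "\<And>p u. norm u \<le> 1/4 \<Longrightarrow> norm (corrected xs p u - 1) \<le> C * norm u ^ Suc N"
    using norm_corrected_minus_1_le[OF xs] by blast
  have C0: "C \<ge> 0"
  proof -
    have "0 \<le> norm (corrected xs 0 (1/4) - 1)" by (rule norm_ge_zero)
    also have "\<dots> \<le> C * norm (1/4 :: complex) ^ Suc N" by (rule C) simp
    finally have "0 \<le> C * (1/4) ^ Suc N" by simp
    thus ?thesis using mult_neg_pos[of C "(1/4) ^ Suc N"] by (metis not_le zero_less_power zero_less_divide_1_iff zero_less_numeral)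
  qed
  have \<sigma>0: "\<sigma> > 0" using \<sigma> by (rule le_less_trans[rotated]) simp
  have "1 < \<sigma> * real (Suc N)" using \<sigma> by (simp add: field_simps del: of_nat_Suc)
  hence S: "summable (\<lambda>p. C * real p powr (- (\<sigma> * real (Suc N))))"
    using summable_real_powr_iff[of "- (\<sigma> * real (Suc N))"] by (intro summable_mult) simp
  have "((\<lambda>p. real p powr (-\<sigma>)) \<longlongrightarrow> 0) sequentially"
    using \<sigma>0 by (intro tendsto_neg_powr filterlim_real_sequentially) auto
  hence ev: "\<forall>\<^sub>F p in sequentially. real p powr (-\<sigma>) < 1/4" by (rule order_tendstoD) simp
  show ?thesis
  proof (rule that[OF S])
    show "\<forall>\<^sub>F p in sequentially. \<forall>s. Re s \<ge> \<sigma> \<longrightarrow>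
      norm (factor xs p s - 1) \<le> C * real p powr (- (\<sigma> * real (Suc N)))"
      using ev eventually_gt_at_top[of 0]
    proof eventually_elim
      case (elim p)
      show ?case
      proof (intro allI impI)
        fix s assume s: "Re s \<ge> \<sigma>"
        have le: "norm (of_nat p powr (-s) :: complex) \<le> real p powr (-\<sigma>)"
          unfolding norm_of_nat_powr using s elim by (intro powr_mono) auto
        hence "norm (of_nat p powr (-s) :: complex) \<le> 1/4" using elim by linarith
        from C[OF this] have "norm (corrected xs p (of_nat p powr (-s)) - 1)
            \<le> C * norm (of_nat p powr (-s) :: complex) ^ Suc N" .
        also have "\<dots> \<le> C * (real p powr (-\<sigma>)) ^ Suc N"
          using le C0 by (intro mult_left_mono power_mono) auto
        also have "(real p powr (-\<sigma>)) ^ Suc N = real p powr (- (\<sigma> * real (Suc N)))"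
          using elim by (subst powr_realpow[symmetric]) (simp_all add: powr_powr del: power_Suc of_nat_Suc)
        finally show "norm (factor xs p s - 1) \<le> C * real p powr (- (\<sigma> * real (Suc N)))"
          using C0 by (simp add: factor_def)
      qed
    qed
  qed
qed

lemma has_prod_eprod:
  assumes xs: "approximating N xs" and s: "Re s > 1 / real (Suc N)"
  shows "(\<lambda>p. factor xs p s) has_prod eprod xs s"
proof -
  obtain M where M: "summable M" "\<forall>\<^sub>F p in sequentially. \<forall>z. Re z \<ge> Re s \<longrightarrow> norm (factor xs p z - 1) \<le> M p"
    using factor_bound[OF xs s] by blast
  from M(2) have "\<forall>\<^sub>F p in sequentially. norm (norm (factor xs p s - 1)) \<le> M p"
    by eventually_elim auto
  hence "summable (\<lambda>p. norm (factor xs p s - 1))"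
    using M(1) by (rule summable_comparison_test_ev)
  hence "convergent_prod (\<lambda>p. factor xs p s)"
    by (intro abs_convergent_prod_imp_convergent_prod summable_imp_abs_convergent_prod)
  thus ?thesis unfolding eprod_def by (rule convergent_prod_has_prod)
qed

lemma holomorphic_factor:
  assumes xs: "approximating N xs" shows "factor xs p holomorphic_on {s. Re s > 0}"
proof (cases "prime p")
  case True
  have "(corrected xs p \<circ> (\<lambda>s. of_nat p powr (-s))) holomorphic_on {s. Re s > 0}"
    by (rule holomorphic_on_compose_gen[OF _ holomorphic_corrected])
       (use xs True norm_of_nat_powr_uminus_lt_1 in \<open>auto simp: approximating_def intro!: holomorphic_intros\<close>)
  thus ?thesis using True by (simp add: factor_def[abs_def] o_def)
qed (simp add: factor_def[abs_def])

lemma holomorphic_eprod: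
  assumes xs: "approximating N xs"
  shows "eprod xs holomorphic_on {s. Re s > 1 / real (Suc N)}"
proof (rule holomorphic_uniform_sequence[where f = "\<lambda>n s. \<Prod>p<n. factor xs p s"])
  show "open {s. Re s > 1 / real (Suc N)}" by (rule open_halfspace_Re_gt)
  have sub: "{s. Re s > 1 / real (Suc N)} \<subseteq> {s. Re s > 0}"
    by (auto intro: le_less_trans[rotated])
  show "(\<lambda>s. \<Prod>p<n. factor xs p s) holomorphic_on {s. Re s > 1 / real (Suc N)}" for n
    by (intro holomorphic_intros holomorphic_on_subset[OF holomorphic_factor[OF xs] sub])
  fix s assume s: "s \<in> {s. Re s > 1 / real (Suc N)}"
  define d where "d = (Re s - 1 / real (Suc N)) / 2"
  have d: "d > 0" using s by (simp add: d_def)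
  have re: "Re w \<ge> 1 / real (Suc N) + d" if "w \<in> cball s d" for w
  proof -
    have "\<bar>Re s - Re w\<bar> \<le> d"
      using that abs_Re_le_cmod[of "s - w"] by (simp add: dist_norm)
    hence "Re w \<ge> Re s - d" by linarith
    moreover have "Re s - d = 1 / real (Suc N) + d" by (simp add: d_def field_simps del: of_nat_Suc)
    ultimately show ?thesis by simp
  qed
  have ins: "w \<in> {s. Re s > 1 / real (Suc N)}" if "w \<in> cball s d" for w
    using re[OF that] d by (simp del: of_nat_Suc)
  obtain M where M: "summable M"
    "\<forall>\<^sub>F p in sequentially. \<forall>z. Re z \<ge> 1 / real (Suc N) + d \<longrightarrow> norm (factor xs p z - 1) \<le> M p"
    using factor_bound[OF xs, of "1 / real (Suc N) + d"] d by auto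
  have "uniformly_convergent_on (cball s d) (\<lambda>n z. \<Sum>p<n. norm (factor xs p z - 1))"
  proof (rule Weierstrass_m_test'_ev[OF _ M(1)])
    show "\<forall>\<^sub>F p in sequentially. \<forall>x\<in>cball s d. norm (norm (factor xs p x - 1)) \<le> M p"
      using M(2) by eventually_elim (use re in auto)
  qed
  moreover have "continuous_on (cball s d) (factor xs p)" for p
    by (rule holomorphic_on_imp_continuous_on[OF holomorphic_on_subset[OF holomorphic_factor[OF xs]]])
       (use ins sub in blast)
  ultimately have "uniformly_convergent_on (cball s d) (\<lambda>n z. \<Prod>p<n. factor xs p z)"
    by (intro uniformly_convergent_on_prod') auto
  then obtain g where g: "uniform_limit (cball s d) (\<lambda>n z. \<Prod>p<n. factor xs p z) g sequentially"
    by (auto simp: uniformly_convergent_on_def)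
  have "g z = eprod xs z" if z: "z \<in> cball s d" for z
    using tendsto_uniform_limitI[OF g z] has_prod_imp_tendsto'[OF has_prod_eprod[OF xs, of z]] ins[OF z]
    by (intro LIMSEQ_unique) auto
  hence "uniform_limit (cball s d) (\<lambda>n z. \<Prod>p<n. factor xs p z) (eprod xs) sequentially"
    using g by (subst uniform_limit_cong'[where g = "\<lambda>n z. \<Prod>p<n. factor xs p z" and i = g]) auto
  thus "\<exists>d>0. cball s d \<subseteq> {s. Re s > 1 / real (Suc N)} \<and>
      uniform_limit (cball s d) (\<lambda>n z. \<Prod>p<n. factor xs p z) (eprod xs) sequentially"
    using d ins by blast
qed

lemma eprod_eq_0:
  assumes "approximating N xs" "Re s > 1 / real (Suc N)" "prime p" "local_fun p (of_nat p powr (-s)) = 0"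
  shows "eprod xs s = 0"
  using has_prod_zeroI[OF has_prod_eprod[OF assms(1,2)], of p] assms(3,4)
  by (simp add: factor_def corrected_def)

lemma local_fun_nonzero:
  assumes "Re s \<ge> 2" "prime p"
  shows "local_fun p (of_nat p powr (-s)) \<noteq> 0"
proof -
  have "norm (of_nat p powr (-s) :: complex) \<le> real p powr (-2)"
    unfolding norm_of_nat_powr using assms prime_ge_2_nat[of p] by (intro powr_mono) auto
  also have "\<dots> \<le> 2 powr (-2)" using prime_ge_2_nat[OF assms(2)] by (intro powr_mono2') auto
  also have "\<dots> = (1/4 :: real)" by (simp add: powr_minus)
  finally show ?thesis using norm_local_fun_ge[of _ p] by force
qed

text \<open>One point of nonvanishing shows that \<open>eprod\<close> is not identically zero, so
  that its zeros are isolated. From \<open>Re s = 2\<close> on,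
  \<open>norm (p^(-s)) \<le> 1/4\<close> for all primes; closer to \<open>Re s = 1\<close> the
  polynomial at \<open>p = 2\<close> may vanish.\<close>

lemma eprod_nonzero:
  assumes xs: "approximating N xs" and s: "Re s \<ge> 2"
  shows "eprod xs s \<noteq> 0"
proof
  assume "eprod xs s = 0"
  have "1 / real (Suc N) \<le> 1" by simp
  hence "Re s > 1 / real (Suc N)" using s by linarith
  from has_prod_eq_0_iff[OF has_prod_eprod[OF xs this]] \<open>eprod xs s = 0\<close>
  obtain p where p: "factor xs p s = 0" by auto
  hence pr: "prime p" by (auto simp: factor_def split: if_splits)
  have adm: "admissible N xs" using xs by (simp add: approximating_def)
  have "norm (of_nat p powr (-s) :: complex) < 1" using norm_of_nat_powr_uminus_lt_1[OF pr] s by simp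
  thus False using p pr cyclo_fun_nonzero[OF adm] local_fun_nonzero[OF s pr]
    by (auto simp: factor_def corrected_def prod_list_zero_iff)
qed

section \<open>Comparison with zeta functions\<close>

text \<open>\<open>xi v / (v - 1)\<close> is \<open>zeta v\<close>. The Boolean matches that of
  \<open>cyclo_fun\<close>: the factors \<open>1 - p^w u^n\<close> have product
  \<open>1 / zeta (n s - w)\<close> over the primes, whence the \<open>inverse\<close> wherever this
  function is compared with \<open>eprod\<close>.\<close>

definition zeta_factor :: "nat \<times> complex \<times> bool \<Rightarrow> complex \<Rightarrow> complex" where
  "zeta_factor x s = (case x of (n, w, t) \<Rightarrow>
     let v = of_nat n * s - w; z = xi v / (v - 1) in if t then z else inverse z)"

lemma Re_weight_shift: "w \<in> weights n \<Longrightarrow> Re (of_nat n * s - w) = real n * Re s"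
  by (simp add: Re_weights)

lemma Re_weight_shift_gt_1: "w \<in> weights n \<Longrightarrow> n \<ge> 1 \<Longrightarrow> Re s > 1 \<Longrightarrow> Re (of_nat n * s - w) > 1"
  unfolding Re_weight_shift by (rule less_le_trans[of _ "Re s"]) auto

lemma zeta_factor_nonzero:
  assumes "admissible N xs" "x \<in> set xs" "Re s > 1"
  shows "zeta_factor x s \<noteq> 0"
proof -
  obtain n w t where x: "x = (n, w, t)" by (cases x) auto
  have "Re (of_nat n * s - w) > 1"
    using assms x by (intro Re_weight_shift_gt_1) (auto simp: admissible_def)
  moreover from this have "of_nat n * s - w \<noteq> 1" by (metis less_irrefl one_complex.sel(1))
  ultimately show ?thesis using xi_nonzero by (auto simp: zeta_factor_def x Let_def)
qed

text \<open>With \<open>u = p^(-s)\<close> the term \<open>p^w u^n\<close> is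
  \<open>p^(-(n s - w))\<close>, so this is the Euler product of zeta at
  \<open>n s - w\<close>.\<close>

lemma has_prod_cyclo_fun:
  assumes "n \<ge> 1" "w \<in> weights n" "Re s > 1"
  shows "(\<lambda>p. if prime p then cyclo_fun (n, w, t) p (of_nat p powr (-s)) else 1)
           has_prod inverse (zeta_factor (n, w, t) s)"
proof -
  define v where "v = of_nat n * s - w"
  define E :: "nat \<Rightarrow> complex" where "E p = (if prime p then 1 - of_nat p powr (-v) else 1)" for p
  have E: "E has_prod inverse (xi v / (v - 1))"
    using euler_product_xi[OF Re_weight_shift_gt_1[OF assms(2,1,3)]] unfolding E_def v_def by simp
  have eq: "1 - twist w p * (of_nat p powr (-s)) ^ n = E p" if "prime p" for p
  proof -
    have "p > 0" using that by (rule prime_gt_0_nat)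
    hence "twist w p * (of_nat p powr (-s)) ^ n = of_nat p powr (-v)"
      by (simp add: of_nat_powr_eq_twist v_def twist_def exp_of_nat_mult[symmetric] exp_add[symmetric] algebra_simps)
    thus ?thesis using that by (simp add: E_def)
  qed
  have "(\<lambda>p. if t then E p else inverse (E p)) has_prod inverse (zeta_factor (n, w, t) s)"
    using E has_prod_inverse[OF E] by (cases t) (simp_all add: zeta_factor_def v_def Let_def)
  also have "(\<lambda>p. if t then E p else inverse (E p)) =
      (\<lambda>p. if prime p then cyclo_fun (n, w, t) p (of_nat p powr (-s)) else 1)"
  proof
    fix p show "(if t then E p else inverse (E p)) =
      (if prime p then cyclo_fun (n, w, t) p (of_nat p powr (-s)) else 1)"
      by (cases "prime p") (simp_all add: cyclo_fun_def eq, simp add: E_def)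
  qed
  finally show ?thesis .
qed

text \<open>The identity behind the continuation: \<open>eprod []\<close> is the reciprocal of
  \<open>Z_abc\<close>, while \<open>eprod xs\<close> and the zeta factors make sense further to the
  left.\<close>

lemma eprod_eq:
  assumes "admissible N xs" "Re s > 1"
  shows "eprod xs s = eprod [] s * (\<Prod>x\<leftarrow>xs. inverse (zeta_factor x s))"
proof -
  have "(\<lambda>p. factor xs p s) has_prod (eprod [] s * (\<Prod>x\<leftarrow>xs. inverse (zeta_factor x s)))"
    using assms(1)
  proof (induction xs)
    case Nil
    show ?case using has_prod_eprod[OF approximating_Nil, of s] assms(2) by simp
  next
    case (Cons x xs)
    obtain n w t where x: "x = (n, w, t)" by (cases x) auto
    have "(\<lambda>p. (if prime p then cyclo_fun x p (of_nat p powr (-s)) else 1) * factor xs p s)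
        has_prod (inverse (zeta_factor x s) * (eprod [] s * (\<Prod>x\<leftarrow>xs. inverse (zeta_factor x s))))"
      using Cons assms(2) unfolding x
      by (intro has_prod_mult has_prod_cyclo_fun) (auto simp: admissible_def)
    moreover have "(\<lambda>p. (if prime p then cyclo_fun x p (of_nat p powr (-s)) else 1) * factor xs p s) =
        (\<lambda>p. factor (x # xs) p s)"
      by (auto simp: factor_def corrected_def fun_eq_iff)
    ultimately show ?case by (simp add: mult_ac)
  qed
  thus ?thesis unfolding eprod_def by (rule has_prod_unique[symmetric])
qed

lemma local_poly_eq: "prime p \<Longrightarrow> local_poly a b c p s = local_fun p (of_nat p powr (-s))"
  using prime_gt_0_nat[of p] twist_add[of c "- s - s" p] twist_add[of "- s" "- s" p]
  by (simp add: local_poly_def local_fun_def of_nat_powr_eq_twist power2_eq_square)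

lemma euler_factor_eq: "euler_factor a b c s n = inverse (factor [] n s)"
  by (simp add: euler_factor_def factor_def corrected_def local_poly_eq)

lemma abs_convergent_euler_factor:
  assumes s: "Re s > 1"
  shows "abs_convergent_prod (euler_factor a b c s)"
proof -
  have "((\<lambda>p. real p powr (- Re s)) \<longlongrightarrow> 0) sequentially"
    using s by (intro tendsto_neg_powr filterlim_real_sequentially) auto
  hence ev: "\<forall>\<^sub>F p in sequentially. real p powr (- Re s) < 1/4" by (rule order_tendstoD) simp
  \<comment> \<open>\<open>12 = 3 / (1/4)\<close>: the bound \<open>3 * norm u\<close> for
    \<open>1 - local_fun p u\<close>, over the lower bound \<open>1/4\<close> for
    \<open>local_fun p u\<close>.\<close>
  hence "\<forall>\<^sub>F p in sequentially. norm (norm (euler_factor a b c s p - 1)) \<le> 12 * real p powr (- Re s)"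
  proof eventually_elim
    case (elim p)
    show ?case
    proof (cases "prime p")
      case True
      define u where "u = (of_nat p powr (-s) :: complex)"
      have u: "norm u \<le> 1/4" "norm u = real p powr (- Re s)"
        using elim by (simp_all add: u_def norm_of_nat_powr)
      have L: "norm (local_fun p u) \<ge> 1/4" using norm_local_fun_ge[OF u(1)] .
      hence nz: "local_fun p u \<noteq> 0" by auto
      have "norm u ^ 2 \<le> norm u" using u(1) by (simp add: power2_eq_square mult_left_le)
      hence n: "norm (1 - local_fun p u) \<le> 3 * norm u" using norm_local_fun_le[of p u] by simp
      have "norm (euler_factor a b c s p - 1) = norm ((1 - local_fun p u) / local_fun p u)"
        using True nz by (simp add: euler_factor_def local_poly_eq u_def[symmetric] field_simps)
      also have "\<dots> \<le> 3 * norm u / (1/4)"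
        unfolding norm_divide using n L by (intro frac_le) auto
      finally show ?thesis using u(2) by simp
    qed (simp add: euler_factor_def)
  qed
  hence "summable (\<lambda>p. norm (euler_factor a b c s p - 1))"
    by (rule summable_comparison_test_ev) (use s in \<open>auto intro!: summable_mult simp: summable_real_powr_iff\<close>)
  thus ?thesis by (rule summable_imp_abs_convergent_prod)
qed

text \<open>The convention \<open>inverse 0 = 0\<close> makes this hold also where a local
  polynomial vanishes: both sides are then \<open>0\<close>, the value prescribed at a pole.\<close>

lemma Z_abc_eq:
  assumes "Re s > 1" shows "Z_abc a b c s = inverse (eprod [] s)"
proof -
  have "convergent_prod (\<lambda>p. factor [] p s)"
    using has_prod_eprod[OF approximating_Nil, of s] assms by (auto simp: has_prod_iff)
  thus ?thesis unfolding Z_abc_def eprod_def euler_factor_eq[abs_def] by (rule prodinf_inverse)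
qed

end

subsection \<open>Weighted sums over primes\<close>

text \<open>The real part of \<open>p^(-(\<sigma> + i u))\<close>; accordingly
  \<open>prime_cos_sum\<close> is the real part of the prime zeta function.\<close>

definition prime_cos :: "real \<Rightarrow> real \<Rightarrow> nat \<Rightarrow> real" where
  "prime_cos u \<sigma> p = (if prime p then cos (u * ln (real p)) * real p powr (-\<sigma>) else 0)"

definition prime_cos_sum :: "real \<Rightarrow> real \<Rightarrow> real" where
  "prime_cos_sum u \<sigma> = (\<Sum>p. prime_cos u \<sigma> p)"

lemma summable_prime_cos:
  assumes "\<sigma> > 1" shows "summable (prime_cos u \<sigma>)"
proof (rule summable_comparison_test')
  show "summable (\<lambda>p. real p powr (-\<sigma>))" using assms by (simp add: summable_real_powr_iff)
  show "norm (prime_cos u \<sigma> p) \<le> real p powr (-\<sigma>)" for p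
    using mult_right_mono[OF abs_cos_le_one[of "u * ln (real p)"], of "real p powr (-\<sigma>)"]
    by (simp add: prime_cos_def abs_mult)
qed

text \<open>In the logarithm of the Euler product, \<open>ln (norm (1 - v)) + Re v\<close> is of
  second order in \<open>v = p^(-s)\<close>, and \<open>norm v \<le> 1/p\<close>; the errors sum to
  a constant independent of \<sigma> and \<open>u\<close>.\<close>

lemma prime_cos_sum_zeta:
  assumes "\<sigma> > 1"
  shows "\<bar>ln (norm (xi (Complex \<sigma> u) / (Complex \<sigma> u - 1))) - prime_cos_sum u \<sigma>\<bar> \<le> 2 * (\<Sum>n. real n powr (-2))"
proof -
  define s where "s = Complex \<sigma> u"
  define E :: "nat \<Rightarrow> complex" where "E p = (if prime p then 1 - of_nat p powr (-s) else 1)" for p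
  have s: "Re s > 1" using assms by (simp add: s_def)
  have s1: "s \<noteq> 1" using s by auto
  have "E has_prod ((s - 1) / xi s)" using euler_product_xi[OF s] unfolding E_def .
  hence N: "(\<lambda>p. norm (E p)) has_prod norm ((s - 1) / xi s)" by (rule has_prod_norm)
  have z: "norm (of_nat p powr (-s) :: complex) \<le> 1/2"
    "norm (of_nat p powr (-s) :: complex) \<le> real p powr (-1)" if "prime p" for p
  proof -
    show 1: "norm (of_nat p powr (-s) :: complex) \<le> real p powr (-1)"
      unfolding norm_of_nat_powr using s prime_ge_2_nat[OF that] by (intro powr_mono) auto
    have "real p powr (-1) \<le> 2 powr (-1)" using prime_ge_2_nat[OF that] by (intro powr_mono2') auto
    thus "norm (of_nat p powr (-s) :: complex) \<le> 1/2" using 1 by (simp add: powr_minus)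
  qed
  have Enz: "E p \<noteq> 0" for p using z(1)[of p] by (auto simp: E_def)
  have nz: "norm ((s - 1) / xi s) \<noteq> 0" using xi_nonzero[OF s] s1 by simp
  have L: "(\<lambda>p. ln (norm (E p))) sums ln (norm ((s - 1) / xi s))"
    using has_prod_imp_sums_ln_real'[OF N] Enz by simp
  have "(\<lambda>p. ln (norm (E p)) + prime_cos u \<sigma> p) sums (ln (norm ((s - 1) / xi s)) + prime_cos_sum u \<sigma>)"
    unfolding prime_cos_sum_def by (intro sums_add L summable_sums summable_prime_cos assms)
  moreover have bd: "norm (ln (norm (E p)) + prime_cos u \<sigma> p) \<le> 2 * real p powr (-2)" for p
  proof (cases "prime p")
    case True
    define v where "v = (of_nat p powr (-s) :: complex)"
    have p: "p > 0" using True by (rule prime_gt_0_nat)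
    have nv: "norm v \<le> 1/2" "norm v \<le> real p powr (-1)" using z[OF True] by (simp_all add: v_def)
    have v1: "1 - v \<noteq> 0" using nv by auto
    have Rv: "Re v = prime_cos u \<sigma> p"
      using p True by (simp add: v_def powr_def Re_exp prime_cos_def s_def)
    have "norm (Ln (1 + (- v)) - (- v)) \<le> norm (- v) ^ 2 / (1 - norm (- v))"
      by (rule Ln_approx_linear) (use nv in simp)
    also have "\<dots> \<le> norm v ^ 2 / (1/2)" using nv(1) by (intro frac_le) auto
    also have "\<dots> = 2 * norm v ^ 2" by simp
    also have "\<dots> \<le> 2 * (real p powr (-1)) ^ 2" using nv by (intro mult_left_mono power_mono) auto
    also have "(real p powr (-1)) ^ 2 = real p powr (-2)" using p by (simp add: powr_minus power2_eq_square)
    finally have "norm (Ln (1 - v) + v) \<le> 2 * real p powr (-2)" by simp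
    moreover have "\<bar>Re (Ln (1 - v) + v)\<bar> \<le> norm (Ln (1 - v) + v)" by (rule abs_Re_le_cmod)
    moreover have "Re (Ln (1 - v) + v) = ln (norm (E p)) + prime_cos u \<sigma> p"
      using v1 True Rv by (simp add: Re_Ln E_def v_def[symmetric])
    ultimately show ?thesis by simp
  qed (simp add: E_def prime_cos_def)
  moreover have S: "summable (\<lambda>n. 2 * real n powr (-2))"
    by (intro summable_mult) (simp add: summable_real_powr_iff)
  ultimately have "norm (ln (norm ((s - 1) / xi s)) + prime_cos_sum u \<sigma>) \<le> (\<Sum>n. 2 * real n powr (-2))"
    using norm_suminf_le[OF bd S] by (simp add: sums_iff)
  also have "\<dots> = 2 * (\<Sum>n. real n powr (-2))"
    by (intro suminf_mult) (simp add: summable_real_powr_iff)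
  finally show ?thesis
    using xi_nonzero[OF s] s1 by (simp add: norm_divide ln_div s_def)
qed

text \<open>For \<open>u \<noteq> 0\<close> the point \<open>1 + i u\<close> is away from the pole,
  so zeta stays bounded as \<sigma> decreases to \<open>1\<close>. Control from below comes from
  \<open>prime_cos_sum_mertens\<close>.\<close>

lemma prime_cos_sum_upper:
  assumes "u \<noteq> 0"
  obtains C where "\<And>\<sigma>. 1 < \<sigma> \<Longrightarrow> \<sigma> \<le> 2 \<Longrightarrow> prime_cos_sum u \<sigma> \<le> C"
proof
  fix \<sigma> :: real assume \<sigma>: "1 < \<sigma>" "\<sigma> \<le> 2"
  define s where "s = Complex \<sigma> u"
  define M where "M = 1 + (1 + \<bar>u\<bar>) * (2 + \<bar>u\<bar>) * 2"
  have s: "Re s > 1" using \<sigma> by (simp add: s_def)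
  have n: "norm (s - 1) \<le> 1 + \<bar>u\<bar>" "norm s \<le> 2 + \<bar>u\<bar>" "norm (s - 1) \<ge> \<bar>u\<bar>"
    using \<sigma> cmod_le[of "s - 1"] cmod_le[of s] abs_Im_le_cmod[of "s - 1"] by (auto simp: s_def)
  have "norm (s - 1) * norm s * 2 \<le> (1 + \<bar>u\<bar>) * (2 + \<bar>u\<bar>) * 2"
    using n by (intro mult_mono) auto
  hence "norm (xi s) \<le> M" using norm_xi_le[of 1 s] s by (simp add: M_def)
  hence "norm (xi s / (s - 1)) \<le> M / \<bar>u\<bar>"
    unfolding norm_divide using n assms by (intro frac_le) (auto simp: M_def)
  moreover have "norm (xi s / (s - 1)) > 0" using xi_nonzero[OF s] s by auto
  ultimately have "ln (norm (xi s / (s - 1))) \<le> ln (M / \<bar>u\<bar>)" by (intro ln_mono)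
  thus "prime_cos_sum u \<sigma> \<le> ln ((1 + (1 + \<bar>u\<bar>) * (2 + \<bar>u\<bar>) * 2) / \<bar>u\<bar>) + 2 * (\<Sum>n. real n powr (-2))"
    using prime_cos_sum_zeta[OF \<sigma>(1), of u] unfolding s_def M_def by linarith
qed

lemma xi_1: "xi 1 = 1"
proof -
  have "zeta_term (Suc k) 1 = 0" for k
    using of_nat_neq_0[of k, where 'a = complex] of_nat_neq_0[of "Suc k", where 'a = complex]
    by (simp add: zeta_term_def del: of_nat_Suc)
  thus ?thesis by (simp add: xi_def)
qed

text \<open>The pole of zeta at \<open>1\<close>, present because \<open>xi 1 = 1\<close>, makes
  \<open>ln (norm (zeta \<sigma>))\<close> unbounded.\<close>

lemma prime_cos_sum_0_unbounded:
  obtains \<sigma> where "1 < \<sigma>" "\<sigma> \<le> 2" "prime_cos_sum 0 \<sigma> \<ge> B"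
proof -
  define K where "K = 2 * (\<Sum>n. real n powr (-2))"
  have "isCont xi 1"
    using holomorphic_on_imp_continuous_on[OF holomorphic_xi]
    by (simp add: continuous_on_eq_continuous_at open_halfspace_Re_gt)
  then obtain d where d: "d > 0" "\<And>z. dist z 1 < d \<Longrightarrow> dist (xi z) (xi 1) < 1/2"
    unfolding continuous_at_eps_delta by (meson half_gt_zero zero_less_one)
  \<comment> \<open>\<open>d / 2\<close> secures \<open>norm (xi s) \<ge> 1/2\<close>; the last
    entry makes \<open>(1/2) / x\<close>, a lower bound for \<open>norm (zeta (1 + x))\<close>, at
    least \<open>exp (B + K)\<close>.\<close>
  define x where "x = min (d / 2) (min 1 (exp (- (B + K)) / 2))"
  have x: "0 < x" "x < d" "x \<le> 1" "x \<le> exp (- (B + K)) / 2" using d by (auto simp: x_def)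
  define s where "s = Complex (1 + x) 0"
  have s: "s = 1 + of_real x" by (simp add: s_def complex_eq_iff)
  have "dist (xi s) 1 < 1/2" using d(2)[of s] x by (simp add: s dist_norm xi_1)
  hence n: "norm (xi s) \<ge> 1/2" using norm_triangle_ineq2[of 1 "1 - xi s"] by (simp add: dist_norm norm_minus_commute)
  have "exp (B + K) * (2 * x) \<le> exp (B + K) * exp (- (B + K))"
    using x by (intro mult_left_mono) auto
  also have "\<dots> = 1" by (simp only: exp_minus_inverse)
  finally have "exp (B + K) \<le> (1/2) / x" using x by (simp add: field_simps)
  also have "\<dots> \<le> norm (xi s) / x" using n x by (intro divide_right_mono) auto
  also have "\<dots> = norm (xi s / (s - 1))" using x by (simp add: s norm_divide)
  finally have le: "exp (B + K) \<le> norm (xi s / (s - 1))" .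
  have "B + K = ln (exp (B + K))" by simp
  also have "\<dots> \<le> ln (norm (xi s / (s - 1)))" using le by (intro ln_mono) auto
  finally have "B + K \<le> ln (norm (xi s / (s - 1)))" .
  hence "prime_cos_sum 0 (1 + x) \<ge> B"
    using prime_cos_sum_zeta[of "1 + x" 0] x unfolding s_def K_def by linarith
  thus ?thesis using that[of "1 + x"] x by simp
qed

lemma prime_cos_sum_uminus: "prime_cos_sum (- u) \<sigma> = prime_cos_sum u \<sigma>"
proof -
  have "prime_cos (- u) \<sigma> = prime_cos u \<sigma>" by (rule ext) (simp add: prime_cos_def)
  thus ?thesis by (simp add: prime_cos_sum_def)
qed

text \<open>For \<open>u \<noteq> 0\<close> it gives \<open>prime_cos_sum u \<sigma> \<ge> - 3/4 *
  prime_cos_sum 0 \<sigma>\<close> up to a constant, so this sum cannot cancel the main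
  term.\<close>

lemma prime_cos_sum_mertens:
  assumes "\<sigma> > 1"
  shows "3 * prime_cos_sum 0 \<sigma> + 4 * prime_cos_sum u \<sigma> + prime_cos_sum (2 * u) \<sigma> \<ge> 0"
proof -
  have "3 * prime_cos_sum 0 \<sigma> + 4 * prime_cos_sum u \<sigma> + prime_cos_sum (2 * u) \<sigma>
      = (\<Sum>p. 3 * prime_cos 0 \<sigma> p + 4 * prime_cos u \<sigma> p + prime_cos (2 * u) \<sigma> p)"
    unfolding prime_cos_sum_def using summable_prime_cos[OF assms]
    by (simp add: suminf_add[symmetric] suminf_mult summable_mult summable_add)
  also have "\<dots> \<ge> 0"
  proof (intro suminf_nonneg summable_add summable_mult summable_prime_cos assms)
    fix p :: nat
    have "3 + 4 * cos x + cos (2 * x) = 2 * (1 + cos x)\<^sup>2" for x :: real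
      unfolding cos_double_cos by (simp add: power2_eq_square algebra_simps)
    hence "3 + 4 * cos x + cos (2 * x) \<ge> 0" for x :: real by simp
    from mult_right_mono[OF this[of "u * ln (real p)"], of "real p powr (-\<sigma>)"]
    show "3 * prime_cos 0 \<sigma> p + 4 * prime_cos u \<sigma> p + prime_cos (2 * u) \<sigma> p \<ge> 0"
      by (simp add: prime_cos_def algebra_simps)
  qed
  finally show ?thesis .
qed

section \<open>Primes of large weight\<close>

text \<open>For \<open>t = Im (a + b - c)\<close> and \<open>u = Im (a - b)\<close> this is a
  quarter of the square of |p^a + p^b| |p^a p^b - p^c|; see \<open>twist_weight\<close>. As a
  trigonometric polynomial in \<open>ln p\<close> it is summed over the primes through
  \<open>prime_cos_sum\<close>.\<close>

definition prime_weight :: "real \<Rightarrow> real \<Rightarrow> nat \<Rightarrow> real" where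
  "prime_weight t u p = (1 - cos (t * ln (real p))) * (1 + cos (u * ln (real p)))"

lemma prime_weight_le: "prime_weight t u p \<le> 4"
proof -
  have a: "0 \<le> 1 - cos x" "1 - cos x \<le> 2" "0 \<le> 1 + cos x" "1 + cos x \<le> 2" for x :: real
    using cos_le_one[of x] cos_ge_minus_one[of x] by linarith+
  have "prime_weight t u p \<le> 2 * 2" unfolding prime_weight_def using a by (intro mult_mono) auto
  thus "prime_weight t u p \<le> 4" by simp
qed

lemma weighted_sum_eq:
  assumes "\<sigma> > 1"
  shows "(\<lambda>p. if prime p then prime_weight t u p * real p powr (-\<sigma>) else 0) sums
    (prime_cos_sum 0 \<sigma> - prime_cos_sum t \<sigma> + prime_cos_sum u \<sigma>
      - prime_cos_sum (t + u) \<sigma> / 2 - prime_cos_sum (t - u) \<sigma> / 2)"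
proof -
  have "(\<lambda>p. if prime p then prime_weight t u p * real p powr (-\<sigma>) else 0) =
    (\<lambda>p. prime_cos 0 \<sigma> p - prime_cos t \<sigma> p + prime_cos u \<sigma> p
      - prime_cos (t + u) \<sigma> p / 2 - prime_cos (t - u) \<sigma> p / 2)"
    by (rule ext) (simp add: prime_weight_def prime_cos_def cos_add cos_diff field_simps)
  thus ?thesis unfolding prime_cos_sum_def
    by (simp only:) (intro sums_add sums_diff sums_divide summable_sums summable_prime_cos assms)
qed

text \<open>In general, sums with a negative coefficient are bounded above, and Mertens' inequality
  leaves a quarter of the main term against \<open>prime_cos_sum u \<sigma>\<close>.\<close>

lemma weighted_sum_lower:
  assumes t: "t \<noteq> 0"
  obtains C where "\<And>\<sigma>. 1 < \<sigma> \<Longrightarrow> \<sigma> \<le> 2 \<Longrightarrow>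
    prime_cos_sum 0 \<sigma> - prime_cos_sum t \<sigma> + prime_cos_sum u \<sigma>
      - prime_cos_sum (t + u) \<sigma> / 2 - prime_cos_sum (t - u) \<sigma> / 2 \<ge> prime_cos_sum 0 \<sigma> / 4 - C"
proof -
  have "\<exists>C. \<forall>v\<noteq>0. \<forall>\<sigma>. 1 < \<sigma> \<and> \<sigma> \<le> 2 \<longrightarrow> prime_cos_sum v \<sigma> \<le> C v"
  proof (rule choice, rule allI)
    fix v :: real
    show "\<exists>C. v \<noteq> 0 \<longrightarrow> (\<forall>\<sigma>. 1 < \<sigma> \<and> \<sigma> \<le> 2 \<longrightarrow> prime_cos_sum v \<sigma> \<le> C)"
    proof (cases "v = 0")
      case False
      thus ?thesis using prime_cos_sum_upper[of v] by metis
    qed simp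
  qed
  then obtain C where C: "\<And>v \<sigma>. v \<noteq> 0 \<Longrightarrow> 1 < \<sigma> \<Longrightarrow> \<sigma> \<le> 2 \<Longrightarrow> prime_cos_sum v \<sigma> \<le> C v"
    by blast
  define D where "D = 2 * \<bar>C t\<bar> + \<bar>C (2 * u)\<bar> + \<bar>C (t + u)\<bar> + \<bar>C (t - u)\<bar> + \<bar>C (2 * t)\<bar>"
  show ?thesis
  proof (rule that[of D])
    fix \<sigma> :: real assume \<sigma>: "1 < \<sigma>" "\<sigma> \<le> 2"
    define Q where "Q v = prime_cos_sum v \<sigma>" for v
    have Q: "Q v \<le> C v" if "v \<noteq> 0" for v using C[OF that \<sigma>] by (simp add: Q_def)
    have Q0: "Q 0 \<ge> 0" unfolding Q_def prime_cos_sum_def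
      by (intro suminf_nonneg summable_prime_cos \<sigma>) (simp add: prime_cos_def)
    have Qm: "3 * Q 0 + 4 * Q u + Q (2 * u) \<ge> 0" unfolding Q_def by (rule prime_cos_sum_mertens[OF \<sigma>(1)])
    have Qe: "Q (- v) = Q v" for v unfolding Q_def by (rule prime_cos_sum_uminus)
    have "Q 0 - Q t + Q u - Q (t + u) / 2 - Q (t - u) / 2 \<ge> Q 0 / 4 - D"
    proof -
      \<comment> \<open>If \<open>u\<close>, \<open>t + u\<close> or \<open>t - u\<close> vanishes,
        the corresponding sum is a main term itself. The total coefficient of the main term is then
        \<open>2\<close> or \<open>1/2\<close>, still above \<open>1/4\<close>.\<close>
      consider "u = 0" | "u = t" "u \<noteq> 0" | "u = - t" "u \<noteq> 0" | "u \<noteq> 0" "t + u \<noteq> 0" "t - u \<noteq> 0"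
        by fastforce
      thus ?thesis
      proof cases
        case 1
        thus ?thesis using Q[OF t] Q0 unfolding D_def by (simp; linarith)
      next
        case 2
        have "2 * t \<noteq> 0" using t by simp
        from Q[OF this] show ?thesis using 2 Q0 unfolding D_def by (simp; linarith)
      next
        case 3
        have "2 * t \<noteq> 0" using t by simp
        from Q[OF this] show ?thesis using 3 Q0 Qe[of t] unfolding D_def by (simp; linarith)
      next
        case 4
        hence "2 * u \<noteq> 0" by simp
        from Q[OF this] Q[OF t] Q[OF 4(2)] Q[OF 4(3)] Qm show ?thesis unfolding D_def by linarith
      qed
    qed
    thus "prime_cos_sum 0 \<sigma> - prime_cos_sum t \<sigma> + prime_cos_sum u \<sigma>
      - prime_cos_sum (t + u) \<sigma> / 2 - prime_cos_sum (t - u) \<sigma> / 2 \<ge> prime_cos_sum 0 \<sigma> / 4 - D"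
      unfolding Q_def .
  qed
qed

text \<open>Primes of weight below \<open>1/16\<close> account for at most a sixteenth of
  \<open>prime_cos_sum 0 \<sigma>\<close>, but the weighted sum is at least a quarter of it up to a
  constant. The other primes, of weight at most \<open>4\<close>, must supply the
  difference.\<close>

lemma not_summable_weighted_primes:
  assumes t: "t \<noteq> 0"
  shows "\<not> summable (\<lambda>p. if prime p \<and> prime_weight t u p \<ge> 1/16 then 1 / real p else 0)"
    (is "\<not> summable ?g")
proof
  assume S: "summable ?g"
  obtain C where C: "\<And>\<sigma>. 1 < \<sigma> \<Longrightarrow> \<sigma> \<le> 2 \<Longrightarrow>
    prime_cos_sum 0 \<sigma> - prime_cos_sum t \<sigma> + prime_cos_sum u \<sigma>
      - prime_cos_sum (t + u) \<sigma> / 2 - prime_cos_sum (t - u) \<sigma> / 2 \<ge> prime_cos_sum 0 \<sigma> / 4 - C"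
    using weighted_sum_lower[OF t] by blast
  \<comment> \<open>The factor \<open>16/3\<close> inverts \<open>1/4 - 1/16\<close>; the additional
    \<open>1\<close> makes the contradiction strict.\<close>
  obtain \<sigma> where \<sigma>: "1 < \<sigma>" "\<sigma> \<le> 2" "prime_cos_sum 0 \<sigma> \<ge> 16/3 * (C + 4 * suminf ?g) + 1"
    using prime_cos_sum_0_unbounded by blast
  have le: "(if prime p then prime_weight t u p * real p powr (-\<sigma>) else 0) \<le> 4 * ?g p + prime_cos 0 \<sigma> p / 16" for p
  proof (cases "prime p")
    case True
    have p: "real p \<ge> 1" using prime_ge_1_nat[OF True] by simp
    have pw: "real p powr (-\<sigma>) \<le> 1 / real p"
      using powr_mono[of "-\<sigma>" "-1" "real p"] p \<sigma> by (simp add: powr_minus inverse_eq_divide)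
    show ?thesis
    proof (cases "prime_weight t u p \<ge> 1/16")
      case T: True
      have "prime_weight t u p * real p powr (-\<sigma>) \<le> 4 * (1 / real p)"
        using pw prime_weight_le by (intro mult_mono) auto
      thus ?thesis using True T by (simp add: prime_cos_def add_increasing2)
    next
      case False
      have "prime_weight t u p * real p powr (-\<sigma>) \<le> (1/16) * real p powr (-\<sigma>)"
        using False by (intro mult_right_mono) auto
      thus ?thesis using True False by (simp add: prime_cos_def)
    qed
  qed (simp add: prime_cos_def)
  have "prime_cos_sum 0 \<sigma> / 4 - C \<le> (\<Sum>p. 4 * ?g p + prime_cos 0 \<sigma> p / 16)"
    using C[OF \<sigma>(1,2)] weighted_sum_eq[OF \<sigma>(1), of t u] S
      suminf_le[OF le, OF sums_summable[OF weighted_sum_eq[OF \<sigma>(1)]]]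
      summable_add[OF summable_mult[OF S] summable_divide[OF summable_prime_cos[OF \<sigma>(1)]]]
    by (fastforce simp: sums_iff)
  also have "\<dots> = 4 * suminf ?g + prime_cos_sum 0 \<sigma> / 16"
    unfolding prime_cos_sum_def using S summable_prime_cos[OF \<sigma>(1)]
    by (simp add: suminf_add[symmetric] suminf_mult suminf_divide summable_mult summable_divide)
  finally show False using \<sigma>(3) by (simp add: field_simps)
qed

subsection \<open>Small zeros of the local polynomials\<close>

text \<open>If \<open>norm u = 1\<close>, conjugating \<open>S = 1 / u + C u\<close> gives
  \<open>cnj S = S / C\<close>, while always \<open>cnj S = S / (A B)\<close>; hence
  \<open>S (A B - C) = 0\<close>. The proof quantifies this: with \<open>r = norm u\<close>, the
  product of norms in the hypothesis is at most \<open>2 (1 - r^2) / r\<close>.\<close>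

lemma quadratic_small_root:
  fixes A B C :: complex
  assumes n: "norm A = 1" "norm B = 1" "norm C = 1" and AB: "norm (A + B) * norm (A * B - C) \<ge> 1/2"
  obtains u where "1 - (A + B) * u + C * u ^ 2 = 0" "1/3 \<le> norm u" "norm u \<le> 8/9"
proof -
  have nz: "A \<noteq> 0" "B \<noteq> 0" "C \<noteq> 0" using n by auto
  define S where "S = A + B"
  define d where "d = csqrt (S ^ 2 - 4 * C)"
  have d2: "d * d = S * S - 4 * C" unfolding d_def by (metis power2_csqrt power2_eq_square)
  define u1 u2 where "u1 = (S + d) / (2 * C)" and "u2 = (S - d) / (2 * C)"
  have quad: "1 - S * v + C * v ^ 2 = 0" if v: "2 * C * v = S + e" and e: "e * e = S * S - 4 * C" for v e
  proof -
    have "4 * C * (1 - S * v + C * v ^ 2) = 4 * C - 2 * S * (2 * C * v) + (2 * C * v) * (2 * C * v)"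
      by (simp add: algebra_simps power2_eq_square)
    also have "\<dots> = 4 * C - S * S + e * e" unfolding v by (simp add: algebra_simps)
    finally show ?thesis using e nz by simp
  qed
  have root: "1 - S * u1 + C * u1 ^ 2 = 0" "1 - S * u2 + C * u2 ^ 2 = 0"
    using nz d2 by (intro quad[of _ d] quad[of _ "-d"]; simp add: u1_def u2_def)+
  have "u1 * u2 = (S * S - d * d) / (4 * C * C)"
    using nz unfolding u1_def u2_def by (simp add: field_simps)
  also have "\<dots> = 1 / C" using nz by (simp add: d2)
  finally have "u1 * u2 = 1 / C" .
  hence "norm u1 * norm u2 = 1" using n by (metis norm_divide norm_mult norm_one div_by_1)
  hence "norm u1 \<le> 1 \<or> norm u2 \<le> 1"
    using mult_strict_mono[of 1 "norm u1" 1 "norm u2"] by force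
  then obtain u where u: "1 - S * u + C * u ^ 2 = 0" "norm u \<le> 1" using root by blast
  define r where "r = norm u"
  have u0: "u \<noteq> 0" using u by auto
  have r: "r > 0" "r \<le> 1" using u u0 by (auto simp: r_def)
  have nS: "norm S \<le> 2" unfolding S_def using norm_triangle_ineq[of A B] n by simp
  \<comment> \<open>This lower bound keeps the real parts of the zeros below a multiple of
    \<open>1 / ln p\<close>, so that they approach the boundary line.\<close>
  have low: "r \<ge> 1/3"
  proof -
    have "1 = S * u - C * u ^ 2" using u by (simp add: algebra_simps)
    hence "1 = norm (S * u - C * u ^ 2)" by (metis norm_one)
    also have "\<dots> \<le> norm S * r + r ^ 2"
      unfolding r_def by (rule order.trans[OF norm_triangle_ineq4]) (simp add: norm_mult norm_power n)
    also have "\<dots> \<le> 2 * r + r * 1" unfolding power2_eq_square using nS r by (intro add_mono mult_mono) auto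
    finally show ?thesis by simp
  qed
  have cn: "cnj A = 1 / A" "cnj B = 1 / B" "cnj C = 1 / C"
    using n nz complex_norm_square[of A] complex_norm_square[of B] complex_norm_square[of C]
    by (simp_all add: field_simps)
  have rr: "u * cnj u = of_real (r ^ 2)" unfolding r_def by (metis complex_norm_square)
  have Su: "S = 1 / u + C * u" using u u0 by (simp add: field_simps power2_eq_square)
  have cS: "cnj S = S / (A * B)" unfolding S_def using cn nz by (simp add: field_simps)
  have cS2: "cnj S = 1 / cnj u + cnj u / C" unfolding Su using cn by simp
  have "S * (A * B - C) = A * B * C * (S / C - S / (A * B))" using nz by (simp add: field_simps)
  hence "norm S * norm (A * B - C) = norm (S / C - S / (A * B))"
    using n by (metis norm_mult mult_1)
  also have "S / C - S / (A * B) = (1 / C) * (1 / u - cnj u) + (u - 1 / cnj u)"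
    unfolding cS[symmetric] cS2 using nz u0 by (subst Su) (simp add: field_simps)
  also have "1 / u - cnj u = of_real (1 - r ^ 2) / u" using rr u0 by (simp add: field_simps)
  also have "u - 1 / cnj u = of_real (r ^ 2 - 1) / cnj u" using rr u0 by (simp add: field_simps)
  also have "norm ((1 / C) * (of_real (1 - r ^ 2) / u) + of_real (r ^ 2 - 1) / cnj u)
      \<le> norm ((1 / C) * (of_real (1 - r ^ 2) / u)) + norm (of_real (r ^ 2 - 1) / cnj u)"
    by (rule norm_triangle_ineq)
  also have "\<dots> = 2 * ((1 - r ^ 2) / r)"
  proof -
    have "r ^ 2 \<le> 1" using r by (simp add: power_le_one)
    hence a: "norm (of_real (1 - r ^ 2) :: complex) = 1 - r ^ 2" "norm (of_real (r ^ 2 - 1) :: complex) = 1 - r ^ 2"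
      unfolding norm_of_real by auto
    show ?thesis unfolding norm_mult norm_divide a by (simp add: n r_def[symmetric])
  qed
  finally have "1/2 \<le> 2 * ((1 - r ^ 2) / r)" using AB unfolding S_def by linarith
  hence q: "r \<le> 4 - 4 * (r * r)" using r by (simp add: field_simps power2_eq_square)
  \<comment> \<open>\<open>8/9\<close> is a rational number slightly above the positive root of
    \<open>4 r^2 + r = 4\<close>.\<close>
  have "r \<le> 8/9"
  proof (rule ccontr)
    assume "\<not> r \<le> 8/9"
    hence "8/9 < r" by simp
    hence "8/9 * (8/9) < r * r" by (intro mult_strict_mono) auto
    thus False using q \<open>8/9 < r\<close> by simp
  qed
  thus ?thesis using that[of u] u low unfolding S_def r_def by blast
qed

context imaginary_twists
begin

lemma twist_imag: "Re w = 0 \<Longrightarrow> twist w p = cis (Im w * ln (real p))"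
  by (simp add: twist_def cis_conv_exp complex_eq_iff Re_exp Im_exp)

lemma norm_one_plus_cis: "norm (1 + cis x) ^ 2 = 2 * (1 + cos x)"
  and norm_one_minus_cis: "norm (1 - cis x) ^ 2 = 2 * (1 - cos x)"
proof -
  have "cos x ^ 2 + sin x ^ 2 = 1" by simp
  thus "norm (1 + cis x) ^ 2 = 2 * (1 + cos x)" "norm (1 - cis x) ^ 2 = 2 * (1 - cos x)"
    unfolding cmod_power2 by (simp_all add: power2_eq_square algebra_simps)
qed

text \<open>Pulling out \<open>p^b\<close> and \<open>p^c\<close>, of modulus \<open>1\<close>,
  leaves \<open>1 + p^(a - b)\<close> and \<open>1 - p^(a + b - c)\<close>. Their squared norms are
  twice the two factors of the weight, so the threshold \<open>1/16\<close> becomes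
  \<open>4/16 = (1/2)^2\<close>.\<close>

lemma twist_weight:
  assumes "prime_weight (Im (a + b - c)) (Im (a - b)) p \<ge> 1/16"
  shows "norm (twist a p + twist b p) * norm (twist a p * twist b p - twist c p) \<ge> 1/2"
proof -
  define l where "l = ln (real p)"
  have 1: "norm (twist a p + twist b p) = norm (1 + cis (Im (a - b) * l))"
  proof -
    have "twist a p = twist b p * twist (a - b) p" by (simp add: twist_add[symmetric])
    hence "twist a p + twist b p = twist b p * (1 + twist (a - b) p)" by (simp add: algebra_simps)
    thus ?thesis using Re_abc by (simp add: norm_mult norm_twist twist_imag[of "a - b"] l_def)
  qed
  have 2: "norm (twist a p * twist b p - twist c p) = norm (1 - cis (Im (a + b - c) * l))"
  proof -
    have "twist a p * twist b p = twist c p * twist (a + b - c) p" by (simp add: twist_add[symmetric])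
    hence "twist a p * twist b p - twist c p = - (twist c p * (1 - twist (a + b - c) p))" by (simp add: algebra_simps)
    hence "norm (twist a p * twist b p - twist c p) = norm (twist c p * (1 - twist (a + b - c) p))"
      by (simp only: norm_minus_cancel)
    thus ?thesis using Re_abc by (simp add: norm_mult norm_twist twist_imag[of "a + b - c"] l_def)
  qed
  have "(norm (twist a p + twist b p) * norm (twist a p * twist b p - twist c p)) ^ 2
      = 4 * prime_weight (Im (a + b - c)) (Im (a - b)) p"
    unfolding 1 2 power_mult_distrib norm_one_plus_cis norm_one_minus_cis prime_weight_def l_def[symmetric]
    by (simp only: mult_ac mult.left_commute)
  also have "\<dots> \<ge> (1/2) ^ 2" using assms by (simp add: power2_eq_square)
  finally show ?thesis by (rule power2_le_imp_le) simp
qed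

end

section \<open>Gluing meromorphic functions, and natural boundaries\<close>

lemma remove_sings_nicely_meromorphic_eq:
  assumes "f nicely_meromorphic_on A" "z \<in> A"
  shows "remove_sings f z = f z"
  using assms unfolding nicely_meromorphic_on_def by (metis remove_sings_at_pole remove_sings_eqI)

lemma nicely_meromorphic_on_open_cong:
  assumes "f nicely_meromorphic_on A" "open A" "\<And>z. z \<in> A \<Longrightarrow> f z = g z"
  shows "g nicely_meromorphic_on A"
proof -
  have ev: "eventually (\<lambda>w. f w = g w) (at z)" if "z \<in> A" for z
    using assms(2,3) that eventually_at_in_open'[of A z] by (auto elim!: eventually_mono)
  have "g meromorphic_on A"
    using assms(1) meromorphic_on_cong[of A f g A] ev by (auto simp: nicely_meromorphic_on_def)
  moreover have "(is_pole g z \<and> g z = 0) \<or> g \<midarrow>z\<rightarrow> g z" if z: "z \<in> A" for z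
  proof -
    have "is_pole g z \<longleftrightarrow> is_pole f z" using ev[OF z] by (intro is_pole_cong) (auto elim: eventually_mono)
    moreover have "g \<midarrow>z\<rightarrow> g z \<longleftrightarrow> f \<midarrow>z\<rightarrow> f z"
      using ev[OF z] assms(3)[OF z] by (intro filterlim_cong) (auto elim: eventually_mono)
    ultimately show ?thesis using assms(1,3) z by (auto simp: nicely_meromorphic_on_def)
  qed
  ultimately show ?thesis by (simp add: nicely_meromorphic_on_def)
qed

lemma nicely_meromorphic_on_UN:
  assumes "\<And>i. i \<in> I \<Longrightarrow> f nicely_meromorphic_on A i"
  shows "f nicely_meromorphic_on (\<Union>i\<in>I. A i)"
  using assms unfolding nicely_meromorphic_on_def by (auto intro: meromorphic_on_UN)

text \<open>The identity theorem gives agreement off a sparse set; \<open>remove_sings\<close> then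
  normalises the value at every point, poles included, so that agreement holds everywhere.\<close>

lemma remove_sings_eq_if_eq_on_open:
  assumes mero: "f meromorphic_on A" "g meromorphic_on A" and A: "open A" "connected A"
    and B: "open B" "B \<subseteq> A" "B \<noteq> {}" "\<And>z. z \<in> B \<Longrightarrow> f z = g z" and z: "z \<in> A"
  shows "remove_sings f z = remove_sings g z"
proof -
  have "(\<lambda>z. f z - g z) meromorphic_on A" using mero by (intro meromorphic_intros)
  from meromorphic_imp_constant_or_avoid[OF this A, of 0]
  have "eventually (\<lambda>z. f z - g z = 0) (cosparse A)"
  proof
    assume "eventually (\<lambda>z. f z - g z \<noteq> 0) (cosparse A)"
    moreover obtain b where b: "b \<in> B" using B by auto
    ultimately have "eventually (\<lambda>z. f z - g z \<noteq> 0) (at b)"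
      using B A by (auto simp: eventually_cosparse_open_eq)
    moreover have "eventually (\<lambda>z. z \<in> B) (at b)"
      using b B by (intro eventually_at_in_open')
    ultimately have "eventually (\<lambda>z. False) (at b)"
      by eventually_elim (use B in auto)
    thus ?thesis by simp
  qed
  hence "eventually (\<lambda>w. f w = g w) (at z)"
    using z A by (auto simp: eventually_cosparse_open_eq)
  thus ?thesis by (intro remove_sings_cong) auto
qed

text \<open>Singularities of a meromorphic function do not accumulate inside its domain. An
  extension \<open>G\<close> agrees with \<open>F\<close> on a punctured neighbourhood of each point
  of \<open>U \<inter> D\<close>, so it inherits the poles there.\<close>

lemma natural_boundaryI:
  assumes D: "open D" and L: "\<And>z. z \<in> L \<Longrightarrow> z \<notin> D \<and> z islimpt {s \<in> D. is_pole F s}"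
  shows "natural_boundary F D L"
  unfolding natural_boundary_def
proof (intro conjI ballI notI)
  show "L \<subseteq> frontier D"
  proof
    fix z assume "z \<in> L"
    hence "z islimpt D" "z \<notin> D" using L islimpt_subset[of z "{s \<in> D. is_pole F s}" D] by auto
    thus "z \<in> frontier D" using D by (simp add: frontier_def closure_def interior_open)
  qed
next
  fix z assume z: "z \<in> L"
  assume "\<exists>U G. open U \<and> z \<in> U \<and> G meromorphic_on U \<and> (\<forall>\<^sub>\<approx>w\<in>U \<inter> D. G w = F w)"
  then obtain U G where U: "open U" "z \<in> U" "G meromorphic_on U" and ev: "\<forall>\<^sub>\<approx>w\<in>U \<inter> D. G w = F w"
    by blast
  have "\<not> G analytic_on {s}" if s: "s \<in> U \<inter> D" "is_pole F s" for s
  proof -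
    have "eventually (\<lambda>w. G w = F w) (at s)"
      using ev s U D eventually_cosparse_open_eq[of "U \<inter> D"] by (auto simp: open_Int)
    hence "is_pole G s" using s(2) is_pole_cong[of G F s s] by auto
    thus ?thesis using analytic_at_imp_no_pole by blast
  qed
  hence sub: "U \<inter> {s \<in> D. is_pole F s} \<subseteq> {w. \<not> G analytic_on {w}}" by auto
  have "z islimpt {s \<in> D. is_pole F s}" using L z by blast
  hence "z islimpt ({s \<in> D. is_pole F s} \<inter> U)"
    using U by (intro islimpt_Int_eventually eventually_at_in_open')
  hence "z islimpt {w. \<not> G analytic_on {w}}"
    by (rule islimpt_subset) (use sub in auto)
  thus False using meromorphic_on_imp_not_islimpt_singularities[OF U(3,2)] by blast
qed

subsection \<open>Sets of primes with few elements\<close>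

text \<open>Grouped by \<open>N = nat \<lceil>ln (real p) / lam\<rceil>\<close>, the elements of
  \<open>S\<close> number at most \<open>K * N ^ D\<close> in each group, and each reciprocal there
  is at most \<open>exp (- lam * (N - 1))\<close>.\<close>

lemma summable_inverse_if_few:
  fixes S :: "nat set" and lam K :: real
  assumes S: "\<And>p. p \<in> S \<Longrightarrow> p \<ge> 2" and lam: "lam > 0"
    and K: "\<And>N::nat. N \<ge> 1 \<Longrightarrow> real (card {p \<in> S. ln (real p) \<le> lam * real N}) \<le> K * real N ^ D"
    and sm: "summable (\<lambda>N. K * real N ^ D * exp (- lam * (real N - 1)))"
  shows "summable (\<lambda>p. if p \<in> S then 1 / real p else 0)"
proof (rule summableI_nonneg_bounded)
  fix m
  define T where "T = {p \<in> S. p < m}"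
  define f where "f p = nat \<lceil>ln (real p) / lam\<rceil>" for p
  define M where "M = Max (insert 1 (f ` T))"
  have finT: "finite T" by (simp add: T_def)
  have f: "f p \<ge> 1" "ln (real p) \<le> lam * real (f p)" "lam * (real (f p) - 1) \<le> ln (real p)"
    if p: "p \<in> S" for p
  proof -
    have "ln (real p) > 0" using S[OF p] by simp
    hence pos: "ln (real p) / lam > 0" using lam by simp
    hence "\<lceil>ln (real p) / lam\<rceil> \<ge> 1" by linarith
    thus "f p \<ge> 1" unfolding f_def by linarith
    have r: "real (f p) = real_of_int \<lceil>ln (real p) / lam\<rceil>" using pos by (simp add: f_def)
    have "ln (real p) / lam \<le> real (f p)" "real (f p) - 1 \<le> ln (real p) / lam"
      unfolding r by linarith+
    thus "ln (real p) \<le> lam * real (f p)" "lam * (real (f p) - 1) \<le> ln (real p)"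
      using lam by (simp_all add: field_simps)
  qed
  have "(\<Sum>p<m. if p \<in> S then 1 / real p else 0) = (\<Sum>p\<in>T. 1 / real p)"
    by (rule sum.mono_neutral_cong_right) (auto simp: T_def)
  also have "\<dots> = (\<Sum>N\<in>{1..M}. \<Sum>p\<in>{p \<in> T. f p = N}. 1 / real p)"
    by (rule sum.group[symmetric]) (use finT f(1) in \<open>auto simp: M_def T_def\<close>)
  also have "\<dots> \<le> (\<Sum>N\<in>{1..M}. K * real N ^ D * exp (- lam * (real N - 1)))"
  proof (rule sum_mono)
    fix N assume N: "N \<in> {1..M}"
    have le: "1 / real p \<le> exp (- lam * (real N - 1))" if p: "p \<in> {p \<in> T. f p = N}" for p
    proof -
      have pS: "p \<in> S" "f p = N" using p by (auto simp: T_def)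
      have p0: "real p > 0" using S[OF pS(1)] by simp
      have "exp (lam * (real N - 1)) \<le> exp (ln (real p))" using f(3)[OF pS(1)] pS by simp
      hence "exp (lam * (real N - 1)) \<le> real p" using p0 by simp
      hence "1 / real p \<le> 1 / exp (lam * (real N - 1))" using p0 by (intro divide_left_mono) auto
      thus ?thesis by (simp add: exp_minus inverse_eq_divide)
    qed
    have sub: "{p \<in> T. f p = N} \<subseteq> {p \<in> S. ln (real p) \<le> lam * real N}"
      using f(2) by (auto simp: T_def)
    have "p \<le> nat \<lceil>exp (lam * real N)\<rceil>" if "p \<in> S" "ln (real p) \<le> lam * real N" for p
    proof -
      have "real p = exp (ln (real p))" using S[OF that(1)] by simp
      also have "\<dots> \<le> exp (lam * real N)" using that by simp
      finally show ?thesis by linarith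
    qed
    hence "{p \<in> S. ln (real p) \<le> lam * real N} \<subseteq> {..nat \<lceil>exp (lam * real N)\<rceil>}"
      by blast
    hence fin: "finite {p \<in> S. ln (real p) \<le> lam * real N}"
      by (rule finite_subset) simp
    have "(\<Sum>p\<in>{p \<in> T. f p = N}. 1 / real p) \<le> real (card {p \<in> T. f p = N}) * exp (- lam * (real N - 1))"
      by (rule sum_bounded_above[OF le])
    also have "\<dots> \<le> K * real N ^ D * exp (- lam * (real N - 1))"
      using card_mono[OF fin sub] K[of N] N by (intro mult_right_mono) auto
    finally show "(\<Sum>p\<in>{p \<in> T. f p = N}. 1 / real p) \<le> K * real N ^ D * exp (- lam * (real N - 1))" .
  qed
  also have "\<dots> \<le> (\<Sum>N. K * real N ^ D * exp (- lam * (real N - 1)))"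
  proof (rule sum_le_suminf[OF sm])
    fix N :: nat assume "N \<in> - {1..M}"
    have "0 \<le> K * real 1 ^ D" using K[of 1] by (meson le_refl of_nat_0_le_iff order.trans)
    hence "K \<ge> 0" by simp
    thus "0 \<le> K * real N ^ D * exp (- lam * (real N - 1))" by simp
  qed simp
  finally show "(\<Sum>p<m. if p \<in> S then 1 / real p else 0) \<le> (\<Sum>N. K * real N ^ D * exp (- lam * (real N - 1)))" .
qed simp

context imaginary_twists
begin

subsection \<open>Continuation and its poles\<close>

definition corrections :: "nat \<Rightarrow> (nat \<times> complex \<times> bool) list" where
  "corrections N = (SOME xs. approximating N xs)"

lemma approximating_corrections: "approximating N (corrections N)"
proof -
  have "\<exists>xs. approximating N xs" unfolding approximating_def by (rule exists_cyclotomic_approximation)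
  thus ?thesis unfolding corrections_def by (rule someI_ex)
qed

lemma admissible_corrections: "admissible N (corrections N)"
  using approximating_corrections[of N] by (simp add: approximating_def)

abbreviation domain :: "nat \<Rightarrow> complex set" where
  "domain N \<equiv> {s. Re s > 1 / real (Suc N)}"

lemma domain_facts: "open (domain N)" "connected (domain N)" "{s. Re s > 1} \<subseteq> domain N" "domain N \<subseteq> {s. Re s > 0}"
proof -
  show "open (domain N)" by (rule open_halfspace_Re_gt)
  show "connected (domain N)" by (intro convex_connected convex_halfspace_Re_gt)
  have "1 / real (Suc N) \<le> 1" "1 / real (Suc N) > 0" by simp_all
  thus "{s. Re s > 1} \<subseteq> domain N" "domain N \<subseteq> {s. Re s > 0}"
    by (intro subsetI; simp only: mem_Collect_eq; linarith)+
qed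

text \<open>By \<open>eprod_eq\<close> this is \<open>Z_abc\<close> for \<open>Re s > 1\<close>. At
  isolated points further left its value may be an artefact of division by zero, which
  \<open>continuation\<close> repairs with \<open>remove_sings\<close>.\<close>

definition local_cont :: "nat \<Rightarrow> complex \<Rightarrow> complex" where
  "local_cont N s = (\<Prod>x\<leftarrow>corrections N. inverse (zeta_factor x s)) / eprod (corrections N) s"

lemma holomorphic_xi_shift:
  assumes "w \<in> weights n" "n \<ge> 1"
  shows "(\<lambda>s. xi (of_nat n * s - w)) holomorphic_on {s. Re s > 0}"
proof -
  have "(xi \<circ> (\<lambda>s. of_nat n * s - w)) holomorphic_on {s. Re s > 0}"
    by (rule holomorphic_on_compose_gen[OF _ holomorphic_xi])
       (use assms Re_weight_shift in \<open>auto intro!: holomorphic_intros\<close>)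
  thus ?thesis by (simp add: o_def)
qed

lemma meromorphic_zeta_factor:
  assumes "admissible N xs" "x \<in> set xs"
  shows "zeta_factor x meromorphic_on {s. Re s > 0}"
proof -
  obtain n w t where x: "x = (n, w, t)" by (cases x) auto
  have nw: "w \<in> weights n" "n \<ge> 1" using assms x by (auto simp: admissible_def)
  have "(\<lambda>s. xi (of_nat n * s - w)) meromorphic_on {s. Re s > 0}"
    using holomorphic_xi_shift[OF nw]
    by (intro analytic_on_imp_meromorphic_on) (simp add: analytic_on_open open_halfspace_Re_gt)
  moreover have "(\<lambda>s. of_nat n * s - w - 1) meromorphic_on {s. Re s > 0}"
    by (intro meromorphic_intros)
  ultimately have "(\<lambda>s. xi (of_nat n * s - w) / (of_nat n * s - w - 1)) meromorphic_on {s. Re s > 0}"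
    by (intro meromorphic_intros)
  from this meromorphic_on_inverse[OF this] show ?thesis
    by (cases t) (simp_all add: zeta_factor_def[abs_def] x Let_def)
qed

lemma meromorphic_local_cont: "local_cont N meromorphic_on domain N"
proof -
  have e: "eprod (corrections N) meromorphic_on domain N"
    using holomorphic_eprod[OF approximating_corrections]
    by (intro analytic_on_imp_meromorphic_on) (simp add: analytic_on_open open_halfspace_Re_gt)
  have zf: "zeta_factor x meromorphic_on domain N" if "x \<in> set (corrections N)" for x
    by (rule meromorphic_on_subset[OF meromorphic_zeta_factor[OF admissible_corrections that] domain_facts(4)])
  have "(\<lambda>s. \<Prod>x\<leftarrow>xs. inverse (zeta_factor x s)) meromorphic_on domain N"
    if "set xs \<subseteq> set (corrections N)" for xs
    using that
  proof (induction xs)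
    case (Cons x xs)
    thus ?case using zf[of x] by (auto intro!: meromorphic_on_mult meromorphic_on_inverse)
  qed (auto intro: meromorphic_intros)
  from this[OF order.refl] e show ?thesis
    unfolding local_cont_def[abs_def] by (rule meromorphic_on_divide)
qed

lemma local_cont_eq:
  assumes "Re s > 1" shows "local_cont N s = Z_abc a b c s"
proof -
  have "(\<Prod>x\<leftarrow>corrections N. inverse (zeta_factor x s)) \<noteq> 0"
    using zeta_factor_nonzero[OF admissible_corrections _ assms] by (auto simp: prod_list_zero_iff)
  thus ?thesis
    using eprod_eq[OF admissible_corrections assms] Z_abc_eq[OF assms]
    by (simp add: local_cont_def field_simps)
qed

text \<open>The index, chosen from \<open>Re s\<close>, is large enough for \<open>s\<close> to lie
  in the corresponding \<open>domain\<close>. By the identity theorem every other admissible index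
  gives the same value, so this glues all the \<open>local_cont N\<close>.\<close>

definition continuation :: "complex \<Rightarrow> complex" where
  "continuation s = remove_sings (local_cont (nat \<lceil>1 / Re s\<rceil>)) s"

lemma remove_sings_local_cont_le:
  assumes "M \<le> N" "s \<in> domain M"
  shows "remove_sings (local_cont M) s = remove_sings (local_cont N) s"
proof -
  have sub: "domain M \<subseteq> domain N"
  proof -
    have "1 / real (Suc N) \<le> 1 / real (Suc M)" using assms by (simp add: frac_le)
    thus ?thesis by (auto simp del: of_nat_Suc)
  qed
  show ?thesis
  proof (rule remove_sings_eq_if_eq_on_open[OF meromorphic_local_cont
        meromorphic_on_subset[OF meromorphic_local_cont sub] domain_facts(1,2) _ domain_facts(3) _ _ assms(2)])
    show "open {s::complex. Re s > 1}" by (rule open_halfspace_Re_gt)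
    have "2 \<in> {s::complex. Re s > 1}" by simp
    thus "{s::complex. Re s > 1} \<noteq> {}" by blast
  qed (simp add: local_cont_eq)
qed

lemma continuation_eq:
  assumes "s \<in> domain N"
  shows "continuation s = remove_sings (local_cont N) s"
proof -
  define M where "M = nat \<lceil>1 / Re s\<rceil>"
  have s: "Re s > 0" using assms domain_facts(4) by auto
  have "1 / Re s \<le> real M" unfolding M_def by linarith
  hence "1 / Re s < real (Suc M)" by simp
  hence sM: "s \<in> domain M" using s by (simp add: field_simps)
  have "continuation s = remove_sings (local_cont M) s" by (simp add: continuation_def M_def)
  also have "\<dots> = remove_sings (local_cont N) s"
    using remove_sings_local_cont_le[OF _ sM, of N] remove_sings_local_cont_le[OF _ assms, of M]
      linear[of M N] by metis
  finally show ?thesis .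
qed

lemma nicely_meromorphic_continuation: "continuation nicely_meromorphic_on {s. Re s > 0}"
proof -
  have "continuation nicely_meromorphic_on (\<Union>N. domain N)"
  proof (rule nicely_meromorphic_on_UN)
    fix N
    show "continuation nicely_meromorphic_on domain N"
      by (rule nicely_meromorphic_on_open_cong[OF remove_sings_nicely_meromorphic[OF meromorphic_local_cont] domain_facts(1)])
         (simp add: continuation_eq)
  qed
  moreover have "{s. Re s > 0} \<subseteq> (\<Union>N. domain N)"
  proof
    fix s :: complex assume "s \<in> {s. Re s > 0}"
    hence "\<exists>N. inverse (real (Suc N)) < Re s" using reals_Archimedean[of "Re s"] by simp
    thus "s \<in> (\<Union>N. domain N)" by (auto simp: inverse_eq_divide)
  qed
  ultimately show ?thesis by (rule nicely_meromorphic_on_subset)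
qed

text \<open>Poles with \<open>Re s > 1\<close> are no exception: \<open>Z_abc\<close> takes the
  value \<open>0\<close> there, so it is nicely meromorphic and unchanged by
  \<open>remove_sings\<close>.\<close>

lemma continuation_eq_Z_abc:
  assumes "Re s > 1" shows "continuation s = Z_abc a b c s"
proof -
  have op: "open {s::complex. Re s > 1}" by (rule open_halfspace_Re_gt)
  have "eprod [] holomorphic_on {s. Re s > 1}"
    using holomorphic_eprod[OF approximating_Nil] by simp
  hence "(\<lambda>s. inverse (eprod [] s)) nicely_meromorphic_on {s. Re s > 1}"
    using op by (intro nicely_meromorphic_on_inverse analytic_on_imp_nicely_meromorphic_on) (simp add: analytic_on_open)
  hence nm: "Z_abc a b c nicely_meromorphic_on {s. Re s > 1}"
    by (rule nicely_meromorphic_on_open_cong[OF _ op]) (simp add: Z_abc_eq)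
  have "continuation s = remove_sings (local_cont 0) s"
    using assms by (intro continuation_eq) auto
  also have "\<dots> = remove_sings (Z_abc a b c) s"
  proof (rule remove_sings_cong[OF _ refl])
    have "eventually (\<lambda>z. z \<in> {s::complex. Re s > 1}) (at s)"
      using assms by (intro eventually_at_in_open' op) auto
    thus "eventually (\<lambda>z. local_cont 0 z = Z_abc a b c z) (at s)"
      by eventually_elim (simp add: local_cont_eq)
  qed
  also have "\<dots> = Z_abc a b c s"
    using remove_sings_nicely_meromorphic_eq[OF nm] assms by simp
  finally show ?thesis .
qed

text \<open>The condition on \<open>n s - w\<close> makes every zeta factor finite and nonzero at
  \<open>s\<close>, whatever its exponent, so the zero of \<open>eprod\<close> in the denominator is
  not cancelled.\<close>

lemma is_pole_continuation:
  assumes s: "s \<in> domain N" and p: "prime p" "local_fun p (of_nat p powr (-s)) = 0"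
    and nz: "\<And>n w. 1 \<le> n \<Longrightarrow> n \<le> N \<Longrightarrow> w \<in> weights n \<Longrightarrow>
      of_nat n * s - w \<noteq> 1 \<and> xi (of_nat n * s - w) \<noteq> 0"
  shows "is_pole continuation s"
proof -
  have Re: "Re s > 0" using s domain_facts(4) by auto
  define P where "P s = (\<Prod>x\<leftarrow>corrections N. inverse (zeta_factor x s))" for s
  have "isCont (\<lambda>s. inverse (zeta_factor x s)) s \<and> inverse (zeta_factor x s) \<noteq> 0"
    if x: "x \<in> set (corrections N)" for x
  proof -
    obtain n w t where nwt: "x = (n, w, t)" by (cases x) auto
    have nw: "1 \<le> n" "n \<le> N" "w \<in> weights n"
      using x nwt admissible_corrections[of N] by (auto simp: admissible_def)
    have "(\<lambda>s. xi (of_nat n * s - w)) analytic_on {s. Re s > 0}"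
      using holomorphic_xi_shift[OF nw(3,1)] by (simp add: analytic_on_open open_halfspace_Re_gt)
    hence "isCont (\<lambda>s. xi (of_nat n * s - w)) s"
      using Re by (intro analytic_at_imp_isCont) (auto intro: analytic_on_subset)
    thus ?thesis using nz[OF nw]
      by (cases t) (auto simp: zeta_factor_def nwt Let_def intro!: continuous_intros)
  qed
  hence "isCont (\<lambda>s. \<Prod>x\<leftarrow>xs. inverse (zeta_factor x s)) s \<and> (\<Prod>x\<leftarrow>xs. inverse (zeta_factor x s)) \<noteq> 0"
    if "set xs \<subseteq> set (corrections N)" for xs
    using that by (induction xs) (auto intro!: continuous_intros)
  hence P: "isCont P s" "P s \<noteq> 0" unfolding P_def by auto
  have hol: "eprod (corrections N) holomorphic_on domain N" by (rule holomorphic_eprod[OF approximating_corrections])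
  have e0: "eprod (corrections N) s = 0" using eprod_eq_0[OF approximating_corrections _ p] s by simp
  have "2 \<in> domain N" by (rule subsetD[OF domain_facts(3)]) simp
  moreover have "eprod (corrections N) 2 \<noteq> 0" by (rule eprod_nonzero[OF approximating_corrections]) simp
  ultimately obtain r where r: "0 < r" "ball s r \<subseteq> domain N"
    "\<And>z. z \<in> ball s r - {s} \<Longrightarrow> eprod (corrections N) z \<noteq> 0"
    using isolated_zeros[OF hol domain_facts(1,2) s e0] by metis
  have "filterlim (eprod (corrections N)) (at 0) (at s)"
  proof (rule filterlim_atI)
    have "isCont (eprod (corrections N)) s"
      using hol s domain_facts(1) holomorphic_on_imp_continuous_on continuous_on_eq_continuous_at by blast
    thus "(eprod (corrections N)) \<midarrow>s\<rightarrow> 0" using e0 by (simp add: isCont_def)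
    have "eventually (\<lambda>z. z \<in> ball s r - {s}) (at s)"
      using r(1) by (intro eventually_at_in_open) auto
    thus "eventually (\<lambda>z. eprod (corrections N) z \<noteq> 0) (at s)"
      by eventually_elim (use r(3) in auto)
  qed
  with P have "is_pole (\<lambda>s. P s / eprod (corrections N) s) s"
    by (intro is_pole_divide)
  hence "is_pole (local_cont N) s" by (simp add: local_cont_def[abs_def] P_def)
  hence pole: "is_pole (remove_sings (local_cont N)) s"
    using meromorphic_on_isolated_singularity[OF meromorphic_on_subset[OF meromorphic_local_cont, of "{s}"]] s
    by simp
  have "eventually (\<lambda>z. z \<in> domain N) (at s)"
    using s by (intro eventually_at_in_open' domain_facts)
  hence "eventually (\<lambda>z. remove_sings (local_cont N) z = continuation z) (at s)"
    by eventually_elim (simp add: continuation_eq)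
  thus ?thesis using pole is_pole_cong[of "remove_sings (local_cont N)" continuation s s] by simp
qed

subsection \<open>Cancellation is rare\<close>

text \<open>The points where a correcting factor of level \<open>N\<close> may cancel a pole. The
  bound \<open>1 / N\<close> lies strictly inside \<open>domain N\<close> and passes to
  \<open>v = n s - w\<close>, because \<open>Re v = n * Re s\<close>.\<close>

definition exceptional :: "real \<Rightarrow> nat \<Rightarrow> complex set" where
  "exceptional y N = {s. Re s \<ge> 1 / real N \<and> \<bar>Im s\<bar> \<le> y \<and>
     (\<exists>n w. 1 \<le> n \<and> n \<le> N \<and> w \<in> weights n \<and> (of_nat n * s - w = 1 \<or> xi (of_nat n * s - w) = 0))}"

text \<open>Such a point is \<open>(v + w) / n\<close>, with \<open>v\<close> equal to
  \<open>1\<close> or a zero of \<open>xi\<close> at height of order \<open>N\<close>. There are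
  \<open>N\<close> degrees, at most \<open>4 N^2\<close> shifts in each and of order
  \<open>N^6\<close> values of \<open>v\<close>, hence the exponent \<open>9\<close>.\<close>

lemma card_exceptional:
  assumes y: "y \<ge> 0"
  obtains A where "A \<ge> 0" "\<And>N. N \<ge> 1 \<Longrightarrow> finite (exceptional y N) \<and> real (card (exceptional y N)) \<le> A * real N ^ 9"
proof -
  define B where "B = y + (norm a + norm b + norm c)"
  obtain A where A: "A \<ge> 0"
    "\<And>N::nat. N \<ge> 1 \<Longrightarrow> finite {v. Re v \<ge> 1 / N \<and> \<bar>Im v\<bar> \<le> B * N \<and> xi v = 0} \<and>
       real (card {v. Re v \<ge> 1 / N \<and> \<bar>Im v\<bar> \<le> B * N \<and> xi v = 0}) \<le> A * real N ^ 6"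
    using xi_zeros_card[of B] y by (auto simp: B_def)
  show ?thesis
  proof (rule that[of "4 * (1 + A)"])
    fix N :: nat assume N: "N \<ge> 1"
    define Z where "Z = {v. Re v \<ge> 1 / N \<and> \<bar>Im v\<bar> \<le> B * N \<and> xi v = 0}"
    define E where "E n w = (\<lambda>v. (v + w) / of_nat n) ` insert 1 Z" for n :: nat and w :: complex
    have Z: "finite Z" "real (card Z) \<le> A * real N ^ 6" using A(2)[OF N] by (auto simp: Z_def)
    have sub: "exceptional y N \<subseteq> (\<Union>n\<in>{1..N}. \<Union>w\<in>weights n. E n w)"
    proof
      fix s assume s: "s \<in> exceptional y N"
      then obtain n w where nw: "1 \<le> n" "n \<le> N" "w \<in> weights n"
        "of_nat n * s - w = 1 \<or> xi (of_nat n * s - w) = 0" by (auto simp: exceptional_def)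
      define v where "v = of_nat n * s - w"
      have s_eq: "s = (v + w) / of_nat n" using nw by (simp add: v_def)
      have "v \<in> insert 1 Z"
      proof (cases "v = 1")
        case False
        have "1 / real N \<le> Re s" "\<bar>Im s\<bar> \<le> y" using s by (auto simp: exceptional_def)
        moreover have "Re s \<le> real n * Re s"
          using mult_right_mono[of 1 "real n" "Re s"] nw(1) \<open>1 / real N \<le> Re s\<close>
            order.trans[of 0 "1 / real N" "Re s"] by simp
        ultimately have 1: "Re v \<ge> 1 / real N" using nw(3) by (simp add: v_def Re_weights)
        have "\<bar>Im v\<bar> \<le> real n * \<bar>Im s\<bar> + \<bar>Im w\<bar>" 
          using abs_triangle_ineq4[of "real n * Im s" "Im w"] by (simp add: v_def abs_mult)
        also have "\<dots> \<le> real n * y + real n * (norm a + norm b + norm c)"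
          using norm_weights[OF nw(3)] abs_Im_le_cmod[of w] \<open>\<bar>Im s\<bar> \<le> y\<close> by (intro add_mono mult_left_mono) auto
        also have "\<dots> = real n * B" by (simp add: B_def algebra_simps)
        also have "\<dots> \<le> real N * B" using nw y by (intro mult_right_mono) (auto simp: B_def)
        finally show ?thesis using 1 nw(4) False by (simp add: Z_def v_def mult.commute)
      qed simp
      hence "s \<in> E n w" unfolding E_def s_eq by blast
      thus "s \<in> (\<Union>n\<in>{1..N}. \<Union>w\<in>weights n. E n w)" using nw by auto
    qed
    have finE: "finite (E n w)" for n w using Z by (simp add: E_def)
    have fin: "finite (\<Union>n\<in>{1..N}. \<Union>w\<in>weights n. E n w)"
      using finE finite_card_weights(1) by auto
    have cE: "real (card (E n w)) \<le> (1 + A) * real N ^ 6" for n w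
    proof -
      have "card (E n w) \<le> card (insert 1 Z)" unfolding E_def using Z by (intro card_image_le) simp
      also have "\<dots> \<le> Suc (card Z)" by (rule card_insert_le_m1[THEN order.trans]) auto
      finally have "real (card (E n w)) \<le> 1 + A * real N ^ 6" using Z by simp
      moreover have "1 \<le> real N ^ 6" using N by simp
      ultimately show ?thesis by (simp add: algebra_simps)
    qed
    have "card (exceptional y N) \<le> card (\<Union>n\<in>{1..N}. \<Union>w\<in>weights n. E n w)"
      by (rule card_mono[OF fin sub])
    also have "\<dots> \<le> (\<Sum>n\<in>{1..N}. card (\<Union>w\<in>weights n. E n w))" by (rule card_UN_le) simp
    also have "\<dots> \<le> (\<Sum>n\<in>{1..N}. \<Sum>w\<in>weights n. card (E n w))"
      by (intro sum_mono card_UN_le finite_card_weights)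
    finally have "real (card (exceptional y N)) \<le> real (\<Sum>n\<in>{1..N}. \<Sum>w\<in>weights n. card (E n w))"
      by (rule of_nat_mono)
    also have "\<dots> = (\<Sum>n\<in>{1..N}. \<Sum>w\<in>weights n. real (card (E n w)))"
      by (simp only: of_nat_sum)
    also have "\<dots> \<le> (\<Sum>n\<in>{1..N}. \<Sum>w\<in>weights n. (1 + A) * real N ^ 6)"
      by (intro sum_mono cE)
    also have "\<dots> \<le> (\<Sum>n\<in>{1..N}. 4 * real N ^ 2 * ((1 + A) * real N ^ 6))"
    proof (rule sum_mono)
      fix n assume n: "n \<in> {1..N}"
      have "real (card (weights n)) \<le> real ((n + 1) ^ 2)" using finite_card_weights(2)[of n] by (rule of_nat_mono)
      also have "\<dots> \<le> (2 * real N) ^ 2" using n unfolding of_nat_power by (intro power_mono) auto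
      finally have "real (card (weights n)) \<le> 4 * real N ^ 2" by (simp add: power_mult_distrib)
      thus "(\<Sum>w\<in>weights n. (1 + A) * real N ^ 6) \<le> 4 * real N ^ 2 * ((1 + A) * real N ^ 6)"
        using A(1) by (simp add: mult_right_mono)
    qed
    also have "\<dots> = 4 * (1 + A) * real N ^ 9" by (simp add: power_numeral_reduce)
    finally show "finite (exceptional y N) \<and> real (card (exceptional y N)) \<le> 4 * (1 + A) * real N ^ 9"
      using finite_subset[OF sub fin] by simp
  qed (use A in simp)
qed

section \<open>Local zeros near the boundary and the final count\<close>

text \<open>For the small root \<open>u\<close>, the solutions of \<open>p^(-s) = u\<close> are the
  values of \<open>- log u / ln p\<close>, spaced by \<open>2 pi i / ln p\<close>; \<open>k\<close>
  selects the lowest one with imaginary part at least \<open>y\<close>. The bounds on the real part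
  are those on \<open>norm u\<close>, with \<open>ln 3 \<le> 2\<close>.\<close>

lemma local_zeros_near:
  fixes y :: real
  assumes p: "prime p" and w: "prime_weight (Im (a + b - c)) (Im (a - b)) p \<ge> 1/16"
  obtains s where "local_fun p (of_nat p powr (-s)) = 0"
    "local_fun p (of_nat p powr (-(s + Complex 0 (2 * pi / ln (real p))))) = 0"
    "ln (9/8) \<le> Re s * ln (real p)" "Re s * ln (real p) \<le> 2"
    "y \<le> Im s" "(Im s - y) * ln (real p) \<le> 2 * pi"
proof -
  define l where "l = ln (real p)"
  have p0: "p > 0" using p by (rule prime_gt_0_nat)
  have l: "l > 0" using prime_gt_1_nat[OF p] by (simp add: l_def)
  obtain u where u: "1 - (twist a p + twist b p) * u + twist c p * u ^ 2 = 0" "1/3 \<le> norm u" "norm u \<le> 8/9"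
    using quadratic_small_root[OF _ _ _ twist_weight[OF w]] Re_abc norm_twist by metis
  have u0: "u \<noteq> 0" using u by auto
  define k where "k = \<lceil>(y * l + Im (Ln u)) / (2 * pi)\<rceil>"
  define z where "z = - Ln u + 2 * of_int k * of_real pi * \<i>"
  define s where "s = z / of_real l"
  have pow: "of_nat p powr (-z / of_real l) = exp (- z)" for z :: complex
  proof -
    have "of_nat p powr w = exp (w * of_real l)" for w :: complex
      by (simp add: of_nat_powr_eq_twist[OF p0] twist_def l_def)
    thus ?thesis using l by simp
  qed
  have "exp (- z) = exp (Ln u) / exp (2 * of_int k * of_real pi * \<i>)"
    by (simp add: z_def exp_diff[symmetric])
  also have "\<dots> = u" using u0 exp_integer_2pi[of "of_int k"] by simp
  finally have e1: "exp (- z) = u" .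
  have e2: "exp (- (z + 2 * of_real pi * \<i>)) = u"
  proof -
    have "exp (- (z + 2 * of_real pi * \<i>)) = exp (- z - 2 * of_real pi * \<i>)" by simp
    also have "\<dots> = exp (- z) / exp (2 * of_real pi * \<i>)" by (rule exp_diff)
    finally have "exp (- (z + 2 * of_real pi * \<i>)) = exp (- z) / exp (2 * of_real pi * \<i>)" .
    thus ?thesis using e1 by (simp add: exp_two_pi_i)
  qed
  have s2: "s + Complex 0 (2 * pi / ln (real p)) = (z + 2 * of_real pi * \<i>) / of_real l"
    using l by (simp add: s_def l_def[symmetric] complex_eq_iff add_divide_distrib)
  have k: "(y * l + Im (Ln u)) / (2 * pi) \<le> of_int k" "of_int k < (y * l + Im (Ln u)) / (2 * pi) + 1"
    unfolding k_def by linarith+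
  have Re: "Re s * l = - ln (norm u)" using l u0 by (simp add: s_def z_def)
  have Im: "Im s * l = 2 * pi * of_int k - Im (Ln u)" using l by (simp add: s_def z_def mult_ac)
  show ?thesis
  proof (rule that[of s])
    show "local_fun p (of_nat p powr (-s)) = 0"
      using pow[of z] e1 u(1) by (simp add: s_def local_fun_def)
    show "local_fun p (of_nat p powr (-(s + Complex 0 (2 * pi / ln (real p))))) = 0"
      unfolding s2 using pow[of "z + 2 * of_real pi * \<i>"] e2 u(1)
      by (simp only: local_fun_def minus_divide_left)
    have "ln (norm u) \<le> ln (8/9)" using u u0 by (intro ln_mono) auto
    also have "ln (8/9 :: real) = - ln (9/8)" using ln_div[of 8 9] ln_div[of 9 8] by simp
    finally show "ln (9/8) \<le> Re s * ln (real p)" using Re by (simp add: l_def)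
    have "ln (1/3) \<le> ln (norm u)" using u u0 by (intro ln_mono) auto
    hence "- ln (norm u) \<le> ln 3" by (simp add: ln_div)
    also have "ln 3 \<le> (2::real)" using ln_le_minus_one[of 3] by simp
    finally show "Re s * ln (real p) \<le> 2" using Re by (simp add: l_def)
    have "y * l \<le> Im s * l" using k(1) unfolding Im by (simp add: field_simps)
    thus "y \<le> Im s" using l by simp
    have "Im s * l \<le> y * l + 2 * pi" using k(2) unfolding Im by (simp add: field_simps)
    thus "(Im s - y) * ln (real p) \<le> 2 * pi" by (simp add: l_def algebra_simps)
  qed
qed

lemma poles_accumulate:
  assumes abc: "a + b \<noteq> c" and z: "Re z = 0"
  shows "z islimpt {s \<in> {s. Re s > 0}. is_pole continuation s}"
  unfolding islimpt_approachable
proof (intro allI impI, rule ccontr)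
  fix e0 :: real assume e0: "e0 > 0"
  assume none: "\<not> (\<exists>x'\<in>{s \<in> {s. Re s > 0}. is_pole continuation s}. x' \<noteq> z \<and> dist x' z < e0)"
  define e where "e = min e0 1"
  have e: "e > 0" "e \<le> e0" "e \<le> 1" using e0 by (auto simp: e_def)
  have no_pole: "\<not> is_pole continuation s" if "Re s > 0" "norm (s - z) < e" for s
  proof
    assume "is_pole continuation s"
    moreover have "s \<noteq> z" using that z by auto
    moreover have "dist s z < e0" using that e by (simp add: dist_norm)
    ultimately show False using none that by blast
  qed
  define t where "t = Im (a + b - c)"
  have t: "t \<noteq> 0" using abc Re_abc by (auto simp: t_def complex_eq_iff)
  define W where "W p \<longleftrightarrow> prime p \<and> prime_weight t (Im (a - b)) p \<ge> 1/16" for p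
  \<comment> \<open>For such \<open>p\<close> both chosen zeros are within
    \<open>18 / ln p < e\<close> of \<open>z\<close>: at most \<open>2 / ln p\<close> horizontally
    and, as \<open>2 pi < 8\<close>, at most \<open>16 / ln p\<close> vertically.\<close>
  define S where "S = {p. W p \<and> ln (real p) > 18 / e}"
  \<comment> \<open>With this constant, \<open>ln p \<le> lam * N\<close> turns the bound
    \<open>lam \<le> Re s * ln p\<close> for the chosen zeros into \<open>Re s \<ge> 1 / N\<close>,
    as \<open>exceptional\<close> requires.\<close>
  define lam where "lam = ln (9/8 :: real)"
  have lam: "lam > 0" by (simp add: lam_def)
  define y where "y = \<bar>Im z\<bar> + 1"
  obtain A where A: "A \<ge> 0"
    "\<And>N. N \<ge> 1 \<Longrightarrow> finite (exceptional y N) \<and> real (card (exceptional y N)) \<le> A * real N ^ 9"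
    using card_exceptional[of y] by (auto simp: y_def)
  have "\<exists>s. s \<in> exceptional y N \<and> s + Complex 0 (2 * pi / ln (real p)) \<in> exceptional y N"
    if N: "N \<ge> 1" and p: "p \<in> S" "ln (real p) \<le> lam * real N" for p N
  proof -
    have pp: "prime p" "prime_weight t (Im (a - b)) p \<ge> 1/16" "ln (real p) > 18 / e"
      using p by (auto simp: S_def W_def)
    define l where "l = ln (real p)"
    have l: "l > 0" using pp(3) e by (simp add: l_def less_trans[rotated])
    have le: "18 / l < e" using pp(3) e l by (simp add: field_simps l_def)
    obtain s where s: "local_fun p (of_nat p powr (-s)) = 0"
      "local_fun p (of_nat p powr (-(s + Complex 0 (2 * pi / l)))) = 0"
      "lam \<le> Re s * l" "Re s * l \<le> 2" "Im z \<le> Im s" "(Im s - Im z) * l \<le> 2 * pi"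
      using local_zeros_near[OF pp(1), of "Im z"] pp(2) unfolding t_def l_def lam_def by metis
    have pi: "pi < 4" by (rule pi_less_4)
    have "l * 1 \<le> lam * real N" using p(2) by (simp add: l_def)
    also have "\<dots> \<le> (Re s * l) * real N" using s(3) by (intro mult_right_mono) auto
    also have "\<dots> = l * (Re s * real N)" by simp
    finally have "1 \<le> Re s * real N" using l by (simp only: mult_le_cancel_left_pos)
    hence ReN: "Re s \<ge> 1 / real N" using N by (simp add: field_simps)
    have b1: "Re s \<le> 2 / l" "Im s - Im z \<le> 8 / l" "2 * pi / l \<le> 8 / l"
      using s(4,6) l pi by (simp_all add: field_simps)
    have exc: "s' \<in> exceptional y N"
      if s': "Re s' = Re s" "Im z \<le> Im s'" "Im s' - Im z \<le> 16 / l" "local_fun p (of_nat p powr (-s')) = 0" for s'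
    proof -
      have "1 / real N > 0" using N by simp
      hence "Re s' > 0" using s'(1) ReN by linarith
      have "norm (s' - z) \<le> \<bar>Re s'\<bar> + \<bar>Im s' - Im z\<bar>" using cmod_le[of "s' - z"] z by simp
      also have "\<dots> \<le> 2 / l + 16 / l" using s' b1 \<open>Re s' > 0\<close> by (intro add_mono) auto
      also have "\<dots> = 18 / l" by (simp add: add_divide_distrib[symmetric])
      finally have near: "norm (s' - z) < e" using le by simp
      have "\<bar>Im s' - Im z\<bar> \<le> norm (s' - z)" using abs_Im_le_cmod[of "s' - z"] by simp
      hence Im: "\<bar>Im s'\<bar> \<le> y" using near e by (simp add: y_def)
      have "1 / real (Suc N) < 1 / real N" using N by (simp add: field_simps)
      hence dom: "s' \<in> domain N" using ReN s' by simp
      have "\<not> is_pole continuation s'" using no_pole[OF \<open>Re s' > 0\<close> near] .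
      hence "\<exists>n w. 1 \<le> n \<and> n \<le> N \<and> w \<in> weights n \<and>
          (of_nat n * s' - w = 1 \<or> xi (of_nat n * s' - w) = 0)"
        using is_pole_continuation[OF dom pp(1) s'(4)] by blast
      thus ?thesis using ReN s' Im by (simp add: exceptional_def)
    qed
    have "s \<in> exceptional y N" using s b1 l by (intro exc) (auto intro: order.trans divide_right_mono)
    moreover have "s + Complex 0 (2 * pi / l) \<in> exceptional y N"
    proof (rule exc)
      have "0 \<le> 2 * pi / l" using l by simp
      thus "Im z \<le> Im (s + Complex 0 (2 * pi / l))" using s(5) by simp
      have "(Im s - Im z) + 2 * pi / l \<le> 8 / l + 8 / l" using b1 by (intro add_mono)
      also have "\<dots> = 16 / l" by (simp add: add_divide_distrib[symmetric])
      finally show "Im (s + Complex 0 (2 * pi / l)) - Im z \<le> 16 / l" by simp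
    qed (use s in simp_all)
    ultimately show ?thesis unfolding l_def by blast
  qed
  then obtain f where f: "\<And>N p. N \<ge> 1 \<Longrightarrow> p \<in> S \<Longrightarrow> ln (real p) \<le> lam * real N \<Longrightarrow>
      f N p \<in> exceptional y N \<and> f N p + Complex 0 (2 * pi / ln (real p)) \<in> exceptional y N"
    by metis
  have card: "real (card {p \<in> S. ln (real p) \<le> lam * real N}) \<le> A ^ 2 * real N ^ 18" if N: "N \<ge> 1" for N
  proof -
    define h where "h p = (f N p, f N p + Complex 0 (2 * pi / ln (real p)))" for p
    have fin: "finite (exceptional y N)" and cd: "real (card (exceptional y N)) \<le> A * real N ^ 9"
      using A(2)[OF N] by auto
    \<comment> \<open>The difference of the two components of \<open>h p\<close> is
      \<open>2 pi i / ln p\<close>, which determines \<open>p\<close>.\<close>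
    have "inj_on h {p \<in> S. ln (real p) \<le> lam * real N}"
    proof (rule inj_onI)
      fix p q assume pq: "p \<in> {p \<in> S. ln (real p) \<le> lam * real N}" "q \<in> {p \<in> S. ln (real p) \<le> lam * real N}"
        and eq: "h p = h q"
      have pos: "ln (real p) > 0" "ln (real q) > 0" "real p > 0" "real q > 0"
        using pq prime_gt_1_nat prime_gt_0_nat by (auto simp: S_def W_def)
      have "2 * pi / ln (real p) = 2 * pi / ln (real q)"
      proof -
        have "f N p + Complex 0 (2 * pi / ln (real p)) = f N p + Complex 0 (2 * pi / ln (real q))"
          using eq unfolding h_def by (metis prod.inject)
        hence "Complex 0 (2 * pi / ln (real p)) = Complex 0 (2 * pi / ln (real q))" by (rule add_left_imp_eq)
        thus ?thesis by (rule complex.inject[THEN iffD1, THEN conjunct2])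
      qed
      hence "ln (real p) = ln (real q)" using pos by (simp add: field_simps)
      thus "p = q" using pos by simp
    qed
    hence "card {p \<in> S. ln (real p) \<le> lam * real N} \<le> card (exceptional y N \<times> exceptional y N)"
      using f[OF N] fin by (intro card_inj_on_le[of h]) (auto simp: h_def)
    hence "real (card {p \<in> S. ln (real p) \<le> lam * real N}) \<le> real (card (exceptional y N)) * real (card (exceptional y N))"
      by (simp add: card_cartesian_product flip: of_nat_mult)
    also have "\<dots> \<le> (A * real N ^ 9) * (A * real N ^ 9)" using cd A(1) by (intro mult_mono) auto
    also have "\<dots> = A ^ 2 * real N ^ 18" by (simp add: power2_eq_square power_add[symmetric])
    finally show ?thesis .
  qed
  have sm: "summable (\<lambda>N. A ^ 2 * real N ^ 18 * exp (- lam * (real N - 1)))"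
  proof (rule summable_comparison_test_bigo)
    show "summable (\<lambda>N. norm (real N powr (-2)))" by (simp add: summable_real_powr_iff)
    show "(\<lambda>N. A ^ 2 * real N ^ 18 * exp (- lam * (real N - 1))) \<in> O(\<lambda>N. real N powr (-2))"
      using lam by real_asymp
  qed
  have sS: "summable (\<lambda>p. if p \<in> S then 1 / real p else 0)"
    by (rule summable_inverse_if_few[OF _ lam card sm]) (auto simp: S_def W_def prime_ge_2_nat)
  \<comment> \<open>Leaving out the finitely many primes with \<open>ln p \<le> 18 / e\<close> does
    not affect summability.\<close>
  have "filterlim (\<lambda>p. ln (real p)) at_top sequentially" by real_asymp
  hence "eventually (\<lambda>p. ln (real p) > 18 / e) sequentially" by (simp add: filterlim_at_top_dense)
  hence "eventually (\<lambda>p. (if p \<in> S then 1 / real p else 0) =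
      (if prime p \<and> prime_weight t (Im (a - b)) p \<ge> 1/16 then 1 / real p else 0)) sequentially"
    by eventually_elim (simp add: S_def W_def)
  from summable_cong[OF this] sS
  have "summable (\<lambda>p. if prime p \<and> prime_weight t (Im (a - b)) p \<ge> 1/16 then 1 / real p else 0)"
    by (rule iffD1)
  thus False using not_summable_weighted_primes[OF t] by blast
qed

end

theorem theoremB:
  fixes a b c :: complex
  assumes "Re a = 0" and "Re b = 0" and "Re c = 0"
  shows "(\<forall>s. Re s > 1 \<longrightarrow> abs_convergent_prod (euler_factor a b c s)) \<and>
    (a + b \<noteq> c \<longrightarrow>
      (\<exists>F. F nicely_meromorphic_on {s. Re s > 0} \<and>
           (\<forall>s. Re s > 1 \<longrightarrow> F s = Z_abc a b c s) \<and>
           natural_boundary F {s. Re s > 0} {s. Re s = 0} \<and>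
           (\<forall>z. Re z = 0 \<longrightarrow> z islimpt {s. Re s > 0 \<and> is_pole F s})))"
proof -
  interpret imaginary_twists a b c by unfold_locales fact+
  have "natural_boundary continuation {s. Re s > 0} {s. Re s = 0}" if "a + b \<noteq> c"
    using poles_accumulate[OF that] by (intro natural_boundaryI) (auto simp: open_halfspace_Re_gt)
  thus ?thesis
    using abs_convergent_euler_factor nicely_meromorphic_continuation continuation_eq_Z_abc poles_accumulate
    by (intro conjI allI impI exI[of _ continuation]) auto
qed

end
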